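(* Let $n\ge 1$, let $G$ be a finitely generated group with property ${\rm F}\mathcal{B}_{\widetilde{A}_n}$, and let $\rho:G\rightarrow \mathrm{GL}_{n+1}(\mathbb{Q})$ be a linear representation (a group homomorphism). If there exists a positive definite quadratic form on $\mathbb{Q}^{n+1}$ which is invariant under $\rho(G)$, then $\rho(G)$ is finite.
   Context: The Coxeter group $W$ of type $\widetilde{A}_n$ ($n\ge 1$) is the infinite dihedral group with its two standard generating involutions if $n=1$; for $n\ge 2$ it has generators $s_0,\dots,s_n$ (indices mod $n+1$) with relations $s_i^2=1$, $(s_is_{i+1})^3=1$, and $(s_is_j)^2=1$ for $j\ne i,i\pm1$. Its Coxeter complex is the simplicial complex whose simplices are the cosets $wW_J$ ($w\in W$, $J\subsetneq I=\{s_0,\dots,s_n\}$, $W_J=\langle J\rangle$), ordered by reverse inclusion. A building of type $\widetilde{A}_n$ is a simplicial complex that is a union of subcomplexes (apartments), each isomorphic to this Coxeter complex, such that any two simplices lie in a common apartment, and for any two apartments containing simplices $A$ and $B$ there is an isomorphism between the apartments fixing $A$ and $B$ pointwise. Buildings are not assumed thick (the Coxeter complex itself is a building). Such a building has a type function (vertex coloring) with values in a set of $n+1$ types, such that the vertices of every maximal simplex (chamber) have pairwise distinct types and realize all types. A simplicial action is type preserving (color-preserving) if every group element preserves the type of every vertex. A group $G$ has property ${\rm F}\mathcal{B}_{\widetilde{A}_n}$ if every simplicial type preserving action of $G$ on any building of type $\widetilde{A}_n$ has a fixed point (in the geometric realisation). *)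

theory Defs
  imports
    Complex_Main
    "HOL-Algebra.Coset"
    "HOL-Algebra.Generated_Groups"
    "HOL-Algebra.Group_Action"
    "Jordan_Normal_Form.Matrix"
begin

text \<open>
  The relators of the presentation. Indices live in \<open>{..n}\<close> and are read modulo
  \<open>n + 1\<close>. For \<open>n = 1\<close> only the relators \<open>s\<^sub>i s\<^sub>i\<close> remain, so that the
  presented group is the infinite dihedral group.
\<close>

definition coxeter_relators :: "nat \<Rightarrow> nat list set" where
  "coxeter_relators n =
     {[i, i] | i. i \<le> n}
   \<union> {[i, j, i, j, i, j] | i j. n \<ge> 2 \<and> i \<le> n \<and> j = Suc i mod Suc n}
   \<union> {[i, j, i, j] | i j. n \<ge> 2 \<and> i \<le> n \<and> j \<le> n \<and> j \<noteq> i
        \<and> j \<noteq> Suc i mod Suc n \<and> i \<noteq> Suc j mod Suc n}"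

text \<open>
  Equality of two words in the presented group: the congruence on the free monoid over the
  generators generated by \<open>r \<sim> []\<close> for all relators \<open>r\<close>. Formal inverses of generators are
  not needed, since every generator is its own inverse by the relator \<open>[i, i]\<close>.
\<close>

inductive coxeter_eq :: "nat \<Rightarrow> nat list \<Rightarrow> nat list \<Rightarrow> bool" for n where
  relator: "r \<in> coxeter_relators n \<Longrightarrow> u \<in> lists {..n} \<Longrightarrow> v \<in> lists {..n} \<Longrightarrow>
    coxeter_eq n (u @ r @ v) (u @ v)"
| refl: "w \<in> lists {..n} \<Longrightarrow> coxeter_eq n w w"
| sym: "coxeter_eq n u v \<Longrightarrow> coxeter_eq n v u"
| trans: "coxeter_eq n u v \<Longrightarrow> coxeter_eq n v w \<Longrightarrow> coxeter_eq n u w"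

definition coxeter_class :: "nat \<Rightarrow> nat list \<Rightarrow> nat list set" where
  "coxeter_class n w = {u. coxeter_eq n w u}"

definition coxeter_group :: "nat \<Rightarrow> nat list set monoid" where
  "coxeter_group n =
     \<lparr>partial_object.carrier = coxeter_class n ` lists {..n},
      monoid.mult = (\<lambda>A B. {w. \<exists>u\<in>A. \<exists>v\<in>B. coxeter_eq n (u @ v) w}),
      monoid.one = coxeter_class n []\<rparr>"

lemma coxeter_relators_lists: "r \<in> coxeter_relators n \<Longrightarrow> r \<in> lists {..n}"
  by (auto simp: coxeter_relators_def)

lemma coxeter_eq_lists: "coxeter_eq n u v \<Longrightarrow> u \<in> lists {..n} \<and> v \<in> lists {..n}"
  by (induction rule: coxeter_eq.induct) (use coxeter_relators_lists in auto)

lemma coxeter_eq_append_context: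
  assumes "coxeter_eq n u v" "x \<in> lists {..n}" "y \<in> lists {..n}"
  shows "coxeter_eq n (x @ u @ y) (x @ v @ y)"
  using assms
proof (induction rule: coxeter_eq.induct)
  case (relator r u v)
  then show ?case using coxeter_eq.relator[of r n "x @ u" "v @ y"] by auto
next
  case (refl w)
  then show ?case by (auto intro!: coxeter_eq.refl)
qed (blast intro: coxeter_eq.sym coxeter_eq.trans)+

lemma coxeter_eq_append:
  assumes "coxeter_eq n u u'" "coxeter_eq n v v'"
  shows "coxeter_eq n (u @ v) (u' @ v')"
  using coxeter_eq_append_context[OF assms(1), of "[]" v]
    coxeter_eq_append_context[OF assms(2), of u' "[]"]
    coxeter_eq_lists[OF assms(1)] coxeter_eq_lists[OF assms(2)]
  by (auto intro: coxeter_eq.trans)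

lemma coxeter_eq_rev_append: "w \<in> lists {..n} \<Longrightarrow> coxeter_eq n (rev w @ w) []"
proof (induction w)
  case Nil
  then show ?case by (auto intro: coxeter_eq.refl)
next
  case (Cons i w)
  have "coxeter_eq n (rev w @ [i, i] @ w) (rev w @ w)"
    using Cons.prems by (intro coxeter_eq.relator) (auto simp: coxeter_relators_def)
  with Cons show ?case by (auto intro: coxeter_eq.trans)
qed

lemma coxeter_class_eq_iff:
  "u \<in> lists {..n} \<Longrightarrow> coxeter_class n u = coxeter_class n v \<longleftrightarrow> coxeter_eq n u v"
  unfolding coxeter_class_def
  by (metis (mono_tags) Collect_cong coxeter_eq.refl coxeter_eq.sym coxeter_eq.trans mem_Collect_eq)

lemma coxeter_mult_class:
  assumes "u \<in> lists {..n}" "v \<in> lists {..n}"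
  shows "coxeter_class n u \<otimes>\<^bsub>coxeter_group n\<^esub> coxeter_class n v = coxeter_class n (u @ v)"
  using assms unfolding coxeter_group_def coxeter_class_def
  by (auto intro: coxeter_eq.refl coxeter_eq.trans coxeter_eq_append)

lemma group_coxeter_group: "group (coxeter_group n)"
proof (rule groupI)
  fix x y z
  have carr: "carrier (coxeter_group n) = coxeter_class n ` lists {..n}"
    and one: "\<one>\<^bsub>coxeter_group n\<^esub> = coxeter_class n []"
    by (simp_all add: coxeter_group_def)
  show "\<one>\<^bsub>coxeter_group n\<^esub> \<in> carrier (coxeter_group n)"
    unfolding carr one by (rule imageI) simp
  assume "x \<in> carrier (coxeter_group n)"
  then obtain u where u: "x = coxeter_class n u" "u \<in> lists {..n}" unfolding carr by blast
  show "\<one>\<^bsub>coxeter_group n\<^esub> \<otimes>\<^bsub>coxeter_group n\<^esub> x = x"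
    using u coxeter_mult_class[of "[]" n u] by (simp add: one)
  have "coxeter_class n (rev u) \<otimes>\<^bsub>coxeter_group n\<^esub> x = \<one>\<^bsub>coxeter_group n\<^esub>"
    using u coxeter_eq_rev_append[of u n] by (simp add: one coxeter_mult_class coxeter_class_eq_iff in_lists_conv_set)
  moreover have "coxeter_class n (rev u) \<in> carrier (coxeter_group n)"
    unfolding carr using u by (intro imageI) (simp add: in_lists_conv_set)
  ultimately show "\<exists>y\<in>carrier (coxeter_group n). y \<otimes>\<^bsub>coxeter_group n\<^esub> x = \<one>\<^bsub>coxeter_group n\<^esub>"
    by blast
  assume "y \<in> carrier (coxeter_group n)"
  then obtain v where v: "y = coxeter_class n v" "v \<in> lists {..n}" unfolding carr by blast
  show "x \<otimes>\<^bsub>coxeter_group n\<^esub> y \<in> carrier (coxeter_group n)"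
    unfolding carr u v coxeter_mult_class[OF u(2) v(2)] using u v by (intro imageI) simp
  assume "z \<in> carrier (coxeter_group n)"
  then obtain w where w: "z = coxeter_class n w" "w \<in> lists {..n}" unfolding carr by blast
  show "x \<otimes>\<^bsub>coxeter_group n\<^esub> y \<otimes>\<^bsub>coxeter_group n\<^esub> z = x \<otimes>\<^bsub>coxeter_group n\<^esub> (y \<otimes>\<^bsub>coxeter_group n\<^esub> z)"
    using u v w by (simp add: coxeter_mult_class)
qed

definition coxeter_gen :: "nat \<Rightarrow> nat \<Rightarrow> nat list set" where
  "coxeter_gen n i = coxeter_class n [i]"

text \<open>
  The Coxeter complex, given by its poset of (nonempty) simplices: the cosets \<open>w W\<^sub>J\<close> for
  proper subsets \<open>J\<close> of the generators. The face relation is reverse inclusion.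
\<close>

definition coxeter_complex :: "nat \<Rightarrow> nat list set set set" where
  "coxeter_complex n =
     {w <#\<^bsub>coxeter_group n\<^esub> generate (coxeter_group n) (coxeter_gen n ` J) | w J.
        w \<in> carrier (coxeter_group n) \<and> J \<subset> {..n}}"

text \<open>The empty set is not counted as a simplex; the set of vertices of \<open>K\<close> is \<open>\<Union>K\<close>.\<close>

definition abstract_complex :: "'v set set \<Rightarrow> bool" where
  "abstract_complex K \<longleftrightarrow>
     (\<forall>A\<in>K. finite A \<and> A \<noteq> {}) \<and> (\<forall>A\<in>K. \<forall>B. B \<noteq> {} \<and> B \<subseteq> A \<longrightarrow> B \<in> K)"

definition complex_iso :: "'v set set \<Rightarrow> 'w set set \<Rightarrow> ('v \<Rightarrow> 'w) \<Rightarrow> bool" where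
  "complex_iso K L f \<longleftrightarrow>
     bij_betw f (\<Union>K) (\<Union>L) \<and> (\<forall>A. A \<subseteq> \<Union>K \<longrightarrow> (A \<in> K \<longleftrightarrow> f ` A \<in> L))"

definition is_coxeter_complex :: "nat \<Rightarrow> 'v set set \<Rightarrow> bool" where
  "is_coxeter_complex n K \<longleftrightarrow>
     (\<exists>f. bij_betw f K (coxeter_complex n) \<and> (\<forall>A\<in>K. \<forall>B\<in>K. A \<subseteq> B \<longleftrightarrow> f B \<subseteq> f A))"

text \<open>
  The requirement \<open>K \<noteq> {}\<close> excludes the empty complex with the empty apartment system. Under
  the convention that counts the empty set as a simplex, it is part of the axiom that any two
  simplices lie in a common apartment.
\<close>

definition apartment_system :: "nat \<Rightarrow> 'v set set \<Rightarrow> 'v set set set \<Rightarrow> bool" where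
  "apartment_system n K \<A> \<longleftrightarrow>
     (\<forall>\<Sigma>\<in>\<A>. abstract_complex \<Sigma> \<and> \<Sigma> \<subseteq> K \<and> is_coxeter_complex n \<Sigma>) \<and>
     K = \<Union>\<A> \<and>
     (\<forall>A\<in>K. \<forall>B\<in>K. \<exists>\<Sigma>\<in>\<A>. A \<in> \<Sigma> \<and> B \<in> \<Sigma>) \<and>
     (\<forall>\<Sigma>\<in>\<A>. \<forall>\<Sigma>'\<in>\<A>. \<forall>A B. A \<in> \<Sigma> \<and> B \<in> \<Sigma> \<and> A \<in> \<Sigma>' \<and> B \<in> \<Sigma>' \<longrightarrow>
        (\<exists>f. complex_iso \<Sigma> \<Sigma>' f \<and> (\<forall>v \<in> A \<union> B. f v = v)))"

definition building :: "nat \<Rightarrow> 'v set set \<Rightarrow> bool" where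
  "building n K \<longleftrightarrow> abstract_complex K \<and> K \<noteq> {} \<and> (\<exists>\<A>. apartment_system n K \<A>)"

definition chamber :: "'v set set \<Rightarrow> 'v set \<Rightarrow> bool" where
  "chamber K C \<longleftrightarrow> C \<in> K \<and> (\<forall>A\<in>K. C \<subseteq> A \<longrightarrow> A = C)"

definition type_function :: "nat \<Rightarrow> 'v set set \<Rightarrow> ('v \<Rightarrow> nat) \<Rightarrow> bool" where
  "type_function n K \<tau> \<longleftrightarrow> (\<forall>C. chamber K C \<longrightarrow> bij_betw \<tau> C {..n})"

definition simplicial_action ::
  "('g, 'm) monoid_scheme \<Rightarrow> 'v set set \<Rightarrow> ('g \<Rightarrow> 'v \<Rightarrow> 'v) \<Rightarrow> bool" where
  "simplicial_action G K \<phi> \<longleftrightarrow>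
     group_action G (\<Union>K) \<phi> \<and> (\<forall>g\<in>carrier G. \<forall>A\<in>K. \<phi> g ` A \<in> K)"

definition type_preserving ::
  "('g, 'm) monoid_scheme \<Rightarrow> 'v set set \<Rightarrow> ('v \<Rightarrow> nat) \<Rightarrow> ('g \<Rightarrow> 'v \<Rightarrow> 'v) \<Rightarrow> bool" where
  "type_preserving G K \<tau> \<phi> \<longleftrightarrow> (\<forall>g\<in>carrier G. \<forall>v\<in>\<Union>K. \<tau> (\<phi> g v) = \<tau> v)"

text \<open>Points of the geometric realisation in barycentric coordinates.\<close>

definition realisation :: "'v set set \<Rightarrow> ('v \<Rightarrow> real) set" where
  "realisation K =
     {x. (\<forall>v. 0 \<le> x v) \<and> {v. x v \<noteq> 0} \<in> K \<and> (\<Sum>v | x v \<noteq> 0. x v) = 1}"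

text \<open>The affine extension of a vertex map to the geometric realisation.\<close>

definition realisation_map :: "('v \<Rightarrow> 'w) \<Rightarrow> ('v \<Rightarrow> real) \<Rightarrow> 'w \<Rightarrow> real" where
  "realisation_map f x = (\<lambda>w. \<Sum>v | x v \<noteq> 0 \<and> f v = w. x v)"

definition has_fixed_point ::
  "('g, 'm) monoid_scheme \<Rightarrow> 'v set set \<Rightarrow> ('g \<Rightarrow> 'v \<Rightarrow> 'v) \<Rightarrow> bool" where
  "has_fixed_point G K \<phi> \<longleftrightarrow>
     (\<exists>x\<in>realisation K. \<forall>g\<in>carrier G. realisation_map (\<phi> g) x = x)"

text \<open>
  A proposition of HOL cannot quantify over types, so the property is relative to the type
  \<open>'v\<close> of vertices. For a finitely generated, hence countable, group it does not depend
  on the choice of an infinite \<open>'v\<close>: every building with a type preserving action contains a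
  countable invariant subbuilding, obtained by closing up a simplex under the action and the
  choice of an apartment (in the complete apartment system) through any two given simplices.
\<close>

definition property_FB :: "'v itself \<Rightarrow> nat \<Rightarrow> ('g, 'm) monoid_scheme \<Rightarrow> bool" where
  "property_FB _ n G \<longleftrightarrow>
     (\<forall>(K :: 'v set set) \<tau> \<phi>.
        building n K \<and> type_function n K \<tau> \<and> simplicial_action G K \<phi> \<and>
        type_preserving G K \<tau> \<phi> \<longrightarrow> has_fixed_point G K \<phi>)"

definition finitely_generated :: "('g, 'm) monoid_scheme \<Rightarrow> bool" where
  "finitely_generated G \<longleftrightarrow> (\<exists>S. finite S \<and> S \<subseteq> carrier G \<and> generate G S = carrier G)"

definition GL_rat :: "nat \<Rightarrow> rat mat monoid" where
  "GL_rat d = units_of (ring_mat TYPE(rat) d ())"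

definition quadratic_form :: "nat \<Rightarrow> (rat vec \<Rightarrow> rat) \<Rightarrow> bool" where
  "quadratic_form d q \<longleftrightarrow>
     (\<exists>A\<in>carrier_mat d d. \<forall>v\<in>carrier_vec d. q v = v \<bullet> (A *\<^sub>v v))"

definition positive_definite :: "nat \<Rightarrow> (rat vec \<Rightarrow> rat) \<Rightarrow> bool" where
  "positive_definite d q \<longleftrightarrow> (\<forall>v\<in>carrier_vec d. v \<noteq> 0\<^sub>v d \<longrightarrow> q v > 0)"

definition invariant_form :: "nat \<Rightarrow> rat mat set \<Rightarrow> (rat vec \<Rightarrow> rat) \<Rightarrow> bool" where
  "invariant_form d H q \<longleftrightarrow> (\<forall>M\<in>H. \<forall>v\<in>carrier_vec d. q (M *\<^sub>v v) = q v)"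

end

theory Submission
  imports
    Defs
    "HOL-Library.Countable_Set"
    "HOL-Library.Function_Algebras"
    "HOL-Combinatorics.Permutations"
    "HOL-Number_Theory.Cong"
    "Jordan_Normal_Form.Determinant"
begin

text \<open>
  For a prime \<open>p\<close>, the classes of lattices in \<open>\<rat>\<^sup>n\<^sup>+\<^sup>1\<close> over the localisation of \<open>\<int>\<close> at \<open>p\<close>
  are the vertices of a building of type \<open>A~\<^sub>n\<close>, whose simplices are the sets of classes for which
  all representatives together form a chain; completing at \<open>p\<close> is not needed. As the
  invariant form forces determinants \<open>\<plusminus>1\<close>, the group acts on it preserving types, hence fixes a
  vertex and stabilises a lattice, which bounds the powers of \<open>p\<close> in the denominators of all
  matrix entries. By finite generation only finitely many \<open>p\<close> occur in denominators, so the
  denominators of all entries are bounded. The entries themselves are bounded by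
  Cauchy--Schwarz for the invariant form, so there are only finitely many matrices.
\<close>

section \<open>The affine symmetric group and its Coxeter presentation\<close>

text \<open>Chambers are encoded as bi-infinite sequences \<open>F\<close> of vectors with
  \<open>F (k + n + 1) = p F k\<close>, the lattice with index k being spanned by all
  \<open>F m\<close> with m \<ge> k. An apartment is then governed by reindexing along bijections of
  the integers that commute with the shift by n + 1, and equality of lattices becomes preservation
  of half-lines {x \<ge> k}. For this reason the Coxeter group, given only by its presentation, has
  to be identified with a group of such bijections, its standard parabolic subgroups being
  stabilisers of half-lines. Uniform translations of the integers also act by reindexing but lie
  outside the Coxeter group; the valuation of the determinant of a lattice basis tells the two apart
  and at the same time supplies the types. In the absence of completeness a vector is not a
  convergent series in the frame vectors; instead, values of linear functionals are shown to be
  divisible by all powers of p, hence zero. The property of \<open>G\<close> concerns only buildings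
  with vertices in a given infinite type, so the lattice classes, being countably many, are injected
  into it.\<close>

definition cgen :: "nat \<Rightarrow> nat \<Rightarrow> int \<Rightarrow> int" where
  "cgen n i x = (if x mod int (Suc n) = int i then x - 1
     else if (x + 1) mod int (Suc n) = int i then x + 1 else x)"

text \<open>Words act through the simple reflections of the affine symmetric group:
  \<open>cgen n i\<close> exchanges i - 1 and i together with all their translates by multiples of n
  + 1, so that index 0 joins neighbouring periods.\<close>

primrec cperm :: "nat \<Rightarrow> nat list \<Rightarrow> int \<Rightarrow> int" where
  "cperm n [] = id"
| "cperm n (i # w) = cgen n i \<circ> cperm n w"

lemma cperm_append: "cperm n (u @ v) = cperm n u \<circ> cperm n v"
  by (induction u) (auto simp: comp_assoc)

text \<open>The extended affine symmetric group. The usual normalisation of the sum of the values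
  over one period is left out, so that uniform translations belong to it. Surjectivity follows from
  injectivity on the finitely many residues (\<open>affine_surj\<close>).\<close>

definition affine :: "nat \<Rightarrow> (int \<Rightarrow> int) \<Rightarrow> bool" where
  "affine n f \<longleftrightarrow> inj f \<and> (\<forall>x. f (x + int (Suc n)) = f x + int (Suc n))"

lemma mod_succ: "N > 0 \<Longrightarrow> (x + 1) mod N = (if x mod N = N - 1 then 0 else x mod N + 1)" for x N :: int
  by (smt (verit) mod_add_left_eq mod_pos_pos_trivial mod_self pos_mod_bound pos_mod_sign)

lemma mod_pred:
  fixes x N :: int
  assumes "N > 0"
  shows "(x - 1) mod N = (if x mod N = 0 then N - 1 else x mod N - 1)"
proof -
  have s: "x mod N = (if (x - 1) mod N = N - 1 then 0 else (x - 1) mod N + 1)"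
    using mod_succ[OF assms, of "x - 1"] by simp
  have "(x - 1) mod N \<ge> 0" using assms by simp
  then show ?thesis using s by (cases "(x - 1) mod N = N - 1") simp_all
qed

lemma cgen_alt:
  assumes "i \<le> n"
  shows "cgen n i x = (let r = x mod int (Suc n) in if r = int i then x - 1
     else if r + 1 = int i \<or> (i = 0 \<and> r = int n) then x + 1 else x)"
  using assms mod_succ[of "int (Suc n)" x] by (auto simp: cgen_def Let_def split: if_splits)

lemma cgen_cgen:
  assumes "n \<ge> 1" "i \<le> n" shows "cgen n i (cgen n i x) = x"
  using assms mod_succ[of "int (Suc n)" x] mod_pred[of "int (Suc n)" x] pos_mod_bound[of "int (Suc n)" x] pos_mod_sign[of "int (Suc n)" x]
  by (auto simp: cgen_alt Let_def split: if_splits)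

lemma cgen_cases:
  assumes "k \<le> n"
  shows "x mod int (Suc n) = int k \<Longrightarrow> cgen n k x = x - 1"
    "(x + 1) mod int (Suc n) = int k \<Longrightarrow> n \<ge> 1 \<Longrightarrow> cgen n k x = x + 1"
    "x mod int (Suc n) \<noteq> int k \<Longrightarrow> (x + 1) mod int (Suc n) \<noteq> int k \<Longrightarrow> cgen n k x = x"
  using mod_succ[of "int (Suc n)" x] by (auto simp: cgen_def split: if_splits)

text \<open>Indices that are not neighbours involve disjoint pairs of residue classes, so
  \<open>cgen n j\<close> fixes every point moved by \<open>cgen n i\<close> as well as its
  image.\<close>

lemma cgen_far:
  assumes "n \<ge> 1" "i \<le> n" "j \<le> n" "j \<noteq> i" "j \<noteq> Suc i mod Suc n" "i \<noteq> Suc j mod Suc n"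
    and x: "x mod int (Suc n) = int i \<or> (x + 1) mod int (Suc n) = int i"
  shows "cgen n j (cgen n i x) = cgen n i x" "cgen n j x = x"
proof -
  define N where "N = int (Suc n)"
  have im: "int i mod N = int i" "int j mod N = int j" using assms by (simp_all add: N_def)
  have ij: "(int i + 1) mod N \<noteq> int j" "(int j + 1) mod N \<noteq> int i"
    using assms(5,6) by (simp_all only: N_def of_nat_eq_iff[where 'a=int, symmetric] zmod_int of_nat_Suc add.commute)
  have nd: "\<not> N dvd int i - int j" "\<not> N dvd (int i + 1) - int j" "\<not> N dvd (int j + 1) - int i"
    using im ij assms(4) by (metis mod_eq_dvd_iff of_nat_eq_iff)+
  have far: "cgen n j y = y" if "N dvd y - int i \<or> N dvd y + 1 - int i" for y
  proof -
    have "\<not> N dvd y - int j"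
    proof
      assume "N dvd y - int j"
      then have "N dvd (y - int j) - (y - int i) \<or> N dvd (y + 1 - int i) - (y - int j)"
        using that dvd_diff by blast
      then show False using nd by (auto simp: algebra_simps)
    qed
    moreover have "\<not> N dvd y + 1 - int j"
    proof
      assume "N dvd y + 1 - int j"
      then have "N dvd (y + 1 - int j) - (y - int i) \<or> N dvd (y + 1 - int j) - (y + 1 - int i)"
        using that dvd_diff by blast
      then show False using nd by (auto simp: algebra_simps)
    qed
    ultimately have "y mod N \<noteq> int j" "(y + 1) mod N \<noteq> int j"
      using im by (metis mod_eq_dvd_iff)+
    then show ?thesis using cgen_cases(3)[OF assms(3)] by (simp add: N_def)
  qed
  consider "N dvd x - int i" "cgen n i x = x - 1" | "N dvd x + 1 - int i" "cgen n i x = x + 1"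
    using x cgen_cases(1,2)[OF assms(2), of x] im assms(1) unfolding N_def by (metis mod_eq_dvd_iff)
  then show "cgen n j (cgen n i x) = cgen n i x" "cgen n j x = x"
    by (cases; use far[of x] far[of "x - 1"] far[of "x + 1"] in simp)+
qed

lemma cgen_commute:
  assumes "n \<ge> 1" "i \<le> n" "j \<le> n" "j \<noteq> i" "j \<noteq> Suc i mod Suc n" "i \<noteq> Suc j mod Suc n"
  shows "cgen n i (cgen n j x) = cgen n j (cgen n i x)"
proof -
  consider "x mod int (Suc n) = int i \<or> (x + 1) mod int (Suc n) = int i"
    | "x mod int (Suc n) = int j \<or> (x + 1) mod int (Suc n) = int j"
    | "cgen n i x = x" "cgen n j x = x"
    using cgen_cases(3)[OF assms(2)] cgen_cases(3)[OF assms(3)] by blast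
  then show ?thesis
  proof cases
    case 1
    then show ?thesis using cgen_far[OF assms] by simp
  next
    case 2
    then show ?thesis using cgen_far[OF assms(1,3,2) assms(4)[symmetric] assms(6,5)] by simp
  qed simp
qed

text \<open>Only the residues of i - 1, i and i + 1 are moved, and n \<ge> 2 makes them distinct;
  the identity is the braid relation for adjacent transpositions of three points.\<close>

lemma cgen_braid:
  assumes "n \<ge> 2" "i \<le> n" "j = Suc i mod Suc n"
  shows "cgen n i (cgen n j (cgen n i x)) = cgen n j (cgen n i (cgen n j x))"
proof -
  define N where "N = int (Suc n)"
  have N: "N \<ge> 3" using assms by (simp add: N_def)
  have j: "j \<le> n" using assms by (simp add: less_Suc_eq_le[symmetric])
  have n1: "n \<ge> 1" using assms by simp
  have ed: "y mod N = int i \<longleftrightarrow> N dvd y - int i" "y mod N = int j \<longleftrightarrow> N dvd y - (int i + 1)" for y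
  proof -
    have "int i mod N = int i" using assms by (simp add: N_def)
    then show "y mod N = int i \<longleftrightarrow> N dvd y - int i" by (metis mod_eq_dvd_iff)
    have "int j = (int i + 1) mod N" using assms(3) by (simp add: N_def zmod_int add.commute)
    then show "y mod N = int j \<longleftrightarrow> N dvd y - (int i + 1)" by (metis mod_eq_dvd_iff)
  qed
  note ci = cgen_cases[OF assms(2), folded N_def, unfolded ed] and cj = cgen_cases[OF j, folded N_def, unfolded ed]
  have nm: "N dvd N * q - c \<longleftrightarrow> N dvd c" "N dvd N * q + c \<longleftrightarrow> N dvd c" "N dvd c + N * q \<longleftrightarrow> N dvd c" for q c
    by (simp_all add: dvd_diff_right_iff dvd_add_right_iff dvd_add_left_iff)
  have nd: "\<not> N dvd 1" "\<not> N dvd 2" "\<not> N dvd - 1" "\<not> N dvd - 2"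
    using N zdvd_imp_le[of N 1] zdvd_imp_le[of N 2] by auto
  consider q where "x = int i + N * q" | q where "x = int i + N * q + 1" | q where "x = int i + N * q - 1"
    | "\<not> N dvd x - int i" "\<not> N dvd x - (int i + 1)" "\<not> N dvd x + 1 - int i"
    by (smt (verit) dvdE)
  then show ?thesis
  proof cases
    case 1
    have "cgen n i x = x - 1" using 1 by (intro ci) simp
    moreover have "cgen n j (x - 1) = x - 1" using 1 nd nm by (intro cj) simp_all
    moreover have "cgen n i (x - 1) = x" using 1 nd nm n1 ci(2)[of "x - 1"] by simp
    moreover have "cgen n j x = x + 1" using 1 n1 by (intro cj) simp_all
    moreover have "cgen n i (x + 1) = x + 1" using 1 nd nm by (intro ci) simp_all
    moreover have "cgen n j (x + 1) = x" using 1 cj(1)[of "x + 1"] by simp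
    ultimately show ?thesis by simp
  next
    case 2
    have "cgen n j x = x - 1" using 2 by (intro cj) simp
    moreover have "cgen n i (x - 1) = x - 2" using 2 ci(1)[of "x - 1"] by simp
    moreover have "cgen n j (x - 2) = x - 2" using 2 nd nm by (intro cj) simp_all
    moreover have "cgen n i x = x" using 2 nd nm by (intro ci) simp_all
    ultimately show ?thesis by simp
  next
    case 3
    have "cgen n i x = x + 1" using 3 n1 by (intro ci) simp_all
    moreover have "cgen n j (x + 1) = x + 2" using 3 n1 cj(2)[of "x + 1"] by simp
    moreover have "cgen n i (x + 2) = x + 2" using 3 nd nm by (intro ci) simp_all
    moreover have "cgen n j x = x" using 3 nd nm by (intro cj) simp_all
    ultimately show ?thesis by simp
  next
    case 4
    then have "cgen n i x = x" "cgen n j x = x" by (auto intro: ci cj)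
    then show ?thesis by simp
  qed
qed

section \<open>The action of the presented group on the integers\<close>

lemma coxeter_eq_cperm:
  assumes n: "n \<ge> 1" and uv: "coxeter_eq n u v"
  shows "cperm n u = cperm n v"
  using uv
proof (induction rule: coxeter_eq.induct)
  case (relator r u v)
  have "cperm n r = id"
  proof -
    consider i where "r = [i,i]" "i \<le> n"
      | i j where "r = [i, j, i, j, i, j]" "n \<ge> 2" "i \<le> n" "j = Suc i mod Suc n"
      | i j where "r = [i, j, i, j]" "n \<ge> 2" "i \<le> n" "j \<le> n" "j \<noteq> i"
        "j \<noteq> Suc i mod Suc n" "i \<noteq> Suc j mod Suc n"
      using relator(1) unfolding coxeter_relators_def by blast
    then show ?thesis
    proof cases
      case 1 then show ?thesis using n by (auto simp: fun_eq_iff cgen_cgen)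
    next
      case 2
      have j: "j \<le> n" using 2 by (simp add: less_Suc_eq_le[symmetric])
      show ?thesis unfolding 2(1) using 2(2,3) j n using cgen_braid[OF 2(2-4)] by (simp add: fun_eq_iff cgen_cgen del: mod_Suc)
    next
      case 3
      then show ?thesis using n by (simp add: fun_eq_iff cgen_cgen cgen_commute[of n i j])
    qed
  qed
  then show ?case by (simp add: cperm_append)
qed simp_all

lemma cgen_shift: "cgen n i (x + int (Suc n)) = cgen n i x + int (Suc n)"
proof -
  have "(x + int (Suc n)) mod int (Suc n) = x mod int (Suc n)"
    "(x + int (Suc n) + 1) mod int (Suc n) = (x + 1) mod int (Suc n)"
    using mod_add_self2[of x "int (Suc n)"] mod_add_self2[of "x + 1" "int (Suc n)"] by (simp_all only: add.assoc add.commute[of "int (Suc n)"])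
  then show ?thesis unfolding cgen_def by simp
qed

lemma cgen_inj: "n \<ge> 1 \<Longrightarrow> i \<le> n \<Longrightarrow> inj (cgen n i)"
  by (metis cgen_cgen injI)

lemma affine_cgen: "n \<ge> 1 \<Longrightarrow> i \<le> n \<Longrightarrow> affine n (cgen n i)"
  unfolding affine_def using cgen_shift[of n i] cgen_inj[of n i] by simp

lemma affine_comp: "affine n f \<Longrightarrow> affine n g \<Longrightarrow> affine n (f \<circ> g)"
  unfolding affine_def by (simp add: inj_compose)

lemma affine_comp_cgen: "affine n f \<Longrightarrow> n \<ge> 1 \<Longrightarrow> i \<le> n \<Longrightarrow> affine n (f \<circ> cgen n i)"
  by (rule affine_comp[OF _ affine_cgen])

lemma affine_id: "affine n id" by (simp add: affine_def)

lemma affine_cperm: "n \<ge> 1 \<Longrightarrow> w \<in> lists {..n} \<Longrightarrow> affine n (cperm n w)"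
proof (induction w)
  case Nil
  show ?case unfolding cperm.simps by (rule affine_id)
next
  case (Cons i w)
  then have "affine n (cgen n i)" "affine n (cperm n w)" by (simp_all add: affine_cgen)
  then show ?case unfolding cperm.simps by (rule affine_comp)
qed

lemma cgen_at:
  assumes "n \<ge> 1" "i \<le> n"
  shows "cgen n i (int i) = int i - 1" "cgen n i (int i - 1) = int i"
  using cgen_cases(1)[OF assms(2), of "int i"] cgen_cases(2)[OF assms(2), of "int i - 1"] assms by simp_all

text \<open>A simple reflection moves points by at most one, so the half-line from k could only be
  violated by exchanging k - 1 and k, which for k between 0 and n happens only if k = i. This is the
  germ of the description of parabolic subgroups by half-lines.\<close>

lemma cgen_ge_iff:
  assumes "n \<ge> 1" "i \<le> n" "k \<le> n" "k \<noteq> i"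
  shows "cgen n i x \<ge> int k \<longleftrightarrow> x \<ge> int k"
proof -
  have k: "int k mod int (Suc n) = int k" using assms by simp
  have "x mod int (Suc n) \<noteq> int i" if "x = int k"
    unfolding that k using assms by simp
  moreover have "(x + 1) mod int (Suc n) \<noteq> int i" if "x + 1 = int k"
    unfolding that k using assms by simp
  ultimately show ?thesis unfolding cgen_def by (smt (verit))
qed

lemma affine_mult:
  assumes "affine n f"
  shows "f (x + int (Suc n) * q) = f x + int (Suc n) * q"
proof -
  have s: "f (y + int (Suc n)) = f y + int (Suc n)" for y
    using assms unfolding affine_def by blast
  have p: "f (y + int (Suc n) * int k) = f y + int (Suc n) * int k" for y k
  proof (induction k)
    case (Suc k)
    have "f (y + int (Suc n) * int (Suc k)) = f ((y + int (Suc n) * int k) + int (Suc n))"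
      by (simp add: algebra_simps)
    then show ?case using Suc s[of "y + int (Suc n) * int k"] by (simp add: algebra_simps)
  qed simp
  show ?thesis
  proof (cases "q \<ge> 0")
    case True
    then show ?thesis using p[of x "nat q"] by simp
  next
    case False
    then show ?thesis using p[of "x + int (Suc n) * q" "nat (- q)"] by simp
  qed
qed

section \<open>Sorting by descents: faithfulness of the action and parabolic subgroups\<close>

definition desc :: "nat \<Rightarrow> (int \<Rightarrow> int) \<Rightarrow> nat \<Rightarrow> bool" where
  "desc n f i \<longleftrightarrow> i \<le> n \<and> f (int i - 1) > f (int i)"

lemma desc_at:
  assumes "affine n f" "i \<le> n" "y mod int (Suc n) = int i"
  shows "desc n f i \<longleftrightarrow> f (y - 1) > f y"
proof -
  have y: "y = int i + int (Suc n) * (y div int (Suc n))"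
    using assms(3) by (metis add.commute mult_div_mod_eq)
  then have "y - 1 = (int i - 1) + int (Suc n) * (y div int (Suc n))" by linarith
  then have "f y = f (int i) + int (Suc n) * (y div int (Suc n))"
    "f (y - 1) = f (int i - 1) + int (Suc n) * (y div int (Suc n))"
    using affine_mult[OF assms(1)] y by metis+
  then show ?thesis using assms(2) by (simp add: desc_def)
qed

text \<open>The termination measure for sorting. It takes the place of the length: exchanging a pair
  in the wrong order lowers it, and no inversions have to be counted.\<close>

definition displacement :: "nat \<Rightarrow> (int \<Rightarrow> int) \<Rightarrow> nat" where
  "displacement n f = nat (\<Sum>x\<in>{0..int n}. (f x - x)\<^sup>2)"

text \<open>Only the terms at the residues of i and i - 1 change. With u = f (i - 1) and v = f i,
  the part (u - i + 1)^2 + (v - i)^2 turns into (u - i)^2 + (v - i + 1)^2, which is smaller by 2 (u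
  - v) > 0.\<close>

lemma displacement_desc:
  assumes "n \<ge> 1" "affine n f" "desc n f i"
  shows "displacement n (f \<circ> cgen n i) < displacement n f"
proof -
  have i: "i \<le> n" and d: "f (int i - 1) > f (int i)" using assms(3) by (auto simp: desc_def)
  \<comment> \<open>The representative of the residue of i - 1 within {0..n}. For i = 0 it is n, and
    periodicity relates the values there to those at -1.\<close>
  define x where "x = (if i = 0 then int n else int i - 1)"
  define A where "A = {0..int n} - {int i} - {x}"
  have xi: "x \<in> {0..int n}" "x \<noteq> int i" "int i \<in> {0..int n}" using i assms(1) by (auto simp: x_def)
  have split: "(\<Sum>x\<in>{0..int n}. h x) = h (int i) + (h x + sum h A)" for h :: "int \<Rightarrow> int"
    using xi by (subst sum.remove[of _ "int i"]; simp; subst sum.remove[of _ x]; simp add: A_def)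
  have fixed: "cgen n i z = z" if "z \<in> A" for z
  proof -
    have z: "z \<ge> 0" "z \<le> int n" "z \<noteq> int i" "z \<noteq> x" using that by (auto simp: A_def)
    have "(z + 1) mod int (Suc n) \<noteq> int i"
      using z mod_succ[of "int (Suc n)" z] by (auto simp: x_def split: if_splits)
    then show ?thesis using z by (intro cgen_cases(3)[OF i]) auto
  qed
  have A: "(\<Sum>z\<in>A. ((f \<circ> cgen n i) z - z)\<^sup>2) = (\<Sum>z\<in>A. (f z - z)\<^sup>2)"
    by (rule sum.cong) (auto simp: fixed)
  have ax: "f (y + int (Suc n)) = f y + int (Suc n)" for y
    using assms(2) by (auto simp: affine_def)
  have "((f \<circ> cgen n i) (int i) - int i)\<^sup>2 + ((f \<circ> cgen n i) x - x)\<^sup>2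
      = (f (int i - 1) - int i)\<^sup>2 + (f (int i) - int i + 1)\<^sup>2"
  proof (cases "i = 0")
    case True
    have "cgen n i (int n) = int n + 1" using True i assms(1) mod_self[of "int (Suc n)"]
      by (intro cgen_cases(2)) (auto simp: add.commute)
    then show ?thesis using True cgen_at[OF assms(1) i] ax[of 0] by (simp add: x_def add.commute)
  next
    case False
    then show ?thesis unfolding comp_apply x_def by (simp add: cgen_at[OF assms(1) i]) (simp add: algebra_simps)
  qed
  moreover have "(f (int i) - int i)\<^sup>2 + (f x - x)\<^sup>2
      = (f (int i) - int i)\<^sup>2 + (f (int i - 1) - int i + 1)\<^sup>2"
    using ax[of "-1"] by (cases "i = 0") (simp_all add: x_def algebra_simps)
  moreover have "(f (int i - 1) - int i)\<^sup>2 + (f (int i) - int i + 1)\<^sup>2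
      < (f (int i) - int i)\<^sup>2 + (f (int i - 1) - int i + 1)\<^sup>2"
    using d by (simp add: power2_eq_square algebra_simps)
  ultimately have "(\<Sum>z\<in>{0..int n}. ((f \<circ> cgen n i) z - z)\<^sup>2) < (\<Sum>z\<in>{0..int n}. (f z - z)\<^sup>2)"
    unfolding split A by linarith
  moreover have "(\<Sum>z\<in>{0..int n}. ((f \<circ> cgen n i) z - z)\<^sup>2) \<ge> 0" by (rule sum_nonneg) simp
  ultimately show ?thesis unfolding displacement_def by simp
qed

text \<open>The record of a complete sorting of f, with descents removed in any order. What is left
  of f at the end is a translation, not necessarily the identity.\<close>

inductive descent_word :: "nat \<Rightarrow> (int \<Rightarrow> int) \<Rightarrow> nat list \<Rightarrow> bool" for n where
  Nil: "(\<And>i. \<not> desc n f i) \<Longrightarrow> descent_word n f []"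
| Cons: "desc n f i \<Longrightarrow> descent_word n (f \<circ> cgen n i) w \<Longrightarrow> descent_word n f (i # w)"

lemma descent_word_lists: "descent_word n f w \<Longrightarrow> w \<in> lists {..n}"
  by (induction rule: descent_word.induct) (auto simp: desc_def)

lemma descent_word_exists:
  assumes "n \<ge> 1" "affine n f"
  shows "\<exists>w. descent_word n f w"
  using assms(2)
proof (induction "displacement n f" arbitrary: f rule: less_induct)
  case less
  show ?case
  proof (cases "\<exists>i. desc n f i")
    case True
    then obtain i where i: "desc n f i" by blast
    then have "affine n (f \<circ> cgen n i)"
      using less.prems assms(1) by (simp add: desc_def affine_comp_cgen)
    then obtain w where "descent_word n (f \<circ> cgen n i) w"
      using less.hyps[OF displacement_desc[OF assms(1) less.prems i]] by blast
    then show ?thesis using i descent_word.Cons by blast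
  qed (blast intro: descent_word.Nil)
qed

text \<open>Multiply the relator on the right by \<open>rev y\<close>, which inverts y because the
  generators are involutions. This turns relators into commutation and braid moves.\<close>

lemma coxeter_eq_braid:
  assumes "x @ y \<in> coxeter_relators n"
  shows "coxeter_eq n x (rev y)"
proof -
  have l: "x \<in> lists {..n}" "y \<in> lists {..n}" "rev y \<in> lists {..n}"
    using coxeter_relators_lists[OF assms] by auto
  have "coxeter_eq n (x @ (rev (rev y) @ rev y) @ []) (x @ [] @ [])"
    using coxeter_eq_append_context[OF coxeter_eq_rev_append[OF l(3)] l(1), of "[]"] by simp
  moreover have "coxeter_eq n ([] @ (x @ y) @ rev y) ([] @ rev y)"
    by (rule coxeter_eq.relator[OF assms]) (use l in auto)
  ultimately show ?thesis by simp (meson coxeter_eq.sym coxeter_eq.trans)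
qed

lemma descent_word_commute:
  assumes n: "n \<ge> 1" and f: "affine n f" and d: "desc n f i" "desc n f j"
    and ij: "i \<noteq> j" "j \<noteq> Suc i mod Suc n" "i \<noteq> Suc j mod Suc n"
  shows "desc n (f \<circ> cgen n i) j"
proof -
  have i: "i \<le> n" "j \<le> n" using d by (auto simp: desc_def)
  have a: "\<not> (j = Suc i)" "\<not> (i = Suc j)" "\<not> (i = n \<and> j = 0)" "\<not> (j = n \<and> i = 0)"
    using i ij by auto
  have "(int j + 1) mod int (Suc n) \<noteq> int i" "(int j - 1) mod int (Suc n) \<noteq> int i"
    using a i mod_succ[of "int (Suc n)" "int j"] mod_pred[of "int (Suc n)" "int j"] by auto
  then have "cgen n i (int j) = int j" "cgen n i (int j - 1) = int j - 1"
    using i ij(1) by (auto intro!: cgen_cases(3))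
  then show ?thesis using d(2) by (simp add: desc_def)
qed

text \<open>Two neighbouring descents mean that f decreases along i - 1, i, i + 1. Both ways of
  reversing three points pass through descents only and end at the same map, so one continuation
  \<open>w\<close> serves both.\<close>

lemma descent_word_braid:
  assumes n: "n \<ge> 2" and f: "affine n f" and d: "desc n f i" "desc n f j" and j: "j = Suc i mod Suc n"
  shows "\<exists>w. descent_word n (f \<circ> cgen n i) (j # i # w) \<and> descent_word n (f \<circ> cgen n j) (i # j # w)"
proof -
  have n1: "n \<ge> 1" using n by simp
  have i: "i \<le> n" "j \<le> n" using d by (auto simp: desc_def)
  define N where "N = int (Suc n)"
  have N: "N \<ge> 3" using n by (simp add: N_def)
  have jm: "(int i + 1) mod N = int j" using j by (simp add: N_def zmod_int add.commute)
  have im: "int i mod N = int i" using i by (simp add: N_def)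
  have ne: "int i \<noteq> int j" "(int i + 1) mod N \<noteq> int i" "(int i + 2) mod N \<noteq> int i" "(int i - 1) mod N \<noteq> int j"
  proof -
    have d: "\<not> N dvd 1" "\<not> N dvd 2" using N zdvd_imp_le[of N 1] zdvd_imp_le[of N 2] by auto
    show "(int i + 1) mod N \<noteq> int i" "(int i + 2) mod N \<noteq> int i" "(int i - 1) mod N \<noteq> int j"
      using d mod_eq_dvd_iff[of "int i + 1" N "int i"] mod_eq_dvd_iff[of "int i + 2" N "int i"]
        mod_eq_dvd_iff[of "int i - 1" N "int i + 1"] im jm by auto
    then show "int i \<noteq> int j" using jm by simp
  qed
  note ci = cgen_cases[OF i(1), folded N_def] and cj = cgen_cases[OF i(2), folded N_def]
  have si: "cgen n i (int i) = int i - 1" "cgen n i (int i - 1) = int i" "cgen n i (int i + 1) = int i + 1"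
    using im jm ne n1 ci(1)[of "int i"] ci(2)[of "int i - 1"] ci(3)[of "int i + 1"] by (auto simp: add.assoc)
  have sj: "cgen n j (int i) = int i + 1" "cgen n j (int i + 1) = int i" "cgen n j (int i - 1) = int i - 1"
    using im jm ne n1 cj(1)[of "int i + 1"] cj(2)[of "int i"] cj(3)[of "int i - 1"] by auto
  have aff: "affine n (g \<circ> cgen n i)" "affine n (g \<circ> cgen n j)" if "affine n g" for g
    using that i n1 by (simp_all add: affine_comp_cgen)
  have di: "desc n g i \<longleftrightarrow> g (int i - 1) > g (int i)" if "affine n g" for g
    using i by (simp add: desc_def)
  have dj: "desc n g j \<longleftrightarrow> g (int i) > g (int i + 1)" if "affine n g" for g
    using desc_at[OF that i(2), of "int i + 1"] jm by (simp add: N_def)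
  have br: "f \<circ> cgen n i \<circ> cgen n j \<circ> cgen n i = f \<circ> cgen n j \<circ> cgen n i \<circ> cgen n j"
    using cgen_braid[OF n i(1) j] by (auto simp: fun_eq_iff)
  obtain w where w: "descent_word n (f \<circ> cgen n i \<circ> cgen n j \<circ> cgen n i) w"
    using descent_word_exists[OF n1] aff f by blast
  have f': "f (int i - 1) > f (int i)" "f (int i) > f (int i + 1)" using d di dj f by auto
  have "descent_word n (f \<circ> cgen n i) (j # i # w)"
    using f f' w by (intro descent_word.Cons) (simp_all add: di dj aff si sj)
  moreover have "descent_word n (f \<circ> cgen n j) (i # j # w)"
    using f f' w unfolding br by (intro descent_word.Cons) (simp_all add: di dj aff si sj)
  ultimately show ?thesis by blast
qed

text \<open>Confluence of sorting, by induction on the measure. Words starting with distinct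
  descents i and j are both compared with words that start with the two sides of the commutation or
  braid move and continue with the same \<open>w\<close>; the induction hypothesis handles the tails
  after the first letter.\<close>

lemma descent_word_unique:
  assumes n: "n \<ge> 1" and "affine n f" "descent_word n f u" "descent_word n f v"
  shows "coxeter_eq n u v"
  using assms(2-)
proof (induction "displacement n f" arbitrary: f u v rule: less_induct)
  case less
  note f = less.prems(1)
  show ?case
  proof (cases "u = [] \<or> v = []")
    case True
    then have "\<not> desc n f i" for i using less.prems(2,3) by (auto elim: descent_word.cases)
    then have "u = []" "v = []" using less.prems(2,3) by (auto elim: descent_word.cases)
    then show ?thesis by (simp add: coxeter_eq.refl)
  next
    case False
    then obtain i u' j v' where uv: "u = i # u'" "v = j # v'" by (meson neq_Nil_conv)
    have d: "desc n f i" "descent_word n (f \<circ> cgen n i) u'" "desc n f j" "descent_word n (f \<circ> cgen n j) v'"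
      using less.prems(2,3) uv by (auto elim: descent_word.cases)
    have i: "i \<le> n" "j \<le> n" using d by (auto simp: desc_def)
    have aff: "affine n (g \<circ> cgen n i)" "affine n (g \<circ> cgen n j)" if "affine n g" for g
      using that i n by (simp_all add: affine_comp_cgen)
    have IHi: "coxeter_eq n (i # u') (i # w)" if "descent_word n (f \<circ> cgen n i) w" for w
      using coxeter_eq_append_context[OF less.hyps[OF displacement_desc[OF n f d(1)] aff(1)[OF f] d(2) that], of "[i]" "[]"] i
      by simp
    have IHj: "coxeter_eq n (j # w) (j # v')" if "descent_word n (f \<circ> cgen n j) w" for w
      using coxeter_eq_append_context[OF less.hyps[OF displacement_desc[OF n f d(3)] aff(2)[OF f] that d(4)], of "[j]" "[]"] i
      by simp
    have sw: "coxeter_eq n (x @ w) (y @ w)" if "coxeter_eq n x y" "w \<in> lists {..n}" for x y w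
      using coxeter_eq_append_context[OF that(1), of "[]" w] that(2) by simp
    consider "i = j" | "i \<noteq> j" "j \<noteq> Suc i mod Suc n" "i \<noteq> Suc j mod Suc n" | "n \<ge> 2" "j = Suc i mod Suc n"
      | "n \<ge> 2" "i = Suc j mod Suc n" | "n = 1" "i \<noteq> j" using n by linarith
    then show ?thesis
    proof cases
      case 1
      then show ?thesis using IHi[of v'] d(4) uv by simp
    next
      case 2
      have c: "f \<circ> cgen n j \<circ> cgen n i = f \<circ> cgen n i \<circ> cgen n j"
        using cgen_commute[OF n i] 2 by (auto simp: fun_eq_iff)
      obtain w where w: "descent_word n (f \<circ> cgen n i \<circ> cgen n j) w"
        using descent_word_exists[OF n] aff f by blast
      have "descent_word n (f \<circ> cgen n i) (j # w)"
        using w descent_word_commute[OF n f d(1,3)] 2 by (auto intro: descent_word.Cons)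
      moreover have "descent_word n (f \<circ> cgen n j) (i # w)"
        using w descent_word_commute[OF n f d(3,1)] 2 c by (auto intro: descent_word.Cons)
      moreover have "coxeter_eq n ([i, j] @ w) ([j, i] @ w)"
      proof (rule sw)
        \<comment> \<open>For n = 1 distinct indices are always neighbours in the cyclic sense, so
          this case does not arise; the commutation relators exist from n = 2 on.\<close>
        have "n \<ge> 2"
        proof (rule ccontr)
          assume "\<not> n \<ge> 2"
          then have "n = 1" using n by simp
          then show False using 2 i by (cases i; cases j) auto
        qed
        then show "coxeter_eq n [i, j] [j, i]"
          using coxeter_eq_braid[of "[i,j]" "[i,j]" n] 2 i by (force simp: coxeter_relators_def)
      qed (rule descent_word_lists[OF w])
      ultimately show ?thesis using IHi IHj uv coxeter_eq.trans by (metis append_Cons append_Nil)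
    next
      case 3
      obtain w where w: "descent_word n (f \<circ> cgen n i) (j # i # w)" "descent_word n (f \<circ> cgen n j) (i # j # w)"
        using descent_word_braid[OF 3(1) f d(1,3) 3(2)] by blast
      have "coxeter_eq n ([i, j, i] @ w) ([j, i, j] @ w)"
      proof (rule sw)
        show "coxeter_eq n [i, j, i] [j, i, j]"
          using coxeter_eq_braid[of "[i,j,i]" "[j,i,j]" n] 3 i by (force simp: coxeter_relators_def)
        show "w \<in> lists {..n}" using descent_word_lists[OF w(1)] by simp
      qed
      then show ?thesis using IHi[OF w(1)] IHj[OF w(2)] uv coxeter_eq.trans by (metis append_Cons append_Nil)
    next
      case 4
      obtain w where w: "descent_word n (f \<circ> cgen n j) (i # j # w)" "descent_word n (f \<circ> cgen n i) (j # i # w)"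
        using descent_word_braid[OF 4(1) f d(3,1) 4(2)] by blast
      have "coxeter_eq n ([i, j, i] @ w) ([j, i, j] @ w)"
      proof (rule sw, rule coxeter_eq.sym)
        show "coxeter_eq n [j, i, j] [i, j, i]"
          using coxeter_eq_braid[of "[j,i,j]" "[i,j,i]" n] 4 i by (force simp: coxeter_relators_def)
        show "w \<in> lists {..n}" using descent_word_lists[OF w(1)] by simp
      qed
      then show ?thesis using IHi[OF w(2)] IHj[OF w(1)] uv coxeter_eq.trans by (metis append_Cons append_Nil)
    next
      case 5
      \<comment> \<open>In the infinite dihedral case the two generators cannot both be descents: f
        would decrease from -1 to 1, whereas periodicity raises it by 2.\<close>
      then have "desc n f 0" "desc n f 1" using d(1,3) i by (cases i; cases j; auto)+
      then have "f (-1) > f 0" "f 0 > f 1" by (simp_all add: desc_def)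
      moreover have "f 1 = f (-1) + 2" using f 5(1) by (auto simp: affine_def dest: spec[of _ "-1"])
      ultimately show ?thesis by simp
    qed
  qed
qed

text \<open>Without descents f is strictly increasing, and its n + 1 increments over one period add
  up to n + 1, so each of them is 1.\<close>

lemma descent_free_shift:
  assumes f: "affine n f" and d: "\<And>i. \<not> desc n f i"
  shows "f x = x + f 0"
proof -
  define N where "N = int (Suc n)"
  have lt: "f (y - 1) < f y" for y
  proof -
    define k where "k = nat (y mod N)"
    have k: "k \<le> n" "y mod N = int k"
      using pos_mod_bound[of N y] pos_mod_sign[of N y] unfolding k_def N_def by linarith+
    have "\<not> f (y - 1) > f y" using desc_at[OF f k(1)] k(2) d by (simp add: N_def)
    moreover have "f (y - 1) \<noteq> f y" using f by (auto simp: affine_def dest: injD)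
    ultimately show ?thesis by linarith
  qed
  have ge: "f (y + int k) \<ge> f y + int k" for y k
  proof (induction k)
    case (Suc k)
    then show ?case using lt[of "y + int k + 1"] by (simp add: algebra_simps)
  qed simp
  have per: "f (y + N) = f y + N" for y using f by (simp add: affine_def N_def)
  have step: "f (y + 1) = f y + 1" for y
    using ge[of y 1] ge[of "y + 1" n] per[of y] by (simp add: N_def add.commute add.left_commute)
  have "f (0 + int k) = int k + f 0" for k
  proof (induction k)
    case (Suc k)
    then show ?case using step[of "int k"] by (simp add: add.commute)
  qed simp
  moreover have "f (- int k) = - int k + f 0" for k
  proof (induction k)
    case (Suc k)
    have "- int (Suc k) = - int k - 1" by simp
    then show ?case using Suc step[of "- int k - 1"] by (metis add.commute add_diff_eq diff_add_cancel)
  qed simp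
  ultimately show ?thesis by (metis add_0 int_cases2)
qed

lemma descent_word_shift:
  assumes "n \<ge> 1" "affine n f" "descent_word n f w"
  shows "\<exists>c. \<forall>x. f (cperm n w x) = x + c"
  using assms(3,2)
proof (induction rule: descent_word.induct)
  case (Nil f)
  have "\<forall>x. f (cperm n [] x) = x + f 0" unfolding cperm.simps id_apply
    by (intro allI descent_free_shift[OF Nil(2,1)])
  then show ?case ..
next
  case (Cons f i w)
  then have "affine n (f \<circ> cgen n i)" using assms(1) by (simp add: desc_def affine_comp_cgen)
  from Cons.IH[OF this] show ?case by simp
qed

text \<open>Up to the relations, composing f with a generator changes its descent word by that
  letter. If i is not a descent of f, it is one of \<open>f \<circ> cgen n i\<close>, and the
  surplus pair of letters i cancels by the involution relator.\<close>

lemma descent_word_cperm: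
  assumes n: "n \<ge> 1" and "affine n f" "w \<in> lists {..n}" "descent_word n f u" "descent_word n (f \<circ> cperm n w) v"
  shows "coxeter_eq n u (w @ v)"
  using assms(2-)
proof (induction w arbitrary: f u)
  case Nil
  then show ?case using descent_word_unique[OF n] by simp
next
  case (Cons i w)
  have i: "i \<le> n" using Cons by simp
  have aff: "affine n (f \<circ> cgen n i)" using Cons i n by (simp_all add: affine_comp_cgen)
  then obtain u' where u': "descent_word n (f \<circ> cgen n i) u'" using descent_word_exists[OF n] by blast
  have "coxeter_eq n u' (w @ v)"
    using Cons.IH[OF aff _ u'] Cons.prems by (simp add: comp_assoc)
  then have *: "coxeter_eq n (i # u') (i # w @ v)"
    using coxeter_eq_append_context[of n _ _ "[i]" "[]"] i by simp
  have ff: "f \<circ> cgen n i \<circ> cgen n i = f" using cgen_cgen[OF n i] by (auto simp: fun_eq_iff)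
  show ?case
  proof (cases "desc n f i")
    case True
    then have "descent_word n f (i # u')" using u' by (rule descent_word.Cons)
    then have "coxeter_eq n u (i # u')" using descent_word_unique[OF n] Cons.prems by blast
    from coxeter_eq.trans[OF this *] show ?thesis by simp
  next
    case False
    have "f (int i - 1) \<noteq> f (int i)" using Cons.prems(1) by (auto simp: affine_def dest: injD)
    then have "desc n (f \<circ> cgen n i) i" using False i by (simp add: desc_def cgen_at[OF n i])
    then have "descent_word n (f \<circ> cgen n i) (i # u)"
      using Cons.prems(3) ff by (intro descent_word.Cons) simp_all
    then have "coxeter_eq n (i # u) u'" using descent_word_unique[OF n aff _ u'] by blast
    then have "coxeter_eq n ([i, i] @ u) (i # u')"
      using coxeter_eq_append_context[of n _ _ "[i]" "[]"] i by fastforce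
    moreover have "coxeter_eq n ([] @ [i, i] @ u) ([] @ u)"
      using i descent_word_lists[OF Cons.prems(3)] by (intro coxeter_eq.relator) (auto simp: coxeter_relators_def)
    ultimately have "coxeter_eq n u (i # u')"
      by (metis append_Nil coxeter_eq.sym coxeter_eq.trans)
    from coxeter_eq.trans[OF this *] show ?thesis by simp
  qed
qed

text \<open>Faithfulness of the action: the identity has the empty descent word, so
  \<open>descent_word_cperm\<close> at f = id compares \<open>[]\<close> with w.\<close>

lemma cperm_eq_id_imp_coxeter_eq:
  assumes n: "n \<ge> 1" and "w \<in> lists {..n}" "cperm n w = id"
  shows "coxeter_eq n w []"
proof -
  have "descent_word n id []" by (auto intro: descent_word.Nil simp: desc_def)
  then show ?thesis
    using descent_word_cperm[OF n affine_id assms(2), of "[]" "[]"] assms(3) by (simp add: coxeter_eq.sym)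
qed

text \<open>If f preserves the half-line from i, then f (i - 1) < i \<le> f i, so i is not a
  descent. Sorting therefore uses letters of J only, and these keep the half-lines at all other
  indices.\<close>

lemma descent_word_stabilizer:
  assumes "n \<ge> 1" "descent_word n f w" "affine n f"
    "\<And>k x. k \<le> n \<Longrightarrow> k \<notin> J \<Longrightarrow> f x \<ge> int k \<longleftrightarrow> x \<ge> int k"
  shows "w \<in> lists J"
  using assms(2-)
proof (induction rule: descent_word.induct)
  case (Cons f i w)
  have i: "i \<le> n" "f (int i - 1) > f (int i)" using Cons by (auto simp: desc_def)
  have "i \<in> J"
  proof (rule ccontr)
    assume "i \<notin> J"
    then have "f (int i) \<ge> int i" "\<not> f (int i - 1) \<ge> int i" using Cons.prems(2)[OF i(1)] by simp_all
    then show False using i by simp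
  qed
  moreover have "w \<in> lists J"
  proof (rule Cons.IH)
    show "affine n (f \<circ> cgen n i)" using Cons.prems i assms(1) by (simp_all add: affine_comp_cgen)
    fix k x assume k: "k \<le> n" "k \<notin> J"
    then have "k \<noteq> i" using \<open>i \<in> J\<close> by blast
    then show "(f \<circ> cgen n i) x \<ge> int k \<longleftrightarrow> x \<ge> int k"
      using Cons.prems(2)[OF k] cgen_ge_iff[OF assms(1) i(1) k(1)] by simp
  qed
  ultimately show ?case by simp
qed simp

text \<open>Sorting w with letters of J leaves a translation. As J is a proper subset, some
  half-line is preserved by everything involved, which forces this translation to be trivial and w
  to be the inverse of the sorting word.\<close>

lemma cperm_parabolic_iff:
  assumes n: "n \<ge> 1" and J: "J \<subset> {..n}" and w: "w \<in> lists {..n}"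
  shows "(\<forall>k\<in>{..n} - J. \<forall>x. cperm n w x \<ge> int k \<longleftrightarrow> x \<ge> int k) \<longleftrightarrow> (\<exists>v\<in>lists J. coxeter_eq n w v)"
    (is "?L \<longleftrightarrow> ?R")
proof
  assume L: ?L
  have aff: "affine n (cperm n w)" using affine_cperm[OF n w] .
  then obtain v where v: "descent_word n (cperm n w) v" using descent_word_exists[OF n] by blast
  have vJ: "v \<in> lists J" using descent_word_stabilizer[OF n v aff] L by auto
  obtain c where c: "\<And>x. cperm n w (cperm n v x) = x + c"
    using descent_word_shift[OF n aff v] by blast
  obtain k where k: "k \<le> n" "k \<notin> J" using J by auto
  have st: "cperm n v x \<ge> int k \<longleftrightarrow> x \<ge> int k" for x
    using vJ
  proof (induction v)
    case (Cons i v)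
    then show ?case using cgen_ge_iff[OF n _ k(1), of i] k J by auto
  qed simp
  have "x + c \<ge> int k \<longleftrightarrow> x \<ge> int k" for x
    using L k st c by (metis Diff_iff atMost_iff)
  from this[of "int k"] this[of "int k - 1"] have "c = 0"
    using \<open>\<And>x. (x + c \<ge> int k) = (x \<ge> int k)\<close>[of "int k - c"] \<open>\<And>x. (x + c \<ge> int k) = (x \<ge> int k)\<close>[of "int k - 1 - c"] by linarith
  then have "cperm n (w @ v) = id" using c by (auto simp: cperm_append)
  moreover have vl: "v \<in> lists {..n}" using descent_word_lists[OF v] .
  ultimately have "coxeter_eq n (w @ v) []" using cperm_eq_id_imp_coxeter_eq[OF n] w by simp
  then have "coxeter_eq n (w @ v @ rev v) (rev v)"
    using coxeter_eq_append_context[of n "w @ v" "[]" "[]" "rev v"] vl by (simp add: in_lists_conv_set)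
  moreover have "coxeter_eq n (w @ v @ rev v) w"
    using coxeter_eq_append_context[OF coxeter_eq_rev_append[of "rev v" n], of w "[]"] w vl by (simp add: in_lists_conv_set)
  ultimately have "coxeter_eq n w (rev v)" using coxeter_eq.sym coxeter_eq.trans by blast
  then show ?R using vJ by (metis in_lists_conv_set set_rev)
next
  assume ?R
  then obtain v where v: "v \<in> lists J" "coxeter_eq n w v" by blast
  have "cperm n v x \<ge> int k \<longleftrightarrow> x \<ge> int k" if "k \<in> {..n} - J" for k x
    using v(1)
  proof (induction v)
    case (Cons i v)
    then show ?case using cgen_ge_iff[OF n _ _, of i k] that J by auto
  qed simp
  then show ?L using coxeter_eq_cperm[OF n v(2)] by simp
qed

section \<open>Localisation at a prime\<close>

definition smul :: "rat \<Rightarrow> (nat \<Rightarrow> rat) \<Rightarrow> nat \<Rightarrow> rat" (infixr "\<star>" 75) where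
  "c \<star> x = (\<lambda>i. c * x i)"

lemma smul_apply [simp]: "(c \<star> x) i = c * x i"
  by (simp add: smul_def)

lemma smul_smul [simp]: "c \<star> d \<star> x = (c * d) \<star> x"
  by (simp add: fun_eq_iff mult.assoc)

lemma smul_simps [simp]: "1 \<star> x = x" "0 \<star> x = 0" "c \<star> 0 = 0"
  by (simp_all add: fun_eq_iff)

lemma smul_add_right: "c \<star> (x + y) = c \<star> x + c \<star> y"
  and smul_add_left: "(c + d) \<star> x = c \<star> x + d \<star> x"
  and smul_minus_right: "c \<star> (x - y) = c \<star> x - c \<star> y"
  and smul_minus_left: "(c - d) \<star> x = c \<star> x - d \<star> x"
  and smul_uminus: "(- 1) \<star> x = - x"
  by (simp_all add: fun_eq_iff algebra_simps)

lemma smul_eq_0_iff: "c \<star> x = 0 \<longleftrightarrow> c = 0 \<or> x = 0"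
  by (auto simp: fun_eq_iff)

lemma sum_fun_apply: "(\<Sum>i\<in>I. f i) j = (\<Sum>i\<in>I. f i (j :: nat) :: rat)"
  by (induction I rule: infinite_finite_induct) auto

lemma smul_sum: "c \<star> (\<Sum>i\<in>I. f i) = (\<Sum>i\<in>I. c \<star> f i)"
  by (simp add: fun_eq_iff sum_fun_apply sum_distrib_left)

lemma sum_delta_smul:
  assumes "finite I" "j \<in> I"
  shows "(\<Sum>i\<in>I. (if i = j then c else 0) \<star> x i) = c \<star> x j"
proof -
  have "(\<Sum>i\<in>I. (if i = j then c else 0) \<star> x i) = (\<Sum>i\<in>I. if i = j then c \<star> x i else 0)"
    by (rule sum.cong) auto
  then show ?thesis using assms by simp
qed

text \<open>Gaussian elimination by induction on the equations: one with a non-zero coefficient at q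
  is solved for that unknown, and the reduced system has one equation and one unknown less. The
  facts on dimension below rest on this.\<close>

lemma underdetermined_system:
  fixes a :: "'i \<Rightarrow> 'j \<Rightarrow> rat"
  assumes "finite I" "finite J" "card I < card J"
  shows "\<exists>c. (\<exists>j\<in>J. c j \<noteq> 0) \<and> (\<forall>i\<in>I. (\<Sum>j\<in>J. a i j * c j) = 0)"
  using assms
proof (induction I arbitrary: J a rule: finite_induct)
  case empty
  then obtain j where "j \<in> J" by fastforce
  then show ?case by (intro exI[of _ "\<lambda>_. 1"]) auto
next
  case (insert m I)
  show ?case
  proof (cases "\<forall>j\<in>J. a m j = 0")
    case True
    from insert obtain c where "\<exists>j\<in>J. c j \<noteq> 0" "\<forall>i\<in>I. (\<Sum>j\<in>J. a i j * c j) = 0"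
      by (metis Suc_lessD card_insert_disjoint)
    then show ?thesis using True by (intro exI[of _ c]) auto
  next
    case False
    then obtain q where q: "q \<in> J" "a m q \<noteq> 0" by blast
    define J' where "J' = J - {q}"
    have J': "finite J'" "card I < card J'" "J = insert q J'" "q \<notin> J'"
      using insert q by (auto simp: J'_def)
    obtain c where c: "\<exists>j\<in>J'. c j \<noteq> 0" "\<forall>i\<in>I. (\<Sum>j\<in>J'. (a i j - a i q * a m j / a m q) * c j) = 0"
      using insert.IH[OF J'(1,2), of "\<lambda>i j. a i j - a i q * a m j / a m q"] by blast
    define s where "s = (\<Sum>j\<in>J'. a m j * c j)"
    define d where "d = (\<lambda>j. if j = q then - s / a m q else c j)"
    have sum: "(\<Sum>j\<in>J. a i j * d j) = a i q * (- s / a m q) + (\<Sum>j\<in>J'. a i j * c j)" for i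
    proof -
      have "(\<Sum>j\<in>J'. a i j * d j) = (\<Sum>j\<in>J'. a i j * c j)"
        using J'(4) by (intro sum.cong) (auto simp: d_def)
      then show ?thesis using J' by (simp add: d_def)
    qed
    have "(\<Sum>j\<in>J. a m j * d j) = 0" unfolding sum s_def[symmetric] using q by simp
    moreover have "(\<Sum>j\<in>J. a i j * d j) = 0" if "i \<in> I" for i
    proof -
      have "(\<Sum>j\<in>J'. (a i j - a i q * a m j / a m q) * c j)
          = (\<Sum>j\<in>J'. a i j * c j) - (\<Sum>j\<in>J'. (a i q / a m q) * (a m j * c j))"
        by (simp add: sum_subtractf[symmetric] algebra_simps)
      also have "\<dots> = (\<Sum>j\<in>J'. a i j * c j) - (a i q / a m q) * s"
        by (simp add: s_def sum_distrib_left)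
      finally show ?thesis using c(2) that sum[of i] by simp
    qed
    moreover have "\<exists>j\<in>J. d j \<noteq> 0" using c(1) J' by (auto simp: d_def)
    ultimately show ?thesis by (intro exI[of _ d]) auto
  qed
qed

definition indep :: "'i set \<Rightarrow> ('i \<Rightarrow> nat \<Rightarrow> rat) \<Rightarrow> bool" where
  "indep I x \<longleftrightarrow> (\<forall>c. (\<Sum>i\<in>I. c i \<star> x i) = 0 \<longrightarrow> (\<forall>i\<in>I. c i = 0))"

lemma indepD: "indep I x \<Longrightarrow> (\<Sum>i\<in>I. c i \<star> x i) = 0 \<Longrightarrow> i \<in> I \<Longrightarrow> c i = 0"
  by (simp add: indep_def)

text \<open>The coordinate space of dimension n + 1, cut out of a single function type so that n can
  be a variable.\<close>

definition vspace :: "nat \<Rightarrow> (nat \<Rightarrow> rat) set" where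
  "vspace n = {x. \<forall>i>n. x i = 0}"

lemma vspace_closed:
  "0 \<in> vspace n" "x \<in> vspace n \<Longrightarrow> y \<in> vspace n \<Longrightarrow> x + y \<in> vspace n"
  "x \<in> vspace n \<Longrightarrow> y \<in> vspace n \<Longrightarrow> x - y \<in> vspace n"
  "x \<in> vspace n \<Longrightarrow> c \<star> x \<in> vspace n"
  "(\<And>i. i \<in> I \<Longrightarrow> f i \<in> vspace n) \<Longrightarrow> (\<Sum>i\<in>I. f i) \<in> vspace n"
  by (auto simp: vspace_def sum_fun_apply)

lemma indep_card_le:
  assumes "finite J" "\<And>j. j \<in> J \<Longrightarrow> x j \<in> vspace n" "indep J x"
  shows "card J \<le> Suc n"
proof (rule ccontr)
  assume "\<not> card J \<le> Suc n"
  then obtain c where c: "\<exists>j\<in>J. c j \<noteq> 0" "\<forall>i\<in>{..n}. (\<Sum>j\<in>J. x j i * c j) = 0"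
    using underdetermined_system[of "{..n}" J "\<lambda>i j. x j i"] assms(1) by auto
  have "(\<Sum>j\<in>J. c j \<star> x j) i = 0" for i
    using c(2) assms(2) by (cases "i \<le> n") (auto simp: sum_fun_apply mult.commute vspace_def)
  then have "(\<Sum>j\<in>J. c j \<star> x j) = 0" by (simp add: fun_eq_iff)
  then show False using assms(3) c(1) by (auto simp: indep_def)
qed

text \<open>Adding v under the index \<open>None\<close> gives n + 2 vectors, hence a dependence,
  and v must occur in it.\<close>

lemma indep_span:
  assumes "finite J" "\<And>j. j \<in> J \<Longrightarrow> x j \<in> vspace n" "indep J x" "card J = Suc n" "v \<in> vspace n"
  shows "\<exists>c. v = (\<Sum>j\<in>J. c j \<star> x j)"
proof -
  define y where "y = case_option v x"
  define J' where "J' = insert None (Some ` J)"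
  have fin: "finite J'" and card: "card J' = Suc (Suc n)"
    using assms(1,4) by (auto simp: J'_def card_image)
  have "\<not> indep J' y"
  proof
    assume "indep J' y"
    moreover have "y j \<in> vspace n" if "j \<in> J'" for j
      using that assms(2,5) by (auto simp: J'_def y_def)
    ultimately show False using indep_card_le[of J' y n] fin card by simp
  qed
  then obtain c j where c: "(\<Sum>i\<in>J'. c i \<star> y i) = 0" "j \<in> J'" "c j \<noteq> 0" by (auto simp: indep_def)
  have s: "c None \<star> v + (\<Sum>i\<in>J. c (Some i) \<star> x i) = 0"
    using c(1) assms(1) by (simp add: J'_def sum.reindex y_def)
  have "c None \<noteq> 0"
  proof
    assume "c None = 0"
    then have "\<forall>i\<in>J. c (Some i) = 0" using s assms(3) by (auto simp: indep_def)
    then show False using c \<open>c None = 0\<close> by (auto simp: J'_def)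
  qed
  moreover have "v = (1 / c None) \<star> (c None \<star> v)" using calculation by simp
  moreover have "c None \<star> v = - (\<Sum>i\<in>J. c (Some i) \<star> x i)" using s by (simp add: eq_neg_iff_add_eq_0)
  ultimately have "v = (1 / c None) \<star> (-1) \<star> (\<Sum>i\<in>J. c (Some i) \<star> x i)" by (metis smul_uminus)
  then show ?thesis unfolding smul_sum smul_smul by (intro exI[of _ "\<lambda>i. 1 / c None * (- 1 * c (Some i))"]) simp
qed

lemma annihilator_exists:
  assumes "finite J" "card J < Suc n"
  shows "\<exists>\<phi>. (\<exists>i\<le>n. \<phi> i \<noteq> 0) \<and> (\<forall>j\<in>J. (\<Sum>i\<le>n. \<phi> i * x j i) = (0 :: rat))"
  using underdetermined_system[of J "{..n}" "\<lambda>j i. x j i"] assms by (auto simp: mult.commute)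

definition std_vec :: "nat \<Rightarrow> nat \<Rightarrow> rat" where
  "std_vec j = (\<lambda>k. if k = j then 1 else 0)"

section \<open>The ring of p-integral rationals and its valuation\<close>

locale plocal =
  fixes p n :: nat
  assumes prime: "prime p" and n1: "n \<ge> 1"
begin

abbreviation P :: rat where "P \<equiv> of_nat p"

abbreviation N :: int where "N \<equiv> int (Suc n)"

definition ring_p :: "rat set" where
  "ring_p = {of_int a / of_int b | a b. \<not> int p dvd b}"

definition unit_p :: "rat set" where
  "unit_p = {u \<in> ring_p. \<exists>w\<in>ring_p. u * w = 1}"

lemma P_neq_0 [simp]: "P \<noteq> 0"
  using prime by (simp add: prime_gt_0_nat)

lemma p_neq_0 [simp]: "p \<noteq> 0"
  using P_neq_0 by (metis of_nat_0)

lemma prime_int: "prime (int p)"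
  using prime by simp

lemma ring_p_int [simp]: "of_int a \<in> ring_p"
proof -
  have "\<not> int p dvd 1" using prime_int not_prime_unit by blast
  then show ?thesis unfolding ring_p_def by (intro CollectI exI[of _ a] exI[of _ 1]) simp
qed

lemma ring_p_of_nat [simp]: "of_nat a \<in> ring_p"
  using ring_p_int[of "int a"] by simp

lemma ring_p_0 [simp]: "0 \<in> ring_p" and ring_p_1 [simp]: "1 \<in> ring_p"
  using ring_p_int[of 0] ring_p_int[of 1] by simp_all

lemma ring_p_add: assumes "x \<in> ring_p" "y \<in> ring_p" shows "x + y \<in> ring_p"
proof -
  obtain a b c d where e: "x = of_int a / of_int b" "y = of_int c / of_int d" "\<not> int p dvd b" "\<not> int p dvd d"
    using assms unfolding ring_p_def by blast
  have "x + y = of_int (a * d + c * b) / of_int (b * d)"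
  proof -
    have "b \<noteq> 0" "d \<noteq> 0" using e by auto
    then show ?thesis using e by (simp add: add_frac_eq)
  qed
  moreover have "\<not> int p dvd b * d" using e prime_int by (simp add: prime_dvd_mult_iff)
  ultimately show ?thesis unfolding ring_p_def by blast
qed

lemma ring_p_mult: assumes "x \<in> ring_p" "y \<in> ring_p" shows "x * y \<in> ring_p"
proof -
  obtain a b c d where e: "x = of_int a / of_int b" "y = of_int c / of_int d" "\<not> int p dvd b" "\<not> int p dvd d"
    using assms unfolding ring_p_def by blast
  have "x * y = of_int (a * c) / of_int (b * d)" using e by auto
  moreover have "\<not> int p dvd b * d" using e prime_int by (simp add: prime_dvd_mult_iff)
  ultimately show ?thesis unfolding ring_p_def by blast
qed

lemma ring_p_uminus: "x \<in> ring_p \<Longrightarrow> - x \<in> ring_p"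
  using ring_p_mult[of "of_int (-1)" x] ring_p_int[of "-1"] by simp

lemma ring_p_power: "x \<in> ring_p \<Longrightarrow> x ^ k \<in> ring_p"
  by (induction k) (auto intro: ring_p_mult)

lemma ring_p_sum: "(\<And>i. i \<in> I \<Longrightarrow> f i \<in> ring_p) \<Longrightarrow> sum f I \<in> ring_p"
  by (induction I rule: infinite_finite_induct) (auto intro: ring_p_add)

lemma ring_p_prod: "(\<And>i. i \<in> I \<Longrightarrow> f i \<in> ring_p) \<Longrightarrow> prod f I \<in> ring_p"
  by (induction I rule: infinite_finite_induct) (auto intro: ring_p_mult)

lemma inv_P_notin: "1 / P \<notin> ring_p"
proof
  assume "1 / P \<in> ring_p"
  then obtain a b where e: "1 / P = of_int a / of_int b" "\<not> int p dvd b" unfolding ring_p_def by blast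
  then have b: "b \<noteq> 0" by auto
  then have "of_int b = (of_int (a * int p) :: rat)" using e(1) by (simp add: field_simps)
  then have "b = a * int p" by (simp only: of_int_eq_iff)
  then show False using e(2) by simp
qed

lemma unit_pD: "u \<in> unit_p \<Longrightarrow> u \<in> ring_p" "u \<in> unit_p \<Longrightarrow> u \<noteq> 0" "u \<in> unit_p \<Longrightarrow> 1 / u \<in> ring_p"
proof -
  assume "u \<in> unit_p"
  then obtain w where w: "u \<in> ring_p" "w \<in> ring_p" "u * w = 1" unfolding unit_p_def by blast
  then have "u \<noteq> 0" by auto
  moreover have "w = 1 / u" using w(3) calculation by (simp add: field_simps)
  ultimately show "u \<in> ring_p" "u \<noteq> 0" "1 / u \<in> ring_p" using w by auto
qed

lemma unit_pI: "u \<in> ring_p \<Longrightarrow> u \<noteq> 0 \<Longrightarrow> 1 / u \<in> ring_p \<Longrightarrow> u \<in> unit_p"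
  unfolding unit_p_def by (auto intro: bexI[of _ "1 / u"])

lemma unit_p_1 [simp]: "1 \<in> unit_p" by (rule unit_pI) auto

lemma unit_p_mult: "u \<in> unit_p \<Longrightarrow> v \<in> unit_p \<Longrightarrow> u * v \<in> unit_p"
proof (rule unit_pI)
  assume u: "u \<in> unit_p" "v \<in> unit_p"
  show "u * v \<in> ring_p" "u * v \<noteq> 0" using u unit_pD ring_p_mult by auto
  show "1 / (u * v) \<in> ring_p" using ring_p_mult[OF unit_pD(3)[OF u(1)] unit_pD(3)[OF u(2)]] by simp
qed

lemma unit_p_inverse: "u \<in> unit_p \<Longrightarrow> 1 / u \<in> unit_p"
  using unit_pD[of u] by (intro unit_pI) auto

lemma unit_p_frac:
  assumes "\<not> int p dvd a" "\<not> int p dvd b"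
  shows "of_int a / of_int b \<in> unit_p"
proof (rule unit_pI)
  have ab: "a \<noteq> 0" "b \<noteq> 0" using assms by auto
  show "of_int a / of_int b \<in> ring_p" using assms unfolding ring_p_def by blast
  show "of_int a / of_int b \<noteq> (0::rat)" using ab by simp
  have "1 / (of_int a / of_int b) = of_int b / (of_int a :: rat)" by simp
  then show "1 / (of_int a / of_int b) \<in> ring_p" using assms unfolding ring_p_def by auto
qed

lemma val_exists:
  assumes "x \<noteq> 0"
  shows "\<exists>m. \<exists>u\<in>unit_p. x = P powi m * u"
proof -
  obtain a b where ab: "x = of_int a / of_int b" "b \<noteq> 0"
    using quotient_of_div[of x] quotient_of_denom_pos[of x] by (cases "quotient_of x") auto
  have a: "a \<noteq> 0" using assms ab by auto
  have np: "\<not> is_unit (int p)" using prime_int not_prime_unit by blast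
  have "\<exists>k y. z = int p ^ k * y \<and> \<not> int p dvd y" if "z \<noteq> 0" for z
    by (metis multiplicity_decompose'[OF that np])
  then obtain i a' j b' where d: "a = int p ^ i * a'" "\<not> int p dvd a'" "b = int p ^ j * b'" "\<not> int p dvd b'"
    using a ab(2) by metis
  have "x = P powi (int i - int j) * (of_int a' / of_int b')"
    unfolding ab d by (simp add: power_int_diff)
  then show ?thesis using unit_p_frac[OF d(2,4)] by blast
qed

text \<open>The value at 0 is unspecified, so zero is always treated apart; \<open>val_ge\<close> is
  the convention in which 0 has infinite valuation.\<close>

definition val :: "rat \<Rightarrow> int" where
  "val x = (THE m. \<exists>u\<in>unit_p. x = P powi m * u)"

text \<open>Otherwise multiplication by a power of p and by the inverse unit would bring 1 / p into
  the ring.\<close>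

lemma P_powi_neg_notin: assumes "u \<in> unit_p" "m < 0" shows "P powi m * u \<notin> ring_p"
proof
  assume a: "P powi m * u \<in> ring_p"
  have "P ^ nat (- m - 1) * (1 / u) * (P powi m * u) \<in> ring_p"
    using a unit_pD(3)[OF assms(1)] ring_p_mult[OF ring_p_mult[OF ring_p_power[OF ring_p_of_nat]]] by blast
  moreover have "P ^ nat (- m - 1) = P powi (- m - 1)" using assms(2) power_int_of_nat[of P "nat (- m - 1)"]
    by (simp del: power_int_of_nat)
  moreover have "P powi (- m - 1) * P powi m = 1 / P"
    by (subst power_int_add[symmetric]) (auto simp: power_int_minus divide_inverse)
  moreover have "P powi (- m - 1) * (1 / u) * (P powi m * u) = P powi (- m - 1) * P powi m"
    using unit_pD(2)[OF assms(1)] by simp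
  ultimately show False using inv_P_notin by metis
qed

lemma val_unique:
  assumes "u \<in> unit_p"
  shows "val (P powi m * u) = m"
  unfolding val_def
proof (rule the_equality)
  show "\<exists>v\<in>unit_p. P powi m * u = P powi m * v" using assms by blast
  fix k assume "\<exists>v\<in>unit_p. P powi m * u = P powi k * v"
  then obtain v where v: "v \<in> unit_p" "P powi m * u = P powi k * v" by blast
  have "P powi (m - k) * (u * (1 / v)) = 1" "P powi (k - m) * (v * (1 / u)) = 1"
    using v(2) unit_pD(2)[OF v(1)] unit_pD(2)[OF assms] by (simp_all add: power_int_diff divide_simps mult.commute)
  then have "\<not> m - k < 0" "\<not> k - m < 0"
    using P_powi_neg_notin[OF unit_p_mult[OF assms unit_p_inverse[OF v(1)]], of "m - k"]
      P_powi_neg_notin[OF unit_p_mult[OF v(1) unit_p_inverse[OF assms]], of "k - m"] by auto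
  then show "k = m" by simp
qed

lemma val_decomp:
  assumes "x \<noteq> 0"
  obtains u where "u \<in> unit_p" "x = P powi val x * u"
  using val_exists[OF assms] val_unique by metis

lemma val_mult: assumes "x \<noteq> 0" "y \<noteq> 0" shows "val (x * y) = val x + val y"
proof -
  obtain u v where u: "u \<in> unit_p" "x = P powi val x * u" and v: "v \<in> unit_p" "y = P powi val y * v"
    using val_decomp assms by metis
  have "x * y = P powi (val x + val y) * (u * v)"
    by (subst u(2), subst v(2)) (simp add: power_int_add)
  then show ?thesis using val_unique[OF unit_p_mult[OF u(1) v(1)]] by metis
qed

lemma val_P_powi [simp]: "val (P powi m) = m"
  using val_unique[of 1 m] by simp

lemma val_unit [simp]: "u \<in> unit_p \<Longrightarrow> val u = 0"
  using val_unique[of u 0] by simp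

lemma val_P_power [simp]: "val (P ^ k) = int k"
  using val_P_powi[of "int k"] by simp

lemma val_P [simp]: "val P = 1" using val_P_power[of 1] by simp

lemma ring_p_iff: "x \<in> ring_p \<longleftrightarrow> x = 0 \<or> val x \<ge> 0"
proof (cases "x = 0")
  case False
  then obtain u where u: "u \<in> unit_p" "x = P powi val x * u" by (rule val_decomp)
  have "x \<in> ring_p" if "val x \<ge> 0"
  proof -
    have "x = P ^ nat (val x) * u" using u(2) that by (metis power_int_of_nat nat_0_le)
    then show ?thesis using u(1) unit_pD by (metis ring_p_mult ring_p_power ring_p_of_nat)
  qed
  then show ?thesis using False P_powi_neg_notin[OF u(1)] u(2) by (metis linorder_not_le)
qed simp

lemma unit_p_iff: "u \<in> unit_p \<longleftrightarrow> u \<noteq> 0 \<and> val u = 0"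
proof
  assume "u \<noteq> 0 \<and> val u = 0"
  then show "u \<in> unit_p" using val_decomp[of u] by (metis mult_1 power_int_0_right)
qed (use unit_pD(2) in auto)

lemma P_powi_ring_p [simp]: "P powi m \<in> ring_p \<longleftrightarrow> m \<ge> 0"
  by (simp add: ring_p_iff)

definition val_ge :: "int \<Rightarrow> rat \<Rightarrow> bool" where
  "val_ge k x \<longleftrightarrow> x = 0 \<or> k \<le> val x"

lemma val_ge_iff: "val_ge k x \<longleftrightarrow> P powi (- k) * x \<in> ring_p"
  by (cases "x = 0") (auto simp: val_ge_def ring_p_iff val_mult)

lemma val_ge_add: "val_ge k x \<Longrightarrow> val_ge k y \<Longrightarrow> val_ge k (x + y)"
  unfolding val_ge_iff by (simp add: distrib_left ring_p_add)

lemma val_ge_mult: "c \<in> ring_p \<Longrightarrow> val_ge k x \<Longrightarrow> val_ge k (c * x)"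
  unfolding val_ge_iff using ring_p_mult by (metis mult.left_commute)

text \<open>The digits 0, ..., p - 1 represent the residue field; for a / b the digit is a times an
  inverse of b modulo p. They make it possible to compare dimensions over the residue field by
  counting.\<close>

lemma digit_exists:
  assumes "x \<in> ring_p"
  shows "\<exists>a<p. \<exists>y\<in>ring_p. x = of_nat a + P * y"
proof -
  obtain a b where ab: "x = of_int a / of_int b" "\<not> int p dvd b" using assms unfolding ring_p_def by blast
  have "coprime b (int p)" using ab(2) prime_int by (metis coprime_commute prime_imp_coprime)
  then obtain c where c: "[b * c = 1] (mod int p)" using cong_solve_coprime_int by blast
  define r where "r = nat ((a * c) mod int p)"
  have r: "r < p" "int r = (a * c) mod int p"
    using prime_gt_0_nat[OF prime] by (auto simp: r_def nat_less_iff)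
  have "[a - int r * b = a - a * c * b] (mod int p)"
    unfolding r(2) by (intro cong_diff cong_mult) (auto simp: cong_def)
  moreover have "[a - a * c * b = a - a * 1] (mod int p)"
    using c by (intro cong_diff cong_refl) (use cong_scalar_left[OF c, of a] in \<open>simp add: mult.assoc mult.commute[of b]\<close>)
  ultimately have "[a - int r * b = 0] (mod int p)" by (metis cong_trans diff_self mult.right_neutral)
  then obtain d where d: "a - int r * b = int p * d" by (auto simp: cong_0_iff dvd_def)
  have b: "b \<noteq> 0" using ab(2) by auto
  have "x = of_nat r + P * (of_int d / of_int b)"
  proof -
    have "(of_int a :: rat) = of_int (int r * b + int p * d)" using d by (metis diff_add_cancel add.commute)
    then show ?thesis using b unfolding ab by (simp add: field_simps)
  qed
  moreover have "of_int d / of_int b \<in> ring_p" using ab(2) unfolding ring_p_def by blast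
  ultimately show ?thesis using r(1) by blast
qed

lemma digit_diff_unit:
  assumes "a < p" "b < p" "a \<noteq> b"
  shows "of_nat a - of_nat b \<in> unit_p"
proof -
  have "\<not> int p dvd (int a - int b)"
  proof
    assume "int p dvd int a - int b"
    then have "int p \<le> \<bar>int a - int b\<bar>" using assms(3) dvd_imp_le_int[of "int a - int b" "int p"] by auto
    then show False using assms by linarith
  qed
  moreover have "\<not> int p dvd 1" using prime_int not_prime_unit by blast
  ultimately have "of_int (int a - int b) / of_int 1 \<in> unit_p" by (rule unit_p_frac)
  then show ?thesis by simp
qed

lemma unit_or_P_mult:
  assumes "x \<in> ring_p" "x \<notin> unit_p"
  shows "\<exists>y\<in>ring_p. x = P * y"
proof (intro bexI)
  show "x = P * (x / P)" by simp
  show "x / P \<in> ring_p"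
  proof (cases "x = 0")
    case False
    then have "val x \<ge> 1" using assms by (auto simp: ring_p_iff unit_p_iff)
    moreover have "val (x / P) = val x - 1"
      using val_mult[of "x / P" P] False by simp
    ultimately show ?thesis by (simp add: ring_p_iff)
  qed simp
qed

end

section \<open>Lattices, periodic chains and frames\<close>

context plocal
begin

abbreviation V :: "(nat \<Rightarrow> rat) set" where "V \<equiv> vspace n"

definition submod :: "(nat \<Rightarrow> rat) set \<Rightarrow> bool" where
  "submod X \<longleftrightarrow> 0 \<in> X \<and> (\<forall>x\<in>X. \<forall>y\<in>X. x + y \<in> X) \<and> (\<forall>c\<in>ring_p. \<forall>x\<in>X. c \<star> x \<in> X)"

lemma submodD:
  assumes "submod X"
  shows "0 \<in> X" "x \<in> X \<Longrightarrow> y \<in> X \<Longrightarrow> x + y \<in> X" "c \<in> ring_p \<Longrightarrow> x \<in> X \<Longrightarrow> c \<star> x \<in> X"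
    "x \<in> X \<Longrightarrow> y \<in> X \<Longrightarrow> x - y \<in> X"
    "(\<And>i. i \<in> I \<Longrightarrow> f i \<in> X) \<Longrightarrow> (\<Sum>i\<in>I. f i) \<in> X"
proof -
  show z: "0 \<in> X" and add: "\<And>x y. x \<in> X \<Longrightarrow> y \<in> X \<Longrightarrow> x + y \<in> X"
    and mult: "\<And>c x. c \<in> ring_p \<Longrightarrow> x \<in> X \<Longrightarrow> c \<star> x \<in> X"
    using assms unfolding submod_def by blast+
  show "x \<in> X \<Longrightarrow> y \<in> X \<Longrightarrow> x - y \<in> X"
    using add[of x "(- 1) \<star> y"] mult[of "- 1" y] ring_p_uminus[of 1] by (simp add: smul_uminus)
  show "(\<And>i. i \<in> I \<Longrightarrow> f i \<in> X) \<Longrightarrow> (\<Sum>i\<in>I. f i) \<in> X"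
    by (induction I rule: infinite_finite_induct) (auto intro: z add)
qed

definition sc :: "rat \<Rightarrow> (nat \<Rightarrow> rat) set \<Rightarrow> (nat \<Rightarrow> rat) set" where
  "sc c X = (\<star>) c ` X"

lemma sc_sc [simp]: "sc c (sc d X) = sc (c * d) X"
  by (auto simp: sc_def image_image)

lemma sc_1 [simp]: "sc 1 X = X"
  by (auto simp: sc_def)

lemma mem_sc_iff: "c \<noteq> 0 \<Longrightarrow> x \<in> sc c X \<longleftrightarrow> (1 / c) \<star> x \<in> X"
  by (auto simp: sc_def intro: rev_image_eqI[of "(1 / c) \<star> x"])

lemma smul_mem_sc [simp]: "c \<noteq> 0 \<Longrightarrow> c \<star> x \<in> sc c X \<longleftrightarrow> x \<in> X"
  by (simp add: mem_sc_iff)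

lemma sc_mono: "X \<subseteq> Y \<Longrightarrow> sc c X \<subseteq> sc c Y"
  by (auto simp: sc_def)

lemma sc_subset_iff [simp]: "c \<noteq> 0 \<Longrightarrow> sc c X \<subseteq> sc c Y \<longleftrightarrow> X \<subseteq> Y"
  using sc_mono[of X Y c] sc_mono[of "sc c X" "sc c Y" "1 / c"] by auto

lemma sc_eq_iff: "c \<noteq> 0 \<Longrightarrow> sc c X = sc c Y \<longleftrightarrow> X = Y"
  by (simp add: set_eq_subset)

lemma sc_psubset_iff: "c \<noteq> 0 \<Longrightarrow> sc c X \<subset> sc c Y \<longleftrightarrow> X \<subset> Y"
  by (simp add: psubset_eq sc_eq_iff)

lemma submod_sc: "submod X \<Longrightarrow> submod (sc c X)"
  unfolding submod_def sc_def
proof (intro conjI ballI)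
  assume X: "0 \<in> X \<and> (\<forall>x\<in>X. \<forall>y\<in>X. x + y \<in> X) \<and> (\<forall>c\<in>ring_p. \<forall>x\<in>X. c \<star> x \<in> X)"
  then show "0 \<in> (\<star>) c ` X" by (auto intro!: rev_image_eqI[of 0])
  fix x y assume "x \<in> (\<star>) c ` X" "y \<in> (\<star>) c ` X"
  then show "x + y \<in> (\<star>) c ` X" using X by (auto simp: smul_add_right[symmetric])
next
  assume X: "0 \<in> X \<and> (\<forall>x\<in>X. \<forall>y\<in>X. x + y \<in> X) \<and> (\<forall>c\<in>ring_p. \<forall>x\<in>X. c \<star> x \<in> X)"
  fix d x assume "d \<in> ring_p" "x \<in> (\<star>) c ` X"
  then obtain y where "y \<in> X" "x = c \<star> y" by blast
  then have "d \<star> x = c \<star> (d \<star> y)" by (simp add: mult.commute)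
  then show "d \<star> x \<in> (\<star>) c ` X" using X \<open>d \<in> ring_p\<close> \<open>y \<in> X\<close> by blast
qed

definition L0 :: "(nat \<Rightarrow> rat) set" where
  "L0 = {x \<in> V. \<forall>i. x i \<in> ring_p}"

lemma submod_L0: "submod L0"
  unfolding submod_def L0_def by (auto intro: vspace_closed ring_p_add ring_p_mult)

text \<open>Lattices are introduced as the submodules commensurable with the standard one, a
  condition that passes easily to larger and smaller modules. That they have bases is a consequence
  of the construction of frames (\<open>lattice_latspan_ex\<close>).\<close>

definition lattice :: "(nat \<Rightarrow> rat) set \<Rightarrow> bool" where
  "lattice X \<longleftrightarrow> submod X \<and> X \<subseteq> V \<and> (\<exists>m. sc (P ^ m) L0 \<subseteq> X \<and> sc (P ^ m) X \<subseteq> L0)"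

lemma lattice_submod: "lattice X \<Longrightarrow> submod X" and lattice_V: "lattice X \<Longrightarrow> X \<subseteq> V"
  by (auto simp: lattice_def)

lemma sc_P_power_le: "submod X \<Longrightarrow> sc (P ^ m) X \<subseteq> X"
  by (auto simp: sc_def intro!: submodD(3) ring_p_power)

lemma sc_P_power_mono: "submod X \<Longrightarrow> k \<le> m \<Longrightarrow> sc (P ^ m) X \<subseteq> sc (P ^ k) X"
proof -
  assume X: "submod X" "k \<le> m"
  have "sc (P ^ m) X = sc (P ^ (m - k)) (sc (P ^ k) X)"
    using X(2) by (simp add: power_add[symmetric])
  then show ?thesis using sc_P_power_le[OF submod_sc[OF X(1)]] by simp
qed

lemma lattice_commensurable:
  assumes "lattice X" "lattice Y"
  shows "\<exists>m. sc (P ^ m) X \<subseteq> Y"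
proof -
  obtain k l where "sc (P ^ k) X \<subseteq> L0" "sc (P ^ l) L0 \<subseteq> Y" using assms unfolding lattice_def by blast
  then have "sc (P ^ l) (sc (P ^ k) X) \<subseteq> Y" using sc_mono by blast
  then show ?thesis unfolding sc_sc power_add[symmetric] by blast
qed

lemma lattice_L0: "lattice L0"
  unfolding lattice_def using submod_L0 by (auto simp: L0_def intro!: exI[of _ 0])

lemma lattice_sandwich:
  assumes "submod X" "X \<subseteq> V" "lattice Y" "sc (P ^ k) Y \<subseteq> X" "sc (P ^ l) X \<subseteq> Y"
  shows "lattice X"
proof -
  obtain m where m: "sc (P ^ m) L0 \<subseteq> Y" "sc (P ^ m) Y \<subseteq> L0" using assms(3) unfolding lattice_def by blast
  have "sc (P ^ (k + m)) L0 \<subseteq> X" "sc (P ^ (m + l)) X \<subseteq> L0"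
    using sc_mono[OF m(1), of "P ^ k"] sc_mono[OF assms(5), of "P ^ m"] m assms(4)
    by (auto simp: power_add)
  moreover have "sc (P ^ (m + k + l)) L0 \<subseteq> sc (P ^ (k + m)) L0" "sc (P ^ (m + k + l)) X \<subseteq> sc (P ^ (m + l)) X"
    by (rule sc_P_power_mono; use submod_L0 assms(1) in simp)+
  ultimately show ?thesis unfolding lattice_def using assms(1,2) by blast
qed

lemma lattice_sc: assumes "lattice X" shows "lattice (sc (P powi m) X)"
proof (rule lattice_sandwich)
  show "submod (sc (P powi m) X)" using assms lattice_submod submod_sc by blast
  show "sc (P powi m) X \<subseteq> V" using lattice_V[OF assms] by (auto simp: sc_def intro: vspace_closed)
  show "lattice X" by (rule assms)
  show "sc (P ^ nat m) X \<subseteq> sc (P powi m) X"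
  proof -
    have "sc (P ^ nat m) X = sc (P powi m) (sc (P ^ nat (- m)) X)"
      unfolding sc_sc by (cases "m \<ge> 0") (simp_all add: power_int_def power_mult_distrib[symmetric])
    then show ?thesis using sc_mono[OF sc_P_power_le[OF lattice_submod[OF assms]]] by metis
  qed
  show "sc (P ^ nat (- m)) (sc (P powi m) X) \<subseteq> X"
  proof -
    have "sc (P ^ nat (- m)) (sc (P powi m) X) = sc (P ^ nat m) X"
      unfolding sc_sc by (cases "m \<ge> 0") (simp_all add: power_int_def power_mult_distrib[symmetric])
    then show ?thesis using sc_P_power_le[OF lattice_submod[OF assms]] by metis
  qed
qed

lemma L0_absorb:
  assumes "x \<in> V" shows "\<exists>m. P ^ m \<star> x \<in> L0"
proof -
  have one: "\<exists>m. P ^ m * y \<in> ring_p" for y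
  proof (cases "y = 0")
    case False
    then have "P ^ nat (- val y) * y \<in> ring_p" by (simp add: ring_p_iff val_mult)
    then show ?thesis by blast
  qed (simp add: exI)
  have "\<forall>i. \<exists>m. P ^ m * x i \<in> ring_p" using one by blast
  then obtain m where m: "\<And>i. P ^ m i * x i \<in> ring_p" by metis
  have "P ^ (\<Sum>i\<le>n. m i) * x i \<in> ring_p" if "i \<le> n" for i
  proof -
    have "(\<Sum>i\<le>n. m i) = (\<Sum>i\<in>{..n} - {i}. m i) + m i" using that by (subst sum.remove[of _ i]) auto
    then show ?thesis using ring_p_mult[OF ring_p_power[OF ring_p_of_nat] m[of i]] by (simp add: power_add mult.assoc)
  qed
  moreover have "x i = 0" if "\<not> i \<le> n" for i using assms that by (simp add: vspace_def)
  ultimately have "P ^ (\<Sum>i\<le>n. m i) * x i \<in> ring_p" for i by (cases "i \<le> n") auto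
  then have "P ^ (\<Sum>i\<le>n. m i) \<star> x \<in> L0"
    using vspace_closed(4)[OF assms] by (simp add: L0_def)
  then show ?thesis by blast
qed

lemma lattice_absorb:
  assumes "lattice X" "x \<in> V" shows "\<exists>m. P ^ m \<star> x \<in> X"
proof -
  obtain k where k: "sc (P ^ k) L0 \<subseteq> X" using assms(1) unfolding lattice_def by blast
  obtain m where "P ^ m \<star> x \<in> L0" using L0_absorb[OF assms(2)] by blast
  then have "P ^ k \<star> P ^ m \<star> x \<in> X" using k by (auto simp: sc_def)
  then show ?thesis by (metis smul_smul power_add)
qed

text \<open>A lattice contains no line: at a non-zero coordinate, unbounded denominators would
  survive multiplication by the fixed power of p that takes X into \<open>L0\<close>.\<close>

lemma lattice_bounded:
  assumes "lattice X" "x \<noteq> 0" shows "\<exists>m. P powi (- int m) \<star> x \<notin> X"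
proof (rule ccontr)
  assume "\<nexists>m. P powi (- int m) \<star> x \<notin> X"
  then have a: "P powi (- int m) \<star> x \<in> X" for m by blast
  obtain k where k: "sc (P ^ k) X \<subseteq> L0" using assms(1) unfolding lattice_def by blast
  obtain i where i: "x i \<noteq> 0" using assms(2) by (auto simp: fun_eq_iff)
  have "P ^ k \<star> P powi (- int m) \<star> x \<in> L0" for m using k a[of m] unfolding sc_def by blast
  then have "P ^ k * P powi (- int m) * x i \<in> ring_p" for m by (auto simp: L0_def)
  then have "val (P ^ k * P powi (- int m) * x i) \<ge> 0" for m using i by (simp add: ring_p_iff)
  then have "int k - int m + val (x i) \<ge> 0" for m using i by (simp add: val_mult)
  from this[of "nat (int k + val (x i) + 1)"] show False by linarith
qed

section \<open>Periodic chains of lattices, encoding simplices with r vertices, and levels of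
  vectors\<close>

definition pchain :: "nat \<Rightarrow> (int \<Rightarrow> (nat \<Rightarrow> rat) set) \<Rightarrow> bool" where
  "pchain r X \<longleftrightarrow> r > 0 \<and> (\<forall>k. lattice (X k) \<and> X (k + 1) \<subset> X k \<and> X (k + int r) = sc P (X k))"

lemma pchain_antimono:
  assumes "pchain r X" "k \<le> l" shows "X l \<subseteq> X k"
proof -
  have "X (k + int j) \<subseteq> X k" for j
  proof (induction j)
    case (Suc j)
    have "X (k + int j + 1) \<subset> X (k + int j)" using assms(1) unfolding pchain_def by blast
    then show ?case using Suc by (simp add: add.assoc add.commute[of 1])
  qed simp
  from this[of "nat (l - k)"] show ?thesis using assms(2) by simp
qed

lemma pchain_strict:
  assumes "pchain r X" "k < l" shows "X l \<subset> X k"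
proof (rule subset_psubset_trans)
  show "X l \<subseteq> X (k + 1)" using pchain_antimono[OF assms(1)] assms(2) by simp
  show "X (k + 1) \<subset> X k" using assms(1) unfolding pchain_def by blast
qed

lemma pchain_subset_iff:
  assumes "pchain r X" shows "X l \<subseteq> X k \<longleftrightarrow> k \<le> l"
  using pchain_antimono[OF assms] pchain_strict[OF assms] by (metis linorder_not_le psubset_eq subset_antisym)

lemma periodic_sc:
  assumes "\<And>k. X (k + int r) = sc P (X k)"
  shows "X (k + int r * t) = sc (P powi t) (X k)"
proof -
  have pos: "X (k + int r * int j) = sc (P ^ j) (X k)" for j k
  proof (induction j)
    case (Suc j)
    have "X (k + int r * int (Suc j)) = X (k + int r * int j + int r)" by (simp add: algebra_simps)
    then show ?case using Suc assms by simp
  qed simp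
  show ?thesis
  proof (cases "t \<ge> 0")
    case True
    then show ?thesis using pos[of k "nat t"] by (simp add: power_int_def)
  next
    case False
    have "X k = sc (P ^ nat (- t)) (X (k + int r * t))"
      using pos[of "k + int r * t" "nat (- t)"] False by simp
    then have "sc (P powi t) (X k) = X (k + int r * t)"
      using False by (simp add: power_int_def power_mult_distrib[symmetric])
    then show ?thesis by simp
  qed
qed

lemma pchain_periodic: "pchain r X \<Longrightarrow> X (k + int r * t) = sc (P powi t) (X k)"
  by (rule periodic_sc) (simp add: pchain_def)

lemma pchain_lattice: "pchain r X \<Longrightarrow> lattice (X k)"
  by (simp add: pchain_def)

text \<open>The integral norm attached to the chain; scaling a vector by c adds r times the
  valuation of c. It is meaningful for non-zero vectors only.\<close>

definition lev :: "(int \<Rightarrow> (nat \<Rightarrow> rat) set) \<Rightarrow> (nat \<Rightarrow> rat) \<Rightarrow> int" where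
  "lev X x = (THE k. x \<in> X k \<and> x \<notin> X (k + 1))"

lemma lev_exists:
  assumes X: "pchain r X" and x: "x \<in> V" "x \<noteq> 0"
  shows "\<exists>k. x \<in> X k \<and> x \<notin> X (k + 1)"
proof -
  obtain m where m: "P ^ m \<star> x \<in> X 0" using lattice_absorb[OF pchain_lattice[OF X] x(1)] by blast
  have lo: "x \<in> X (- int r * int m)"
    using m pchain_periodic[OF X, of 0 "- int m"] by (simp add: mem_sc_iff power_int_minus divide_inverse)
  obtain l where l: "P powi (- int l) \<star> x \<notin> X 0" using lattice_bounded[OF pchain_lattice[OF X] x(2)] by blast
  have hi: "x \<notin> X (int r * int l)"
    using l pchain_periodic[OF X, of 0 "int l"] by (simp add: mem_sc_iff power_int_minus divide_inverse)
  show ?thesis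
  proof (rule ccontr)
    assume "\<nexists>k. x \<in> X k \<and> x \<notin> X (k + 1)"
    then have step: "x \<in> X k \<Longrightarrow> x \<in> X (k + 1)" for k by blast
    have "x \<in> X (- int r * int m + int j)" for j
    proof (induction j)
      case (Suc j)
      have "- int r * int m + int (Suc j) = - int r * int m + int j + 1" by simp
      then show ?case using step[OF Suc] by (simp only:)
    qed (use lo in simp)
    from this[of "nat (int r * int l + int r * int m)"] show False using hi by simp
  qed
qed

lemma lev_eqI:
  assumes X: "pchain r X" and "x \<in> X k" "x \<notin> X (k + 1)"
  shows "lev X x = k"
  unfolding lev_def
proof (rule the_equality)
  fix l assume l: "x \<in> X l \<and> x \<notin> X (l + 1)"
  have "\<not> l + 1 \<le> k" "\<not> k + 1 \<le> l" using pchain_antimono[OF X] l assms by blast+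
  then show "l = k" by simp
qed (use assms in blast)

lemma lev_iff:
  assumes X: "pchain r X" and x: "x \<in> V" "x \<noteq> 0"
  shows "x \<in> X k \<longleftrightarrow> k \<le> lev X x"
proof -
  obtain l where l: "x \<in> X l" "x \<notin> X (l + 1)" using lev_exists[OF assms] by blast
  then have "lev X x = l" by (rule lev_eqI[OF X])
  then show ?thesis using l pchain_antimono[OF X, of k l] pchain_antimono[OF X, of "l + 1" k]
    by (cases "k \<le> l") auto
qed

lemma submod_unit_smul:
  assumes "submod X" "u \<in> unit_p" shows "u \<star> x \<in> X \<longleftrightarrow> x \<in> X"
proof
  assume "u \<star> x \<in> X"
  then have "(1 / u) \<star> u \<star> x \<in> X" using submodD(3)[OF assms(1)] unit_pD(3)[OF assms(2)] by blast
  then show "x \<in> X" using unit_pD(2)[OF assms(2)] by simp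
qed (use submodD(3)[OF assms(1)] unit_pD(1)[OF assms(2)] in blast)

lemma lev_smul:
  assumes X: "pchain r X" and x: "x \<in> V" "x \<noteq> 0" and c: "c \<noteq> 0"
  shows "lev X (c \<star> x) = lev X x + int r * val c"
proof (rule lev_eqI[OF X])
  obtain u where u: "u \<in> unit_p" "c = P powi val c * u" using val_decomp[OF c] .
  have mem: "c \<star> x \<in> X (k + int r * val c) \<longleftrightarrow> x \<in> X k" for k
  proof -
    have "c \<star> x = P powi val c \<star> u \<star> x" using u(2) by simp
    moreover have "P powi val c \<star> u \<star> x \<in> sc (P powi val c) (X k) \<longleftrightarrow> u \<star> x \<in> X k" by (rule smul_mem_sc) simp
    ultimately show ?thesis
      unfolding pchain_periodic[OF X] using submod_unit_smul[OF lattice_submod[OF pchain_lattice[OF X]] u(1)] by metis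
  qed
  show "c \<star> x \<in> X (lev X x + int r * val c)" using mem lev_iff[OF X x] by simp
  have "c \<star> x \<notin> X (lev X x + 1 + int r * val c)" using mem lev_iff[OF X x] by simp
  then show "c \<star> x \<notin> X (lev X x + int r * val c + 1)" by (simp add: algebra_simps)
qed

text \<open>Summands of distinct levels cannot cancel, so the level of a sum is the least one.\<close>

lemma pchain_split:
  assumes X: "pchain r X" and fin: "finite I" and x: "\<And>i. i \<in> I \<Longrightarrow> x i \<in> V" "\<And>i. i \<in> I \<Longrightarrow> x i \<noteq> 0"
    and inj: "inj_on (\<lambda>i. lev X (x i) mod int r) I"
    and sum: "(\<Sum>i\<in>I. c i \<star> x i) \<in> X k" and i: "i \<in> I"
  shows "c i \<star> x i \<in> X k"
proof (rule ccontr)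
  define B where "B = {i \<in> I. c i \<star> x i \<notin> X k}"
  define l where "l = (\<lambda>i. lev X (c i \<star> x i))"
  assume "c i \<star> x i \<notin> X k"
  then have "B \<noteq> {}" "finite B" using i fin by (auto simp: B_def)
  then obtain j where j: "j \<in> B" "\<And>i. i \<in> B \<Longrightarrow> l j \<le> l i"
    using ex_is_arg_min_if_finite[of B l] by (auto simp: is_arg_min_linorder)
  have jI: "j \<in> I" "c j \<star> x j \<notin> X k" using j(1) by (auto simp: B_def)
  note sub = lattice_submod[OF pchain_lattice[OF X]]
  have cj: "c j \<noteq> 0" using jI submodD(1)[OF sub] by auto
  have V: "c i \<star> x i \<in> V" if "i \<in> I" for i using x(1)[OF that] by (rule vspace_closed)
  have lk: "l j < k" using jI lev_iff[OF X V[OF jI(1)]] cj x(2) by (auto simp: l_def smul_eq_0_iff)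
  have oth: "c i \<star> x i \<in> X (l j + 1)" if "i \<in> I - {j}" for i
  proof (cases "i \<in> B")
    case True
    then have ci: "c i \<noteq> 0" using submodD(1)[OF sub] by (auto simp: B_def)
    have "l i = lev X (x i) + int r * val (c i)" "l j = lev X (x j) + int r * val (c j)"
      using lev_smul[OF X] x that jI ci cj by (auto simp: l_def)
    moreover have "lev X (x i) mod int r \<noteq> lev X (x j) mod int r"
      using inj_onD[OF inj, of i j] that jI by auto
    ultimately have "l i \<noteq> l j" by (metis mod_mult_self2)
    then have "l j + 1 \<le> l i" using j(2)[OF True] by simp
    then show ?thesis using lev_iff[OF X V, of i] that ci x(2)[of i] by (auto simp: l_def smul_eq_0_iff)
  next
    case False
    then show ?thesis using that lk pchain_antimono[OF X, of "l j + 1" k] by (auto simp: B_def)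
  qed
  \<comment> \<open>The summand of least level equals the total minus the other summands, all of
    which lie at least one step deeper.\<close>
  have "c j \<star> x j = (\<Sum>i\<in>I. c i \<star> x i) - (\<Sum>i\<in>I - {j}. c i \<star> x i)"
    using fin jI(1) by (simp add: sum_diff1)
  also have "\<dots> \<in> X (l j + 1)"
  proof (rule submodD(4)[OF sub])
    show "(\<Sum>i\<in>I. c i \<star> x i) \<in> X (l j + 1)" using sum lk pchain_antimono[OF X, of "l j + 1" k] by auto
    show "(\<Sum>i\<in>I - {j}. c i \<star> x i) \<in> X (l j + 1)" by (rule submodD(5)[OF sub oth])
  qed
  finally show False
    using lev_iff[OF X V[OF jI(1)]] cj x(2)[OF jI(1)] by (auto simp: l_def smul_eq_0_iff)
qed

text \<open>A vanishing combination lies in every lattice of the chain, hence so does each summand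
  by \<open>pchain_split\<close>, and a non-zero vector has a finite level.\<close>

lemma pchain_indep:
  assumes X: "pchain r X" and fin: "finite I" and x: "\<And>i. i \<in> I \<Longrightarrow> x i \<in> V" "\<And>i. i \<in> I \<Longrightarrow> x i \<noteq> 0"
    and inj: "inj_on (\<lambda>i. lev X (x i) mod int r) I"
  shows "indep I x"
  unfolding indep_def
proof (intro allI impI ballI)
  fix c i assume s: "(\<Sum>i\<in>I. c i \<star> x i) = 0" and i: "i \<in> I"
  have all: "c i \<star> x i \<in> X k" for k
    using pchain_split[OF X fin x inj _ i, of c k] s submodD(1)[OF lattice_submod[OF pchain_lattice[OF X]]] by simp
  show "c i = 0"
  proof (rule ccontr)
    assume "c i \<noteq> 0"
    then have "k \<le> lev X (c i \<star> x i)" for k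
      using all[of k] lev_iff[OF X, of "c i \<star> x i" k] x[OF i] vspace_closed(4) by (auto simp: smul_eq_0_iff)
    from this[of "lev X (c i \<star> x i) + 1"] show False by simp
  qed
qed

section \<open>Bases, split lattices and periodic frames\<close>

definition basis :: "(nat \<Rightarrow> nat \<Rightarrow> rat) \<Rightarrow> bool" where
  "basis b \<longleftrightarrow> (\<forall>i\<le>n. b i \<in> V) \<and> indep {..n} b"

lemma basis_V: "basis b \<Longrightarrow> i \<le> n \<Longrightarrow> b i \<in> V"
  by (simp add: basis_def)

lemma basis_span: "basis b \<Longrightarrow> x \<in> V \<Longrightarrow> \<exists>c. x = (\<Sum>i\<le>n. c i \<star> b i)"
  using indep_span[of "{..n}" b n x] by (auto simp: basis_def)

lemma basis_unique:
  assumes "basis b" "(\<Sum>i\<le>n. c i \<star> b i) = (\<Sum>i\<le>n. d i \<star> b i)" "i \<le> n"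
  shows "c i = d i"
proof -
  have "(\<Sum>i\<le>n. (c i - d i) \<star> b i) = 0" using assms(2) by (simp add: smul_minus_left sum_subtractf)
  moreover have "indep {..n} b" using assms(1) by (simp add: basis_def)
  ultimately have "c i - d i = 0" using indepD[of "{..n}" b "\<lambda>i. c i - d i" i] assms(3) by simp
  then show ?thesis by simp
qed

lemma basis_neq_0: assumes "basis b" "i \<le> n" shows "b i \<noteq> 0"
proof
  assume "b i = 0"
  then have "(\<Sum>j\<le>n. (if j = i then 1 else 0) \<star> b j) = (\<Sum>j\<le>n. 0 \<star> b j)"
    using sum_delta_smul[of "{..n}" i 1 b] assms(2) by simp
  from basis_unique[OF assms(1) this assms(2)] show False by simp
qed

text \<open>X is the direct sum of its intersections with the lines spanned by the b i. Only the
  lines matter, so permuting and rescaling b changes nothing.\<close>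

definition split :: "(nat \<Rightarrow> nat \<Rightarrow> rat) \<Rightarrow> (nat \<Rightarrow> rat) set \<Rightarrow> bool" where
  "split b X \<longleftrightarrow> (\<forall>c. (\<Sum>i\<le>n. c i \<star> b i) \<in> X \<longrightarrow> (\<forall>i\<le>n. c i \<star> b i \<in> X))"

text \<open>A basis together with an enumeration, by the integers, of all multiples of its vectors
  by powers of p. Affine permutations act on frames by reindexing.\<close>

definition pframe :: "(int \<Rightarrow> nat \<Rightarrow> rat) \<Rightarrow> bool" where
  "pframe F \<longleftrightarrow> (\<forall>k. F (k + N) = P \<star> F k) \<and> basis (\<lambda>i. F (int i))"

text \<open>The lattice spanned by all F m with m \<ge> k, in coordinates: for non-zero c, the
  vector c F i is a unit multiple of F (i + N v) with v the valuation of c.\<close>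

definition std :: "(int \<Rightarrow> nat \<Rightarrow> rat) \<Rightarrow> int \<Rightarrow> (nat \<Rightarrow> rat) set" where
  "std F k = {x. \<exists>c. x = (\<Sum>i\<le>n. c i \<star> F (int i)) \<and> (\<forall>i\<le>n. c i = 0 \<or> k \<le> int i + N * val (c i))}"

lemma periodic_smul:
  assumes "\<And>k. F (k + int r) = P \<star> F k"
  shows "F (k + int r * t) = P powi t \<star> F k"
proof -
  have pos: "F (k + int r * int j) = P ^ j \<star> F k" for j k
  proof (induction j)
    case (Suc j)
    have "k + int r * int (Suc j) = (k + int r * int j) + int r" by (simp add: algebra_simps)
    then have "F (k + int r * int (Suc j)) = P \<star> P ^ j \<star> F k" by (simp only: assms Suc)
    then show ?case unfolding smul_smul by simp
  qed simp
  show ?thesis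
  proof (cases "t \<ge> 0")
    case True
    then show ?thesis using pos[of k "nat t"] by (simp add: power_int_def)
  next
    case False
    have "F k = P ^ nat (- t) \<star> F (k + int r * t)"
      using pos[of "k + int r * t" "nat (- t)"] False by simp
    then have "P powi t \<star> F k = F (k + int r * t)"
      using False by (simp add: power_int_def power_mult_distrib[symmetric])
    then show ?thesis by simp
  qed
qed

lemma pframe_periodic: "pframe F \<Longrightarrow> F (k + N * t) = P powi t \<star> F k"
  by (rule periodic_smul) (unfold pframe_def, blast)

lemma pframe_basis: "pframe F \<Longrightarrow> basis (\<lambda>i. F (int i))"
  by (simp add: pframe_def)

lemma pframe_residue:
  assumes "pframe F"
  obtains i where "i \<le> n" "int i = k mod N" "F k = P powi (k div N) \<star> F (int i)"
proof
  show "nat (k mod N) \<le> n" using pos_mod_bound[of N k] by linarith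
  show i: "int (nat (k mod N)) = k mod N" using pos_mod_sign[of N k] by simp
  show "F k = P powi (k div N) \<star> F (int (nat (k mod N)))"
    using pframe_periodic[OF assms, of "k mod N" "k div N"] unfolding i by simp
qed

lemma pframe_V: assumes "pframe F" shows "F k \<in> V" "F k \<noteq> 0"
proof -
  obtain i where i: "i \<le> n" "F k = P powi (k div N) \<star> F (int i)" using pframe_residue[OF assms] by metis
  show "F k \<in> V" unfolding i(2) using basis_V[OF pframe_basis[OF assms] i(1)] by (rule vspace_closed)
  show "F k \<noteq> 0" unfolding i(2) using basis_neq_0[OF pframe_basis[OF assms] i(1)] by (simp add: smul_eq_0_iff)
qed

lemma std_antimono: "k \<le> l \<Longrightarrow> std F l \<subseteq> std F k"
  unfolding std_def by fastforce

lemma std_split: assumes "pframe F" shows "split (\<lambda>i. F (int i)) (std F k)"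
  unfolding split_def
proof (intro allI impI)
  fix c i assume "(\<Sum>i\<le>n. c i \<star> F (int i)) \<in> std F k" and i: "i \<le> n"
  then obtain d where d: "(\<Sum>i\<le>n. c i \<star> F (int i)) = (\<Sum>i\<le>n. d i \<star> F (int i))"
    "\<forall>i\<le>n. d i = 0 \<or> k \<le> int i + N * val (d i)" unfolding std_def by blast
  have "c i = d i" using basis_unique[OF pframe_basis[OF assms] d(1) i] .
  then have "c i = 0 \<or> k \<le> int i + N * val (c i)" using d(2) i by simp
  moreover have "c i \<star> F (int i) = (\<Sum>j\<le>n. (if j = i then c i else 0) \<star> F (int j))"
    using sum_delta_smul[of "{..n}" i "c i" "\<lambda>j. F (int j)"] i by simp
  ultimately show "c i \<star> F (int i) \<in> std F k"
    unfolding std_def by (intro CollectI exI[of _ "\<lambda>j. if j = i then c i else 0"]) auto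
qed

text \<open>The least v with i + N v \<ge> k is minus the floor of (i - k) / N, so the condition is
  a lower bound on one valuation.\<close>

lemma std_val_ge:
  "c = 0 \<or> k \<le> int i + N * val c \<longleftrightarrow> val_ge (- ((int i - k) div N)) c"
proof -
  have "k \<le> int i + N * v \<longleftrightarrow> - ((int i - k) div N) \<le> v" for v
  proof -
    have "k \<le> int i + N * v \<longleftrightarrow> - v * N \<le> int i - k" by (simp add: algebra_simps)
    also have "\<dots> \<longleftrightarrow> - v \<le> (int i - k) div N"
    proof
      assume "- v * N \<le> int i - k"
      then have "(- v * N) div N \<le> (int i - k) div N" by (rule zdiv_mono1) simp
      then show "- v \<le> (int i - k) div N" by (simp only: nonzero_mult_div_cancel_right[of N "- v"])
    next
      assume "- v \<le> (int i - k) div N"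
      then have "- v * N \<le> (int i - k) div N * N" by (intro mult_right_mono) simp_all
      also have "\<dots> \<le> int i - k" using div_mult_mod_eq[of "int i - k" N] pos_mod_sign[of N "int i - k"] by linarith
      finally show "- v * N \<le> int i - k" .
    qed
    finally show ?thesis by linarith
  qed
  then show ?thesis by (auto simp: val_ge_def)
qed

lemma std_alt:
  "std F k = {x. \<exists>c. x = (\<Sum>i\<le>n. c i \<star> F (int i)) \<and> (\<forall>i\<le>n. val_ge (- ((int i - k) div N)) (c i))}"
  unfolding std_def std_val_ge ..

lemma submod_std: "submod (std F k)"
  unfolding submod_def
proof (intro conjI ballI)
  show "0 \<in> std F k" unfolding std_def by (auto intro!: exI[of _ "\<lambda>_. 0"])
  fix x assume "x \<in> std F k"
  then obtain c where c: "x = (\<Sum>i\<le>n. c i \<star> F (int i))" "\<forall>i\<le>n. val_ge (- ((int i - k) div N)) (c i)"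
    unfolding std_alt by blast
  {
    fix y assume "y \<in> std F k"
    then obtain d where d: "y = (\<Sum>i\<le>n. d i \<star> F (int i))" "\<forall>i\<le>n. val_ge (- ((int i - k) div N)) (d i)"
      unfolding std_alt by blast
    show "x + y \<in> std F k" unfolding std_alt using c d
      by (intro CollectI exI[of _ "\<lambda>i. c i + d i"]) (auto simp: smul_add_left sum.distrib intro: val_ge_add)
  }
  fix d assume "d \<in> ring_p"
  then show "d \<star> x \<in> std F k" unfolding std_alt using c
    by (intro CollectI exI[of _ "\<lambda>i. d * c i"]) (auto simp: smul_sum intro: val_ge_mult)
qed

lemma std_periodic: "std F (k + N) = sc P (std F k)"
proof (intro equalityI subsetI)
  fix x assume "x \<in> std F (k + N)"
  then obtain c where c: "x = (\<Sum>i\<le>n. c i \<star> F (int i))" "\<forall>i\<le>n. c i = 0 \<or> k + N \<le> int i + N * val (c i)"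
    unfolding std_def by blast
  have "(\<Sum>i\<le>n. (c i / P) \<star> F (int i)) \<in> std F k"
    unfolding std_def
  proof (rule CollectI, rule exI[of _ "\<lambda>i. c i / P"], intro conjI allI impI)
    show "(\<Sum>i\<le>n. (c i / P) \<star> F (int i)) = (\<Sum>i\<le>n. (c i / P) \<star> F (int i))" ..
    fix i assume "i \<le> n"
    then show "c i / P = 0 \<or> k \<le> int i + N * val (c i / P)"
      using c(2) val_mult[of "c i / P" P] by (cases "c i = 0") (auto simp: algebra_simps)
  qed
  moreover have "x = P \<star> (\<Sum>i\<le>n. (c i / P) \<star> F (int i))" by (simp add: c(1) smul_sum)
  ultimately show "x \<in> sc P (std F k)" unfolding sc_def by blast
next
  fix x assume "x \<in> sc P (std F k)"
  then obtain c where c: "x = P \<star> (\<Sum>i\<le>n. c i \<star> F (int i))" "\<forall>i\<le>n. c i = 0 \<or> k \<le> int i + N * val (c i)"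
    unfolding std_def sc_def by blast
  show "x \<in> std F (k + N)" unfolding std_def
  proof (rule CollectI, rule exI[of _ "\<lambda>i. P * c i"], intro conjI allI impI)
    show "x = (\<Sum>i\<le>n. (P * c i) \<star> F (int i))" by (simp add: c(1) smul_sum)
    fix i assume "i \<le> n"
    then show "P * c i = 0 \<or> k + N \<le> int i + N * val (P * c i)"
      using c(2) val_mult[of P "c i"] by (cases "c i = 0") (auto simp: algebra_simps)
  qed
qed

lemma mem_std_iff: assumes "pframe F" shows "F m \<in> std F k \<longleftrightarrow> k \<le> m"
proof -
  obtain i where i: "i \<le> n" "int i = m mod N" "F m = P powi (m div N) \<star> F (int i)" by (rule pframe_residue[OF assms])
  have m: "m = int i + N * (m div N)" using i(2) by simp
  have e: "F m = (\<Sum>j\<le>n. (if j = i then P powi (m div N) else 0) \<star> F (int j))"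
    using sum_delta_smul[of "{..n}" i "P powi (m div N)" "\<lambda>j. F (int j)"] i by simp
  show ?thesis
  proof
    assume "F m \<in> std F k"
    then obtain c where c: "F m = (\<Sum>i\<le>n. c i \<star> F (int i))" "\<forall>i\<le>n. c i = 0 \<or> k \<le> int i + N * val (c i)"
      unfolding std_def by blast
    have "P powi (m div N) = c i"
      using basis_unique[OF pframe_basis[OF assms] c(1)[unfolded e] i(1)] by simp
    then have "k \<le> int i + N * (m div N)" using c(2) i(1) by (metis val_P_powi P_neq_0 power_int_eq_0_iff)
    then show "k \<le> m" using m by linarith
  next
    assume "k \<le> m"
    then show "F m \<in> std F k" unfolding std_def using e m i(1)
      by (intro CollectI exI[of _ "\<lambda>j. if j = i then P powi (m div N) else 0"]) auto
  qed
qed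

lemma std_subset_V: assumes "pframe F" shows "std F k \<subseteq> V"
  using pframe_V[OF assms] by (auto simp: std_def intro!: vspace_closed)

definition latspan :: "(nat \<Rightarrow> nat \<Rightarrow> rat) \<Rightarrow> (nat \<Rightarrow> rat) set" where
  "latspan b = {x. \<exists>c. x = (\<Sum>i\<le>n. c i \<star> b i) \<and> (\<forall>i\<le>n. c i \<in> ring_p)}"

lemma submod_latspan: "submod (latspan b)"
  unfolding submod_def
proof (intro conjI ballI)
  show "0 \<in> latspan b" unfolding latspan_def by (auto intro!: exI[of _ "\<lambda>_. 0"])
  fix x assume "x \<in> latspan b"
  then obtain c where c: "x = (\<Sum>i\<le>n. c i \<star> b i)" "\<forall>i\<le>n. c i \<in> ring_p" unfolding latspan_def by blast
  {
    fix y assume "y \<in> latspan b"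
    then obtain d where d: "y = (\<Sum>i\<le>n. d i \<star> b i)" "\<forall>i\<le>n. d i \<in> ring_p" unfolding latspan_def by blast
    show "x + y \<in> latspan b" unfolding latspan_def using c d
      by (intro CollectI exI[of _ "\<lambda>i. c i + d i"]) (auto simp: smul_add_left sum.distrib intro: ring_p_add)
  }
  fix d assume "d \<in> ring_p"
  then show "d \<star> x \<in> latspan b" unfolding latspan_def using c
    by (intro CollectI exI[of _ "\<lambda>i. d * c i"]) (auto simp: smul_sum intro: ring_p_mult)
qed

lemma power_bound_exists:
  assumes "\<And>i. i \<in> I \<Longrightarrow> \<exists>m. P ^ m \<star> x i \<in> X" "finite I" "submod X"
  shows "\<exists>m. \<forall>i\<in>I. P ^ m \<star> x i \<in> X"
proof -
  obtain f where f: "i \<in> I \<Longrightarrow> P ^ f i \<star> x i \<in> X" for i using assms(1) by metis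
  have "P ^ (\<Sum>i\<in>I. f i) \<star> x i \<in> X" if "i \<in> I" for i
  proof -
    have "(\<Sum>i\<in>I. f i) = (\<Sum>i\<in>I - {i}. f i) + f i" using that assms(2) by (subst sum.remove[of _ i]) auto
    then have "P ^ (\<Sum>i\<in>I. f i) \<star> x i = P ^ (\<Sum>i\<in>I - {i}. f i) \<star> P ^ f i \<star> x i" by (simp add: power_add)
    then show ?thesis using submodD(3)[OF assms(3) ring_p_power[OF ring_p_of_nat] f[OF that]] by simp
  qed
  then show ?thesis by blast
qed

lemma std_vec_expand: "x \<in> V \<Longrightarrow> x = (\<Sum>i\<le>n. x i \<star> std_vec i)"
  by (auto simp: fun_eq_iff sum_fun_apply std_vec_def vspace_def if_distrib sum.delta cong: if_cong)

lemma lattice_latspan: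
  assumes "basis b" shows "lattice (latspan b)"
proof -
  have V: "latspan b \<subseteq> V" using basis_V[OF assms] by (auto simp: latspan_def intro!: vspace_closed)
  have bl: "b i \<in> latspan b" if "i \<le> n" for i
    unfolding latspan_def using sum_delta_smul[of "{..n}" i 1 b] that
    by (intro CollectI exI[of _ "\<lambda>j. if j = i then 1 else 0"]) auto
  have absorb: "\<exists>m. P ^ m \<star> x \<in> latspan b" if xV: "x \<in> V" for x
  proof -
    obtain c where c: "x = (\<Sum>i\<le>n. c i \<star> b i)" using basis_span[OF assms xV] by blast
    have "\<exists>m. P ^ m \<star> c i \<star> b i \<in> latspan b" if "i \<in> {..n}" for i
    proof -
      have "P ^ nat (- val (c i)) * c i \<in> ring_p" by (cases "c i = 0") (simp_all add: ring_p_iff val_mult)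
      then have "(P ^ nat (- val (c i)) * c i) \<star> b i \<in> latspan b" using bl that submodD(3)[OF submod_latspan] by simp
      then show ?thesis by (metis smul_smul)
    qed
    then obtain m where "\<forall>i\<in>{..n}. P ^ m \<star> c i \<star> b i \<in> latspan b"
      using power_bound_exists[OF _ _ submod_latspan, of "{..n}" "\<lambda>i. c i \<star> b i" b] by blast
    then have "(\<Sum>i\<le>n. P ^ m \<star> c i \<star> b i) \<in> latspan b" by (intro submodD(5)[OF submod_latspan]) auto
    then show ?thesis unfolding c smul_sum by blast
  qed
  have "std_vec i \<in> V" if "i \<le> n" for i using that by (auto simp: std_vec_def vspace_def)
  then obtain k where k: "\<forall>i\<in>{..n}. P ^ k \<star> std_vec i \<in> latspan b"
    using power_bound_exists[OF _ _ submod_latspan, of "{..n}" std_vec b] absorb by auto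
  have "sc (P ^ k) L0 \<subseteq> latspan b"
  proof
    fix y assume "y \<in> sc (P ^ k) L0"
    then obtain x where x: "x \<in> V" "\<forall>i. x i \<in> ring_p" "y = P ^ k \<star> x" by (auto simp: sc_def L0_def)
    have "y = (\<Sum>i\<le>n. x i \<star> P ^ k \<star> std_vec i)"
      unfolding x(3) by (subst std_vec_expand[OF x(1)]) (simp add: smul_sum mult.commute)
    also have "\<dots> \<in> latspan b" using k x(2)
      by (intro submodD(5)[OF submod_latspan], intro submodD(3)[OF submod_latspan, of "x i" for i]) auto
    finally show "y \<in> latspan b" .
  qed
  moreover obtain l where l: "\<forall>i\<in>{..n}. P ^ l \<star> b i \<in> L0"
    using power_bound_exists[OF _ _ submod_L0, of "{..n}" b] L0_absorb basis_V[OF assms] by auto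
  have "sc (P ^ l) (latspan b) \<subseteq> L0"
  proof
    fix y assume "y \<in> sc (P ^ l) (latspan b)"
    then obtain c where c: "y = P ^ l \<star> (\<Sum>i\<le>n. c i \<star> b i)" "\<forall>i\<le>n. c i \<in> ring_p"
      by (auto simp: sc_def latspan_def)
    have "y = (\<Sum>i\<le>n. c i \<star> P ^ l \<star> b i)" by (simp add: c(1) smul_sum mult.commute)
    also have "\<dots> \<in> L0" using l c(2)
      by (intro submodD(5)[OF submod_L0], intro submodD(3)[OF submod_L0, of "c i" for i]) auto
    finally show "y \<in> L0" .
  qed
  ultimately show ?thesis using lattice_sandwich[OF submod_latspan V lattice_L0] by blast
qed

lemma std_0: "std F 0 = latspan (\<lambda>i. F (int i))"
proof -
  have "c = 0 \<or> 0 \<le> int i + N * val c \<longleftrightarrow> c \<in> ring_p" if "i \<le> n" for c i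
  proof -
    have "0 \<le> int i + N * v \<longleftrightarrow> 0 \<le> v" for v
    proof
      assume "0 \<le> int i + N * v"
      show "0 \<le> v"
      proof (rule ccontr)
        assume "\<not> 0 \<le> v"
        then have "N * v \<le> N * (- 1)" by (intro mult_left_mono) auto
        then show False using \<open>0 \<le> int i + N * v\<close> that by simp
      qed
    qed simp
    then show ?thesis by (simp add: ring_p_iff)
  qed
  then show ?thesis unfolding std_def latspan_def by (metis (no_types, lifting))
qed

lemma lattice_std: assumes "pframe F" shows "lattice (std F k)"
proof (rule lattice_sandwich[OF submod_std std_subset_V[OF assms]])
  show "lattice (std F 0)" unfolding std_0 using pframe_basis[OF assms] by (rule lattice_latspan)
  define t where "t = nat \<bar>k\<bar>"
  have p: "std F (l + N * s) = sc (P powi s) (std F l)" for l s by (rule periodic_sc) (rule std_periodic)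
  have tn: "\<bar>k\<bar> \<le> N * int t" by (simp add: t_def algebra_simps)
  have "sc (P ^ t) (std F 0) = std F (N * int t)" "sc (P ^ t) (std F k) = std F (k + N * int t)"
    using p[of 0 "int t"] p[of k "int t"] by simp_all
  then show "sc (P ^ t) (std F 0) \<subseteq> std F k" "sc (P ^ t) (std F k) \<subseteq> std F 0"
    using std_antimono[of k "N * int t" F] std_antimono[of 0 "k + N * int t" F] tn by auto
qed

lemma pchain_std: assumes "pframe F" shows "pchain (Suc n) (std F)"
  unfolding pchain_def
proof (intro conjI allI)
  fix k
  have "F k \<in> std F k" "F k \<notin> std F (k + 1)" by (simp_all add: mem_std_iff[OF assms])
  then show "std F (k + 1) \<subset> std F k" using std_antimono[of k "k + 1" F] by auto
qed (use lattice_std[OF assms] std_periodic in auto)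

text \<open>In a chain with n + 1 steps per period, vectors picked from the steps have levels 0,
  ..., n over one period. These are distinct modulo n + 1, so the vectors form a basis and split
  every lattice of the chain.\<close>

lemma pchain_frame:
  assumes X: "pchain (Suc n) X" and F: "\<And>k. F k \<in> X k" "\<And>k. F k \<notin> X (k + 1)" "\<And>k. F (k + N) = P \<star> F k"
  shows "pframe F" "X k = std F k"
proof -
  note sub = lattice_submod[OF pchain_lattice[OF X]]
  have V: "F k \<in> V" for k using F(1) lattice_V[OF pchain_lattice[OF X]] by blast
  have nz: "F k \<noteq> 0" for k using F(2)[of k] submodD(1)[OF sub] by auto
  have lev: "lev X (F k) = k" for k using lev_eqI[OF X F(1,2)] .
  have inj: "inj_on (\<lambda>i. lev X (F (int i)) mod int (Suc n)) {..n}"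
    by (auto simp: lev inj_on_def)
  have b: "basis (\<lambda>i. F (int i))" unfolding basis_def using V pchain_indep[OF X _ V nz inj] by simp
  then show "pframe F" unfolding pframe_def using F(3) by blast
  have c: "c = 0 \<or> k \<le> int i + N * val c \<longleftrightarrow> c \<star> F (int i) \<in> X k" for c i
  proof (cases "c = 0")
    case False
    then show ?thesis
      using lev_iff[OF X, of "c \<star> F (int i)"] lev_smul[OF X V nz False] vspace_closed(4)[OF V] nz
      by (simp add: lev smul_eq_0_iff)
  qed (use submodD(1)[OF sub] in simp)
  show "X k = std F k"
  proof (intro equalityI subsetI)
    fix x assume x: "x \<in> X k"
    then obtain d where d: "x = (\<Sum>i\<le>n. d i \<star> F (int i))"
      using basis_span[OF b] lattice_V[OF pchain_lattice[OF X]] by blast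
    then have "\<forall>i\<le>n. d i \<star> F (int i) \<in> X k" using pchain_split[OF X _ V nz inj] x by simp
    then show "x \<in> std F k" unfolding std_def c using d by blast
  next
    fix x assume "x \<in> std F k"
    then show "x \<in> X k" unfolding std_def c by (auto intro!: submodD(5)[OF sub])
  qed
qed

end

section \<open>Chambers and apartments\<close>

context plocal
begin

lemma splitD: "split b X \<Longrightarrow> (\<Sum>i\<le>n. c i \<star> b i) \<in> X \<Longrightarrow> i \<le> n \<Longrightarrow> c i \<star> b i \<in> X"
  by (simp add: split_def)

text \<open>The homothety class of a lattice; powers of p suffice, since units of the local ring
  leave a submodule unchanged.\<close>

definition cls :: "(nat \<Rightarrow> rat) set \<Rightarrow> (nat \<Rightarrow> rat) set set" where
  "cls X = range (\<lambda>m. sc (P powi m) X)"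

lemma cls_self [simp]: "X \<in> cls X"
  unfolding cls_def by (auto intro: range_eqI[of _ _ 0])

lemma sc_powi_mult: "sc (P powi a) (sc (P powi b) X) = sc (P powi (a + b)) X"
  by (simp add: power_int_add)

lemma cls_sc [simp]: "cls (sc (P powi m) X) = cls X"
proof -
  have "sc (P powi k) X = sc (P powi (k - m)) (sc (P powi m) X)" for k
    unfolding sc_powi_mult by simp
  then have "sc (P powi k) X \<in> cls (sc (P powi m) X)" for k unfolding cls_def by blast
  moreover have "sc (P powi k) (sc (P powi m) X) \<in> cls X" for k unfolding cls_def sc_powi_mult by blast
  ultimately show ?thesis unfolding cls_def by blast
qed

lemma cls_eq: "Y \<in> cls X \<Longrightarrow> cls Y = cls X"
  by (auto simp: cls_def[of X])

lemma cls_eq_iff: "cls X = cls Y \<longleftrightarrow> (\<exists>m. Y = sc (P powi m) X)"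
proof
  assume "cls X = cls Y"
  then have "Y \<in> cls X" by simp
  then show "\<exists>m. Y = sc (P powi m) X" unfolding cls_def by blast
qed auto

lemma lattice_cls: "lattice X \<Longrightarrow> Y \<in> cls X \<Longrightarrow> lattice Y"
  unfolding cls_def using lattice_sc by blast

section \<open>Simplices and their periodic chains\<close>

definition simplex :: "(nat \<Rightarrow> rat) set set set \<Rightarrow> bool" where
  "simplex A \<longleftrightarrow> finite A \<and> A \<noteq> {} \<and> A \<subseteq> cls ` Collect lattice \<and> (\<forall>X\<in>\<Union>A. \<forall>Y\<in>\<Union>A. X \<subseteq> Y \<or> Y \<subseteq> X)"

lemma simplex_mem:
  assumes "simplex A" "X \<in> \<Union>A"
  shows "lattice X" "cls X \<in> A" "sc (P powi m) X \<in> \<Union>A"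
proof -
  obtain v where v: "v \<in> A" "X \<in> v" using assms(2) by blast
  then obtain Y where Y: "lattice Y" "v = cls Y" using assms(1) unfolding simplex_def by blast
  show "lattice X" using lattice_cls Y v by blast
  have "cls X = v" using cls_eq v Y by blast
  then show "cls X \<in> A" using v by simp
  moreover have "sc (P powi m) X \<in> cls X" unfolding cls_def by blast
  ultimately show "sc (P powi m) X \<in> \<Union>A" by blast
qed

lemma simplex_nonempty_class:
  assumes "simplex A" "v \<in> A"
  obtains X where "X \<in> v" "lattice X" "v = cls X"
proof -
  have "v \<in> cls ` Collect lattice" using assms unfolding simplex_def by blast
  then obtain X where "lattice X" "v = cls X" by blast
  then show ?thesis using that cls_self by blast
qed

lemma simplex_subset: "simplex A \<Longrightarrow> B \<subseteq> A \<Longrightarrow> B \<noteq> {} \<Longrightarrow> simplex B"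
proof -
  assume A: "simplex A" and B: "B \<subseteq> A" "B \<noteq> {}"
  then have "\<Union>B \<subseteq> \<Union>A" "finite B" using finite_subset unfolding simplex_def by blast+
  then show ?thesis using A B unfolding simplex_def by (meson subset_iff subset_trans)
qed

lemma lattice_nonzero: assumes "lattice X" shows "\<exists>x\<in>X. x \<noteq> 0"
proof -
  have "std_vec 0 \<in> V" by (auto simp: std_vec_def vspace_def)
  then obtain m where "P ^ m \<star> std_vec 0 \<in> X" using lattice_absorb[OF assms] by blast
  moreover have "P ^ m \<star> std_vec 0 \<noteq> 0" by (auto simp: smul_eq_0_iff std_vec_def fun_eq_iff)
  ultimately show ?thesis by blast
qed

lemma lattice_unbounded: assumes "lattice X" "lattice Y" shows "\<exists>m. \<not> sc (P powi (- int m)) Y \<subseteq> X"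
proof -
  obtain y where y: "y \<in> Y" "y \<noteq> 0" using lattice_nonzero[OF assms(2)] by blast
  obtain m where "P powi (- int m) \<star> y \<notin> X" using lattice_bounded[OF assms(1) y(2)] by blast
  then show ?thesis using y(1) unfolding sc_def by blast
qed

lemma sc_powi_antimono: assumes "submod X" "k \<le> m" shows "sc (P powi m) X \<subseteq> sc (P powi k) X"
proof -
  have "sc (P powi m) X = sc (P powi k) (sc (P powi (m - k)) X)" unfolding sc_powi_mult by simp
  also have "P powi (m - k) = P ^ nat (m - k)" using assms(2) by (simp add: power_int_def)
  also have "sc (P powi k) (sc (P ^ nat (m - k)) X) \<subseteq> sc (P powi k) X"
    by (rule sc_mono) (rule sc_P_power_le[OF assms(1)])
  finally show ?thesis .
qed

lemma pchain_range_cls: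
  assumes "pchain r X"
  shows "(\<Union>k<r. cls (X (int k))) = range X"
proof -
  have r: "r > 0" using assms by (simp add: pchain_def)
  have "X k \<in> cls (X (int (nat (k mod int r))))" for k
    using pchain_periodic[OF assms, of "k mod int r" "k div int r"] r by (simp add: cls_def)
  moreover have "nat (k mod int r) < r" for k using r by (simp add: nat_less_iff)
  ultimately have "range X \<subseteq> (\<Union>k<r. cls (X (int k)))" by blast
  moreover have "cls (X k) \<subseteq> range X" for k
    unfolding cls_def pchain_periodic[OF assms, symmetric] by blast
  ultimately show ?thesis by blast
qed

lemma pchain_simplex:
  assumes "pchain r X"
  shows "simplex ((\<lambda>k. cls (X (int k))) ` {..<r})"
proof -
  have "r > 0" using assms by (simp add: pchain_def)
  moreover have "X k \<subseteq> X l \<or> X l \<subseteq> X k" for k l using pchain_antimono[OF assms] by (meson linear)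
  moreover have "\<Union>((\<lambda>k. cls (X (int k))) ` {..<r}) = range X" using pchain_range_cls[OF assms] by simp
  ultimately show ?thesis unfolding simplex_def using pchain_lattice[OF assms] by auto
qed

lemma int_step:
  assumes "Q b" "\<not> Q a" "a \<le> (b :: int)"
  shows "\<exists>m. Q m \<and> \<not> Q (m - 1)"
  using assms(3,1)
proof (induction b rule: int_ge_induct)
  case (step b)
  show ?case
  proof (cases "Q b")
    case True
    then show ?thesis using step by blast
  next
    case False
    then have "Q (b + 1) \<and> \<not> Q (b + 1 - 1)" using step by simp
    then show ?thesis by blast
  qed
qed (use assms(2) in simp)

text \<open>The representatives of a class in a simplex are comparable with X0. The largest one
  contained in X0 is not contained in p X0, and it is the only one in this window.\<close>

lemma simplex_window:
  assumes A: "simplex A" and X0: "X0 \<in> \<Union>A"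
  shows "bij_betw cls {X \<in> \<Union>A. sc P X0 \<subset> X \<and> X \<subseteq> X0} A"
proof -
  let ?W = "{X \<in> \<Union>A. sc P X0 \<subset> X \<and> X \<subseteq> X0}"
  have "\<not> m \<ge> 1" if "X \<in> ?W" "sc (P powi m) X \<in> ?W" for X m
  proof
    assume "m \<ge> 1"
    then have "sc (P powi m) X \<subseteq> sc (P powi 1) X"
      using sc_powi_antimono lattice_submod simplex_mem(1)[OF A] that(1) by blast
    also have "\<dots> \<subseteq> sc P X0" using that(1) by (simp add: sc_mono)
    finally show False using that(2) by blast
  qed
  note no = this
  have "inj_on cls ?W"
  proof (rule inj_onI)
    fix X Y assume XY: "X \<in> ?W" "Y \<in> ?W" "cls X = cls Y"
    then obtain m where m: "Y = sc (P powi m) X" unfolding cls_eq_iff by blast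
    have "X = sc (P powi (- m)) Y" unfolding m sc_powi_mult by simp
    have w1: "sc (P powi m) X \<in> ?W" unfolding m[symmetric] by (rule XY(2))
    have w2: "sc (P powi (- m)) Y \<in> ?W" unfolding \<open>X = sc (P powi (- m)) Y\<close>[symmetric] by (rule XY(1))
    have "\<not> m \<ge> 1" "\<not> - m \<ge> 1" using no[OF XY(1) w1] no[OF XY(2) w2] by simp_all
    then have "m = 0" by simp
    then show "X = Y" using m by simp
  qed
  moreover have "v \<in> cls ` ?W" if vA: "v \<in> A" for v
  proof -
    obtain Y where Y: "Y \<in> v" "lattice Y" "v = cls Y" using simplex_nonempty_class[OF A vA] .
    have lX0: "lattice X0" using simplex_mem(1)[OF A X0] .
    obtain b where "sc (P ^ b) Y \<subseteq> X0" using lattice_commensurable[OF Y(2) lX0] by blast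
    then have b: "sc (P powi (int b)) Y \<subseteq> X0" by simp
    obtain a where a: "\<not> sc (P powi (- int a)) Y \<subseteq> X0" using lattice_unbounded[OF lX0 Y(2)] by blast
    obtain m where m: "sc (P powi m) Y \<subseteq> X0" "\<not> sc (P powi (m - 1)) Y \<subseteq> X0"
      using int_step[of "\<lambda>m. sc (P powi m) Y \<subseteq> X0" "int b" "- int a"] a b by auto
    have U: "sc (P powi k) Y \<in> \<Union>A" for k using simplex_mem(3)[OF A] Y(1) vA by blast
    have "X0 \<subset> sc (P powi (m - 1)) Y" using m(2) U[of "m - 1"] X0 A unfolding simplex_def by blast
    then have "sc P X0 \<subset> sc P (sc (P powi (m - 1)) Y)" by (simp only: sc_psubset_iff[OF P_neq_0])
    also have "sc P (sc (P powi (m - 1)) Y) = sc (P powi m) Y"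
      using sc_powi_mult[of 1 "m - 1" Y] by simp
    finally have "sc (P powi m) Y \<in> ?W" using m(1) U by blast
    moreover have "v = cls (sc (P powi m) Y)" using Y(3) by simp
    ultimately show ?thesis by blast
  qed
  moreover have "cls ` ?W \<subseteq> A" using simplex_mem(2)[OF A] by blast
  ultimately show ?thesis unfolding bij_betw_def by blast
qed

text \<open>The window below a fixed representative is a finite chain. Listed in decreasing order,
  by the number g of members strictly above, and repeated with powers of p it gives the periodic
  chain.\<close>

lemma simplex_pchain:
  assumes A: "simplex A"
  shows "\<exists>X. pchain (card A) X \<and> range X = \<Union>A"
proof -
  define r where "r = card A"
  have r: "r > 0" using A unfolding simplex_def r_def by (simp add: card_gt_0_iff)
  obtain v where "v \<in> A" using A unfolding simplex_def by blast
  then obtain X0 where X0: "X0 \<in> \<Union>A" using simplex_nonempty_class[OF A] by blast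
  define W where "W = {X \<in> \<Union>A. sc P X0 \<subset> X \<and> X \<subseteq> X0}"
  have bij: "bij_betw cls W A" unfolding W_def using simplex_window[OF A X0] .
  have finW: "finite W" and cardW: "card W = r"
    using bij_betw_finite[OF bij] bij_betw_same_card[OF bij] A by (simp_all add: simplex_def r_def)
  define g where "g = (\<lambda>Z. card {Y \<in> W. Z \<subset> Y})"
  have cmp: "X \<subseteq> Y \<or> Y \<subseteq> X" if "X \<in> W" "Y \<in> W" for X Y
    using that A unfolding W_def simplex_def by blast
  have gmono: "g Z' < g Z" if "Z \<subset> Z'" "Z' \<in> W" for Z Z'
    unfolding g_def using that finW by (intro psubset_card_mono) auto
  have ginj: "inj_on g W"
  proof (rule inj_onI)
    fix X Y assume XY: "X \<in> W" "Y \<in> W" "g X = g Y"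
    then have "\<not> X \<subset> Y" "\<not> Y \<subset> X" using gmono by (metis less_irrefl)+
    then show "X = Y" using cmp[OF XY(1,2)] by blast
  qed
  have glt: "g Z < r" if "Z \<in> W" for Z
    unfolding g_def cardW[symmetric] using that finW by (intro psubset_card_mono) auto
  have gim: "g ` W = {..<r}"
    by (rule card_subset_eq) (use glt cardW card_image[OF ginj] in auto)
  define w where "w = inv_into W g"
  have wW: "w i \<in> W" and gw: "g (w i) = i" if "i < r" for i
    unfolding w_def using that gim by (auto intro: inv_into_into f_inv_into_f)
  have wlt: "w j \<subset> w i" if "i < j" "j < r" for i j
  proof -
    have "i < r" using that by simp
    have "\<not> w i \<subset> w j" using gmono[of "w i" "w j"] wW gw that \<open>i < r\<close> by fastforce
    moreover have "w i \<noteq> w j" using gw that \<open>i < r\<close> by (metis nat_neq_iff)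
    ultimately show ?thesis using cmp[OF wW wW, of i j] that \<open>i < r\<close> by blast
  qed
  define X where "X = (\<lambda>k. sc (P powi (k div int r)) (w (nat (k mod int r))))"
  have XU: "X k \<in> \<Union>A" for k
  proof -
    have "nat (k mod int r) < r" using r by (simp add: nat_less_iff)
    then show ?thesis unfolding X_def using simplex_mem(3)[OF A] wW unfolding W_def by blast
  qed
  have Xval: "X (int r * q + int i) = sc (P powi q) (w i)" if "i < r" for q i
    using that by (simp add: X_def)
  have "pchain r X"
    unfolding pchain_def
  proof (intro conjI allI)
    fix k
    define q i where "q = k div int r" and "i = nat (k mod int r)"
    have i: "i < r" using r by (simp add: i_def nat_less_iff)
    have k: "k = int r * q + int i" using r by (simp add: q_def i_def)
    show "lattice (X k)" using XU simplex_mem(1)[OF A] by blast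
    have "k + int r = int r * (q + 1) + int i" using k by (simp add: algebra_simps)
    then have "X (k + int r) = sc (P powi (1 + q)) (w i)" using Xval[OF i] by (simp add: add.commute)
    also have "\<dots> = sc P (sc (P powi q) (w i))" unfolding sc_powi_mult[symmetric] by simp
    finally show "X (k + int r) = sc P (X k)" using k Xval[OF i] by simp
    show "X (k + 1) \<subset> X k"
    proof (cases "Suc i < r")
      case True
      have "k + 1 = int r * q + int (Suc i)" using k by simp
      then have "X (k + 1) = sc (P powi q) (w (Suc i))" by (simp only: Xval[OF True])
      then show ?thesis using wlt[of i "Suc i"] True k Xval[OF i] by (simp add: sc_psubset_iff)
    next
      case False
      \<comment> \<open>At the end of a period the next lattice is a multiple of p (w 0), which lies
        in the corresponding multiple of p X0 and so strictly below every member of the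
        window.\<close>
      then have "Suc i = r" using i by simp
      then have "k + 1 = int r * (q + 1) + int 0" using k by (simp add: algebra_simps)
      then have "X (k + 1) = sc (P powi (q + 1)) (w 0)" using Xval[OF r] by metis
      also have "\<dots> = sc (P powi q) (sc P (w 0))" using sc_powi_mult[of q 1] by simp
      also have "\<dots> \<subseteq> sc (P powi q) (sc P X0)" using wW[OF r] by (intro sc_mono) (auto simp: W_def)
      also have "\<dots> \<subset> sc (P powi q) (w i)" using wW[OF i] by (simp add: sc_psubset_iff W_def del: sc_sc)
      finally show ?thesis using k Xval[OF i] by simp
    qed
  qed (rule r)
  moreover have "range X = \<Union>A"
  proof (intro equalityI subsetI)
    fix Y assume Y: "Y \<in> \<Union>A"
    then have "cls Y \<in> A" using simplex_mem(2)[OF A] by blast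
    then obtain Z where Z: "Z \<in> W" "cls Z = cls Y" using bij unfolding bij_betw_def by (metis imageE)
    then obtain m where m: "Y = sc (P powi m) Z" unfolding cls_eq_iff by blast
    have "Z = w (g Z)" unfolding w_def using ginj Z(1) by simp
    then have "Y = X (int r * m + int (g Z))" using Xval[OF glt[OF Z(1)]] m by simp
    then show "Y \<in> range X" by blast
  qed (use XU in blast)
  ultimately show ?thesis unfolding r_def by blast
qed

lemma simplex_eq_pchain:
  assumes A: "simplex A" and X: "pchain r X" "range X = \<Union>A"
  shows "A = (\<lambda>k. cls (X (int k))) ` {..<r}"
proof (intro equalityI subsetI)
  fix v assume v: "v \<in> A"
  obtain Y where Y: "Y \<in> v" "lattice Y" "v = cls Y" by (rule simplex_nonempty_class[OF A v])
  have "Y \<in> \<Union>A" using v Y(1) by (rule UnionI)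
  then have "Y \<in> (\<Union>k<r. cls (X (int k)))" unfolding X(2)[symmetric] pchain_range_cls[OF X(1)] .
  then obtain k where k: "k < r" "Y \<in> cls (X (int k))" by blast
  then have "v = cls (X (int k))" using Y(3) cls_eq by simp
  then show "v \<in> (\<lambda>k. cls (X (int k))) ` {..<r}" using k(1) by simp
next
  fix v assume "v \<in> (\<lambda>k. cls (X (int k))) ` {..<r}"
  then obtain k where k: "v = cls (X (int k))" by blast
  have "X (int k) \<in> \<Union>A" unfolding X(2)[symmetric] by simp
  then show "v \<in> A" unfolding k by (rule simplex_mem(2)[OF A])
qed

definition ch :: "(int \<Rightarrow> nat \<Rightarrow> rat) \<Rightarrow> (nat \<Rightarrow> rat) set set set" where
  "ch F = (\<lambda>k. cls (std F (int k))) ` {..n}"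

lemma simplex_ch: "pframe F \<Longrightarrow> simplex (ch F)"
  using pchain_simplex[OF pchain_std] by (simp add: ch_def lessThan_Suc_atMost)

lemma Union_ch: "pframe F \<Longrightarrow> \<Union>(ch F) = range (std F)"
  using pchain_range_cls[OF pchain_std] by (simp add: ch_def lessThan_Suc_atMost)

text \<open>Vectors taken from the r steps of one period have distinct levels modulo r and are
  therefore independent. This bounds the dimension of the complex.\<close>

lemma pchain_length:
  assumes X: "pchain r X" shows "r \<le> Suc n"
proof -
  have "\<exists>x. x \<in> X k \<and> x \<notin> X (k + 1)" for k using X unfolding pchain_def by blast
  then obtain x where x: "\<And>k. x k \<in> X k" "\<And>k. x k \<notin> X (k + 1)" by metis
  have V: "x k \<in> V" for k using x(1) lattice_V[OF pchain_lattice[OF X]] by blast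
  have nz: "x k \<noteq> 0" for k using x(2)[of k] submodD(1)[OF lattice_submod[OF pchain_lattice[OF X]]] by auto
  have "inj_on (\<lambda>i. lev X (x (int i)) mod int r) {..<r}"
    by (auto simp: lev_eqI[OF X x(1,2)] inj_on_def)
  then have "indep {..<r} (\<lambda>i. x (int i))" using pchain_indep[OF X _ V nz] by blast
  then show ?thesis using indep_card_le[of "{..<r}" "\<lambda>i. x (int i)" n] V by simp
qed

lemma simplex_card: "simplex A \<Longrightarrow> card A \<le> Suc n"
  using simplex_pchain pchain_length by blast

section \<open>Extension of simplices to chambers\<close>

definition add_line :: "(nat \<Rightarrow> rat) set \<Rightarrow> (nat \<Rightarrow> rat) \<Rightarrow> (nat \<Rightarrow> rat) set" where
  "add_line X x = {y + c \<star> x | y c. y \<in> X \<and> c \<in> ring_p}"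

lemma add_line_mem: "y \<in> X \<Longrightarrow> c \<in> ring_p \<Longrightarrow> y + c \<star> x \<in> add_line X x"
  unfolding add_line_def by blast

lemma lattice_add_line:
  assumes X: "lattice X" and x: "P \<star> x \<in> X"
  shows "lattice (add_line X x)" "X \<subseteq> add_line X x" "x \<in> add_line X x"
proof -
  note sub = lattice_submod[OF X]
  show 1: "X \<subseteq> add_line X x" using add_line_mem[of _ X 0 x] by auto
  show "x \<in> add_line X x" using add_line_mem[OF submodD(1)[OF sub], of 1 x] by simp
  have xV: "x \<in> V" using vspace_closed(4)[of "P \<star> x" n "1 / P"] lattice_V[OF X] x by auto
  have "submod (add_line X x)"
    unfolding submod_def
  proof (intro conjI ballI)
    show "0 \<in> add_line X x" using 1 submodD(1)[OF sub] by blast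
    fix u assume "u \<in> add_line X x"
    then obtain y c where u: "u = y + c \<star> x" "y \<in> X" "c \<in> ring_p" unfolding add_line_def by blast
    {
      fix v assume "v \<in> add_line X x"
      then obtain z d where v: "v = z + d \<star> x" "z \<in> X" "d \<in> ring_p" unfolding add_line_def by blast
      have "u + v = (y + z) + (c + d) \<star> x" by (simp add: u v smul_add_left algebra_simps)
      then show "u + v \<in> add_line X x"
        using add_line_mem[OF submodD(2)[OF sub u(2) v(2)] ring_p_add[OF u(3) v(3)]] by simp
    }
    fix d assume d: "d \<in> ring_p"
    have "d \<star> u = d \<star> y + (d * c) \<star> x" by (simp add: u smul_add_right)
    then show "d \<star> u \<in> add_line X x"
      using add_line_mem[OF submodD(3)[OF sub d u(2)] ring_p_mult[OF d u(3)]] by simp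
  qed
  moreover have "add_line X x \<subseteq> V"
    unfolding add_line_def using lattice_V[OF X] xV by (auto intro!: vspace_closed)
  moreover have "sc (P ^ 0) X \<subseteq> add_line X x" using 1 by simp
  moreover have "sc (P ^ 1) (add_line X x) \<subseteq> X"
  proof
    fix u assume "u \<in> sc (P ^ 1) (add_line X x)"
    then obtain y c where u: "u = P \<star> (y + c \<star> x)" "y \<in> X" "c \<in> ring_p" unfolding add_line_def sc_def by auto
    have "u = P \<star> y + c \<star> (P \<star> x)" by (simp add: u(1) smul_add_right mult.commute)
    moreover have "P \<star> y \<in> X" "c \<star> (P \<star> x) \<in> X"
      using submodD(3)[OF sub ring_p_of_nat u(2)] submodD(3)[OF sub u(3) x] by blast+
    ultimately show "u \<in> X" using submodD(2)[OF sub] by simp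
  qed
  ultimately show "lattice (add_line X x)" using lattice_sandwich[OF _ _ X] by blast
qed

text \<open>Z lies in one step of the chain and its multiples lie in the steps shifted by periods,
  so everything stays comparable; strictness on both sides keeps the class of Z out of B.\<close>

lemma simplex_insert_between:
  assumes B: "simplex B" and X: "pchain r X" "range X = \<Union>B"
    and Z: "lattice Z" "X (k + 1) \<subset> Z" "Z \<subset> X k"
  shows "simplex (insert (cls Z) B)" "cls Z \<notin> B"
proof -
  show "cls Z \<notin> B"
  proof
    assume "cls Z \<in> B"
    then have "Z \<in> range X" using X(2) cls_self by blast
    then obtain j where "Z = X j" by blast
    then have "k + 1 > j" "j > k" using Z pchain_subset_iff[OF X(1)] by (metis linorder_not_le psubset_eq subset_antisym psubsetE)+
    then show False by simp
  qed
  have Zm: "X (k + 1 + int r * m) \<subseteq> sc (P powi m) Z" "sc (P powi m) Z \<subseteq> X (k + int r * m)" for m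
    unfolding pchain_periodic[OF X(1)] using Z by (auto intro!: sc_mono)
  have c1: "sc (P powi m) Z \<subseteq> X j \<or> X j \<subseteq> sc (P powi m) Z" for m j
  proof (cases "j \<le> k + int r * m")
    case True
    then show ?thesis using Zm(2)[of m] pchain_antimono[OF X(1) True] by blast
  next
    case False
    then have "k + 1 + int r * m \<le> j" by simp
    then show ?thesis using Zm(1)[of m] pchain_antimono[OF X(1)] by blast
  qed
  have c2: "sc (P powi m) Z \<subseteq> sc (P powi m') Z \<or> sc (P powi m') Z \<subseteq> sc (P powi m) Z" for m m'
    using sc_powi_antimono[OF lattice_submod[OF Z(1)]] by (meson linear)
  have U: "\<Union>(insert (cls Z) B) = range (\<lambda>m. sc (P powi m) Z) \<union> range X" using X(2) by (auto simp: cls_def)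
  have c3: "X i \<subseteq> X j \<or> X j \<subseteq> X i" for i j using pchain_antimono[OF X(1)] by (meson linear)
  have "\<forall>X\<in>\<Union>(insert (cls Z) B). \<forall>Y\<in>\<Union>(insert (cls Z) B). X \<subseteq> Y \<or> Y \<subseteq> X"
    unfolding U using c1 c2 c3 by blast
  then show "simplex (insert (cls Z) B)" using B Z(1) unfolding simplex_def by blast
qed

text \<open>Takes the place of expanding a vector as a convergent series in the F k. A functional
  killing every F k takes on y a value that it also takes arbitrarily deep in the chain. This value
  is divisible by all powers of p, hence zero, and a functional vanishing on a lattice is
  zero.\<close>

lemma annihilator_zero:
  assumes X: "pchain r X" and F: "\<And>k. X k \<subseteq> add_line (X (k + 1)) (F k)"
    and \<phi>: "\<And>k. (\<Sum>i\<le>n. \<phi> i * F k i) = 0" and i: "i \<le> n"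
  shows "\<phi> i = 0"
proof -
  define ev where "ev = (\<lambda>y :: nat \<Rightarrow> rat. \<Sum>i\<le>n. \<phi> i * y i)"
  have ev_add: "ev (x + c \<star> y) = ev x + c * ev y" for x y c
    by (simp add: ev_def sum.distrib sum_distrib_left algebra_simps)
  have ev_smul: "ev (c \<star> y) = c * ev y" for y c
    by (simp add: ev_def sum_distrib_left algebra_simps)
  have step: "\<exists>y'\<in>X (k + 1). ev y' = ev y" if y: "y \<in> X k" for y k
  proof -
    obtain z c where z: "y = z + c \<star> F k" "z \<in> X (k + 1)" using F[of k] y unfolding add_line_def by blast
    then have "ev y = ev z" using \<phi>[of k] ev_add by (simp add: ev_def)
    then show ?thesis using z(2) by auto
  qed
  have deep: "\<exists>y'\<in>X (int m). ev y' = ev y" if "y \<in> X 0" for y m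
  proof (induction m)
    case (Suc m)
    then obtain y' where "y' \<in> X (int m)" "ev y' = ev y" by blast
    then show ?case using step[of y' "int m"] by (auto simp: add.commute)
  qed (use that in auto)
  obtain m where m: "sc (P ^ m) (X 0) \<subseteq> L0" using pchain_lattice[OF X, of 0] unfolding lattice_def by blast
  \<comment> \<open>Truncated to the first n + 1 coefficients the functional becomes a vector of
    \<open>V\<close>, so a power of p clears its denominators.\<close>
  have "(\<lambda>i. if i \<le> n then \<phi> i else 0) \<in> V" by (simp add: vspace_def)
  from L0_absorb[OF this] obtain b where "P ^ b \<star> (\<lambda>i. if i \<le> n then \<phi> i else 0) \<in> L0" by blast
  then have "(P ^ b \<star> (\<lambda>i. if i \<le> n then \<phi> i else 0)) i \<in> ring_p" for i unfolding L0_def by simp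
  note b0 = this
  have b: "P ^ b * \<phi> i \<in> ring_p" if "i \<le> n" for i
    using b0[of i] that by simp
  have bound: "P ^ (b + m) * ev y \<in> ring_p" if "y \<in> X 0" for y
  proof -
    have "P ^ m \<star> y \<in> L0" using m that unfolding sc_def by blast
    then have "P ^ m * y i \<in> ring_p" for i by (auto simp: L0_def)
    then have "(P ^ b * \<phi> i) * (P ^ m * y i) \<in> ring_p" if "i \<le> n" for i using ring_p_mult[OF b[OF that]] by blast
    then have "(\<Sum>i\<le>n. (P ^ b * \<phi> i) * (P ^ m * y i)) \<in> ring_p" by (intro ring_p_sum) simp
    moreover have "P ^ (b + m) * ev y = (\<Sum>i\<le>n. (P ^ b * \<phi> i) * (P ^ m * y i))"
      by (simp add: ev_def sum_distrib_left power_add algebra_simps)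
    ultimately show ?thesis by simp
  qed
  have zero: "ev y = 0" if y: "y \<in> X 0" for y
  proof (rule ccontr)
    assume nz: "ev y \<noteq> 0"
    have "val (ev y) \<ge> int t - int (b + m)" for t
    proof -
      obtain y' where y': "y' \<in> X (int (r * t))" "ev y' = ev y" using deep[OF y] by blast
      have "X (int (r * t)) = sc (P ^ t) (X 0)" using pchain_periodic[OF X, of 0 "int t"] by simp
      then obtain z where z: "z \<in> X 0" "y' = P ^ t \<star> z" using y'(1) unfolding sc_def by blast
      have e: "ev y = P ^ t * ev z" using z y' ev_smul by simp
      then have "ev z \<noteq> 0" using nz by auto
      then have "val (ev y) = int t + val (ev z)" "0 \<le> int (b + m) + val (ev z)"
        using e bound[OF z(1)] by (simp_all add: val_mult ring_p_iff)
      then show ?thesis by simp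
    qed
    from this[of "nat (val (ev y) + int (b + m) + 1)"] show False by linarith
  qed
  have "std_vec i \<in> V" using i by (auto simp: std_vec_def vspace_def)
  then obtain t where "P ^ t \<star> std_vec i \<in> X 0" using lattice_absorb[OF pchain_lattice[OF X]] by blast
  then have "P ^ t * ev (std_vec i) = 0" using zero ev_smul by metis
  moreover have "ev (std_vec i) = \<phi> i" using i by (simp add: ev_def std_vec_def if_distrib sum.delta cong: if_cong)
  ultimately show ?thesis by simp
qed

text \<open>
  A maximal simplex among those built from the lattices in \<open>\<X>\<close> yields a periodic chain all of
  whose quotients are one-dimensional; picking vectors of \<open>\<T>\<close> in the successive steps produces
  a frame. It is used for all lattices, and for the lattices split by a given frame.
\<close>

lemma extend_to_chamber:
  assumes lat: "\<And>X. X \<in> \<X> \<Longrightarrow> lattice X"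
    and T: "\<And>x m. x \<in> \<T> \<Longrightarrow> P powi m \<star> x \<in> \<T>"
    and sep: "\<And>X Y. X \<in> \<X> \<Longrightarrow> Y \<in> \<X> \<Longrightarrow> X \<subset> Y \<Longrightarrow> \<exists>x\<in>\<T>. x \<in> Y \<and> x \<notin> X"
    and sc: "\<And>X m. X \<in> \<X> \<Longrightarrow> sc (P powi m) X \<in> \<X>"
    and add: "\<And>X x. X \<in> \<X> \<Longrightarrow> x \<in> \<T> \<Longrightarrow> P \<star> x \<in> X \<Longrightarrow> add_line X x \<in> \<X>"
    and A: "simplex A" "\<Union>A \<subseteq> \<X>"
  shows "\<exists>F. pframe F \<and> range F \<subseteq> \<T> \<and> A \<subseteq> ch F"
proof -
  define Q where "Q = (\<lambda>B. simplex B \<and> A \<subseteq> B \<and> \<Union>B \<subseteq> \<X>)"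
  \<comment> \<open>A simplex of largest size exists because no simplex has more than n + 1
    vertices.\<close>
  have "\<exists>B. Q B \<and> (\<forall>C. Q C \<longrightarrow> card C \<le> card B)"
    by (rule ex_has_greatest_nat[of Q A card "Suc (Suc n)"]) (use A simplex_card in \<open>auto simp: Q_def less_Suc_eq_le le_Suc_eq\<close>)
  then obtain B where B: "simplex B" "A \<subseteq> B" "\<Union>B \<subseteq> \<X>" and max: "\<And>C. Q C \<Longrightarrow> card C \<le> card B"
    unfolding Q_def by blast
  define r where "r = card B"
  obtain X where X: "pchain r X" "range X = \<Union>B" using simplex_pchain[OF B(1)] unfolding r_def by blast
  have XX: "X k \<in> \<X>" for k using X(2) B(3) by blast
  have r: "r > 0" using X(1) by (simp add: pchain_def)
  have "\<exists>x. x \<in> \<T> \<and> x \<in> X k \<and> x \<notin> X (k + 1)" for k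
    using sep[OF XX XX, of "k + 1" k] X(1) unfolding pchain_def by blast
  then obtain x where x: "\<And>k. x k \<in> \<T>" "\<And>k. x k \<in> X k" "\<And>k. x k \<notin> X (k + 1)" by metis
  define F where "F = (\<lambda>k. P powi (k div int r) \<star> x (k mod int r))"
  have kk: "X (k + j) = sc (P powi (k div int r)) (X (k mod int r + j))" for k j
  proof -
    have "k + j = (k mod int r + j) + int r * (k div int r)" by (simp add: algebra_simps)
    then show ?thesis using pchain_periodic[OF X(1)] by metis
  qed
  have F: "F k \<in> \<T>" "F k \<in> X k" "F k \<notin> X (k + 1)" for k
    using T[OF x(1)] x(2)[of "k mod int r"] x(3)[of "k mod int r"] kk[of k 0] kk[of k 1]
    by (simp_all add: F_def)
  have Fper: "F (k + int r) = P \<star> F k" for k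
    using r by (simp add: F_def power_int_add mult.commute)
  \<comment> \<open>If the lower lattice and F k did not generate the upper one, the lattice they
    generate would fit strictly in between and enlarge the maximal simplex.\<close>
  have full: "X k \<subseteq> add_line (X (k + 1)) (F k)" for k
  proof (rule ccontr)
    assume nf: "\<not> X k \<subseteq> add_line (X (k + 1)) (F k)"
    define Z where "Z = add_line (X (k + 1)) (F k)"
    have PF: "P \<star> F k \<in> X (k + 1)"
      using F(2)[of "k + int r"] pchain_antimono[OF X(1), of "k + 1" "k + int r"] r unfolding Fper by auto
    note al = lattice_add_line[OF lat[OF XX] PF, folded Z_def]
    have "Z \<subseteq> X k"
    proof
      fix z assume "z \<in> Z"
      then obtain y c where z: "z = y + c \<star> F k" "y \<in> X (k + 1)" "c \<in> ring_p" unfolding Z_def add_line_def by blast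
      then have "y \<in> X k" using pchain_antimono[OF X(1), of k "k + 1"] by auto
      then show "z \<in> X k" unfolding z(1)
        using submodD(2,3)[OF lattice_submod[OF lat[OF XX]]] z(3) F(2) by blast
    qed
    then have Z: "X (k + 1) \<subset> Z" "Z \<subset> X k" using al F(3)[of k] nf unfolding Z_def by blast+
    have "Z \<in> \<X>" unfolding Z_def using add[OF XX F(1) PF] .
    then have "\<Union>(insert (cls Z) B) \<subseteq> \<X>" using B(3) sc by (auto simp: cls_def)
    then have "Q (insert (cls Z) B)" unfolding Q_def
      using simplex_insert_between(1)[OF B(1) X al(1) Z] B(2) by blast
    then have "card (insert (cls Z) B) \<le> card B" by (rule max)
    moreover have "finite B" using B(1) unfolding simplex_def by blast
    ultimately show False using simplex_insert_between(2)[OF B(1) X al(1) Z] by simp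
  qed
  \<comment> \<open>With fewer than n + 1 steps per period, some non-zero functional kills the F k
    of one period, hence all of them.\<close>
  have "\<not> r < Suc n"
  proof
    assume "r < Suc n"
    then obtain \<phi> i where \<phi>: "i \<le> n" "\<phi> i \<noteq> 0" "\<forall>j\<in>{..<r}. (\<Sum>i\<le>n. \<phi> i * F (int j) i) = 0"
      using annihilator_exists[of "{..<r}" n "\<lambda>j. F (int j)"] by auto
    have "(\<Sum>i\<le>n. \<phi> i * F k i) = 0" for k
    proof -
      have "nat (k mod int r) < r" using r by (simp add: nat_less_iff)
      then have "(\<Sum>i\<le>n. \<phi> i * F (k mod int r) i) = 0" using \<phi>(3) r by force
      moreover have "F k = P powi (k div int r) \<star> F (k mod int r)" using r by (simp add: F_def)
      moreover have "(\<Sum>i\<le>n. \<phi> i * (P powi (k div int r) \<star> F (k mod int r)) i)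
          = P powi (k div int r) * (\<Sum>i\<le>n. \<phi> i * F (k mod int r) i)"
        by (simp add: sum_distrib_left mult.left_commute)
      ultimately show ?thesis by simp
    qed
    from annihilator_zero[OF X(1) full this \<phi>(1)] show False using \<phi>(2) by simp
  qed
  then have rn: "r = Suc n" using pchain_length[OF X(1)] by simp
  note fr = pchain_frame[OF X(1)[unfolded rn] F(2,3) Fper[unfolded rn]]
  have "B = ch F"
    using simplex_eq_pchain[OF B(1) X] fr(2) unfolding ch_def rn lessThan_Suc_atMost by simp
  then show ?thesis using fr(1) F(1) B(2) by blast
qed

lemma simplex_in_chamber: assumes "simplex A" shows "\<exists>F. pframe F \<and> A \<subseteq> ch F"
proof -
  have "\<exists>F. pframe F \<and> range F \<subseteq> UNIV \<and> A \<subseteq> ch F"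
  proof (rule extend_to_chamber[of "Collect lattice"])
    show "\<Union>A \<subseteq> Collect lattice" using simplex_mem(1)[OF assms] by blast
  qed (use lattice_sc lattice_add_line(1) assms in auto)
  then show ?thesis by blast
qed

section \<open>Reindexing of frames and the simplices split by a frame\<close>

lemma lines_sum:
  assumes "bij_betw \<pi> {..n} {..n}"
  shows "(\<Sum>i\<le>n. c i \<star> d i \<star> b (\<pi> i))
    = (\<Sum>j\<le>n. (c (the_inv_into {..n} \<pi> j) * d (the_inv_into {..n} \<pi> j)) \<star> b j)"
  by (subst sum.reindex_bij_betw[OF assms, symmetric], rule sum.cong)
    (use assms in \<open>auto simp: the_inv_into_f_f bij_betw_def\<close>)

lemma basis_lines:
  assumes b: "basis b" and \<pi>: "bij_betw \<pi> {..n} {..n}" and d: "\<And>i. i \<le> n \<Longrightarrow> d i \<noteq> 0"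
  shows "basis (\<lambda>i. d i \<star> b (\<pi> i))" "split (\<lambda>i. d i \<star> b (\<pi> i)) X \<longleftrightarrow> split b X"
proof -
  let ?\<sigma> = "the_inv_into {..n} \<pi>"
  have \<pi>n: "\<pi> i \<le> n" if "i \<le> n" for i using \<pi> that by (auto simp: bij_betw_def)
  have \<sigma>: "?\<sigma> (\<pi> i) = i" if "i \<le> n" for i using \<pi> that by (auto simp: bij_betw_def the_inv_into_f_f)
  have \<pi>\<sigma>: "\<pi> (?\<sigma> i) = i" "?\<sigma> i \<le> n" if "i \<le> n" for i
    using \<pi> that f_the_inv_into_f[of \<pi> "{..n}" i] the_inv_into_into[of \<pi> "{..n}" i "{..n}"] by (auto simp: bij_betw_def)
  have ind: "indep {..n} b" using b by (simp add: basis_def)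
  show "basis (\<lambda>i. d i \<star> b (\<pi> i))"
    unfolding basis_def indep_def
  proof (intro conjI allI impI ballI)
    fix i assume "i \<le> n"
    then show "d i \<star> b (\<pi> i) \<in> V" using basis_V[OF b \<pi>n] by (intro vspace_closed)
  next
    fix c i assume z: "(\<Sum>i\<le>n. c i \<star> d i \<star> b (\<pi> i)) = 0" and i: "i \<in> {..n}"
    from z have "(\<Sum>j\<le>n. (c (?\<sigma> j) * d (?\<sigma> j)) \<star> b j) = 0" unfolding lines_sum[OF \<pi>] .
    from indepD[OF ind this, of "\<pi> i"] show "c i = 0" using i \<pi>n \<sigma> d by auto
  qed
  show "split (\<lambda>i. d i \<star> b (\<pi> i)) X \<longleftrightarrow> split b X"
  proof
    assume s: "split (\<lambda>i. d i \<star> b (\<pi> i)) X"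
    show "split b X" unfolding split_def
    proof (intro allI impI)
      fix c i assume c: "(\<Sum>i\<le>n. c i \<star> b i) \<in> X" and i: "i \<le> n"
      define e where "e = (\<lambda>i. c (\<pi> i) / d i)"
      have "(\<Sum>i\<le>n. e i \<star> d i \<star> b (\<pi> i)) = (\<Sum>i\<le>n. c i \<star> b i)"
        unfolding lines_sum[OF \<pi>] by (rule sum.cong) (use d \<pi>\<sigma> in \<open>auto simp: e_def\<close>)
      then have "e (?\<sigma> i) \<star> d (?\<sigma> i) \<star> b (\<pi> (?\<sigma> i)) \<in> X"
        using splitD[OF s _ \<pi>\<sigma>(2)[OF i], of e] c by simp
      then show "c i \<star> b i \<in> X" using \<pi>\<sigma>[OF i] d by (simp add: e_def)
    qed
  next
    assume s: "split b X"
    show "split (\<lambda>i. d i \<star> b (\<pi> i)) X" unfolding split_def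
    proof (intro allI impI)
      fix c i assume c: "(\<Sum>i\<le>n. c i \<star> d i \<star> b (\<pi> i)) \<in> X" and i: "i \<le> n"
      have "(c (?\<sigma> (\<pi> i)) * d (?\<sigma> (\<pi> i))) \<star> b (\<pi> i) \<in> X"
        using splitD[OF s c[unfolded lines_sum[OF \<pi>]] \<pi>n[OF i]] .
      then show "c i \<star> d i \<star> b (\<pi> i) \<in> X" using \<sigma>[OF i] by simp
    qed
  qed
qed

text \<open>If f i and f j agree modulo n + 1, then f i = f (j + (n + 1) t) for some t, and
  injectivity makes i and j congruent. The resulting permutation is the one by which f moves the
  lines of a frame.\<close>

lemma affine_residue_bij:
  assumes "affine n f"
  shows "bij_betw (\<lambda>i. nat (f (int i) mod N)) {..n} {..n}"
proof -
  have lt: "nat (k mod N) \<le> n" for k using pos_mod_bound[of N k] by linarith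
  have "inj_on (\<lambda>i. nat (f (int i) mod N)) {..n}"
  proof (rule inj_onI)
    fix i j assume ij: "i \<in> {..n}" "j \<in> {..n}" "nat (f (int i) mod N) = nat (f (int j) mod N)"
    have "f (int i) mod N = f (int j) mod N"
      using ij(3) pos_mod_sign[of N "f (int i)"] pos_mod_sign[of N "f (int j)"] by (simp add: eq_nat_nat_iff)
    then obtain t where "f (int i) = f (int j) + N * t"
      by (metis mod_eqE mult.commute)
    then have "f (int i) = f (int j + N * t)" using affine_mult[OF assms] by simp
    then have "int i = int j + N * t" using assms by (auto simp: affine_def dest: injD)
    then have "int i mod N = int j mod N" by simp
    then show "i = j" using ij by simp
  qed
  moreover have "(\<lambda>i. nat (f (int i) mod N)) ` {..n} \<subseteq> {..n}" using lt by auto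
  ultimately show ?thesis by (simp add: bij_betw_def endo_inj_surj)
qed

text \<open>Reindexing permutes the lines of a frame and rescales its vectors by powers of p, so
  bases and split lattices are preserved.\<close>

lemma pframe_affine:
  assumes F: "pframe F" and f: "affine n f"
  shows "pframe (\<lambda>k. F (f k))" "split (\<lambda>i. F (f (int i))) X \<longleftrightarrow> split (\<lambda>i. F (int i)) X"
proof -
  let ?\<pi> = "\<lambda>i. nat (f (int i) mod N)"
  have e: "(\<lambda>i. F (f (int i))) = (\<lambda>i. P powi (f (int i) div N) \<star> F (int (?\<pi> i)))"
  proof
    fix i
    have "F (f (int i)) = P powi (f (int i) div N) \<star> F (f (int i) mod N)"
      using pframe_periodic[OF F, of "f (int i) mod N" "f (int i) div N"] by simp
    then show "F (f (int i)) = P powi (f (int i) div N) \<star> F (int (?\<pi> i))"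
      using pos_mod_sign[of N "f (int i)"] by simp
  qed
  note L = basis_lines[OF pframe_basis[OF F] affine_residue_bij[OF f], of "\<lambda>i. P powi (f (int i) div N)"]
  show "split (\<lambda>i. F (f (int i))) X \<longleftrightarrow> split (\<lambda>i. F (int i)) X" unfolding e by (rule L(2)) simp
  have "basis (\<lambda>i. F (f (int i)))" unfolding e by (rule L(1)) simp
  moreover have "F (f (k + N)) = P \<star> F (f k)" for k
  proof -
    have "f (k + N) = f k + N" using f unfolding affine_def by blast
    then show ?thesis using F unfolding pframe_def by metis
  qed
  ultimately show "pframe (\<lambda>k. F (f k))" unfolding pframe_def by blast
qed

definition apt :: "(int \<Rightarrow> nat \<Rightarrow> rat) \<Rightarrow> (nat \<Rightarrow> rat) set set set set" where
  "apt E = {A. simplex A \<and> (\<forall>X\<in>\<Union>A. split (\<lambda>i. E (int i)) X)}"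

lemma ch_in_apt:
  assumes E: "pframe E" and f: "affine n f"
  shows "ch (\<lambda>k. E (f k)) \<in> apt E"
  unfolding apt_def
proof (intro CollectI conjI ballI)
  note Ef = pframe_affine(1)[OF E f]
  show "simplex (ch (\<lambda>k. E (f k)))" by (rule simplex_ch[OF Ef])
  fix X assume "X \<in> \<Union>(ch (\<lambda>k. E (f k)))"
  then obtain k where "X = std (\<lambda>k. E (f k)) k" unfolding Union_ch[OF Ef] by blast
  then show "split (\<lambda>i. E (int i)) X"
    using std_split[OF Ef, of k] pframe_affine(2)[OF E f] by simp
qed

lemma submod_powi_mem_iff:
  assumes "submod X" "c \<noteq> 0" shows "c \<star> x \<in> X \<longleftrightarrow> P powi val c \<star> x \<in> X"
proof -
  obtain u where u: "u \<in> unit_p" "c = P powi val c * u" using val_decomp[OF assms(2)] .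
  then have "c \<star> x = u \<star> P powi val c \<star> x" by (metis smul_smul mult.commute)
  then show ?thesis using submod_unit_smul[OF assms(1) u(1)] by metis
qed

lemma pframe_range: "pframe E \<Longrightarrow> i \<le> n \<Longrightarrow> P powi m \<star> E (int i) \<in> range E"
  using pframe_periodic[of E "int i" m] by (metis rangeI)

lemma split_sc: assumes "split b X" "c \<noteq> 0" shows "split b (sc c X)"
  unfolding split_def
proof (intro allI impI)
  fix d i assume d: "(\<Sum>i\<le>n. d i \<star> b i) \<in> sc c X" and i: "i \<le> n"
  have "(\<Sum>i\<le>n. (1 / c * d i) \<star> b i) \<in> X"
    using d assms(2) by (simp add: mem_sc_iff smul_sum)
  from splitD[OF assms(1) this i] have "(1 / c * d i) \<star> b i \<in> X" .
  then show "d i \<star> b i \<in> sc c X" using assms(2) by (simp add: mem_sc_iff)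
qed

text \<open>On each line of the frame, membership in a lattice depends only on the valuation of the
  coefficient, so the vectors E m suffice to tell a split lattice from another lattice.\<close>

lemma split_sep:
  assumes E: "pframe E" and XY: "lattice X" "lattice Y" "split (\<lambda>i. E (int i)) Y" "\<not> Y \<subseteq> X"
  shows "\<exists>m. E m \<in> Y \<and> E m \<notin> X"
proof -
  obtain y where y: "y \<in> Y" "y \<notin> X" using XY(4) by blast
  then obtain c where c: "y = (\<Sum>i\<le>n. c i \<star> E (int i))"
    using basis_span[OF pframe_basis[OF E]] lattice_V[OF XY(2)] by blast
  then obtain i where i: "i \<le> n" "c i \<star> E (int i) \<notin> X"
    using y(2) submodD(5)[OF lattice_submod[OF XY(1)], of "{..n}" "\<lambda>i. c i \<star> E (int i)"] by auto
  then have "c i \<noteq> 0" using submodD(1)[OF lattice_submod[OF XY(1)]] by auto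
  moreover have "c i \<star> E (int i) \<in> Y" using splitD[OF XY(3) y(1)[unfolded c] i(1)] .
  ultimately have "P powi val (c i) \<star> E (int i) \<in> Y" "P powi val (c i) \<star> E (int i) \<notin> X"
    using submod_powi_mem_iff lattice_submod XY(1,2) i(2) by blast+
  then show ?thesis using pframe_range[OF E i(1), of "val (c i)"] by force
qed

lemma split_add_line:
  assumes E: "pframe E" and X: "lattice X" "split (\<lambda>i. E (int i)) X"
  shows "split (\<lambda>i. E (int i)) (add_line X (E m))"
  unfolding split_def
proof (intro allI impI)
  obtain j where j: "j \<le> n" "E m = P powi (m div N) \<star> E (int j)" using pframe_residue[OF E, of m] by metis
  note sub = lattice_submod[OF X(1)]
  fix d i assume "(\<Sum>i\<le>n. d i \<star> E (int i)) \<in> add_line X (E m)" and i: "i \<le> n"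
  then obtain y c where y: "(\<Sum>i\<le>n. d i \<star> E (int i)) = y + c \<star> E m" "y \<in> X" "c \<in> ring_p"
    unfolding add_line_def by blast
  define e where "e = (\<lambda>i. if i = j then c * P powi (m div N) else 0)"
  have e: "c \<star> E m = (\<Sum>i\<le>n. e i \<star> E (int i))"
    using sum_delta_smul[of "{..n}" j "c * P powi (m div N)" "\<lambda>i. E (int i)"] j by (simp add: e_def)
  have "y = (\<Sum>i\<le>n. (d i - e i) \<star> E (int i))"
    using y(1) unfolding e by (simp add: smul_minus_left sum_subtractf)
  then have yi: "(d i - e i) \<star> E (int i) \<in> X" using splitD[OF X(2) _ i, of "\<lambda>i. d i - e i"] y(2) by simp
  have de: "d i \<star> E (int i) = (d i - e i) \<star> E (int i) + e i \<star> E (int i)" by (simp add: smul_minus_left)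
  have ei: "e i \<star> E (int i) = (if i = j then c else 0) \<star> E m" using j(2) by (simp add: e_def)
  show "d i \<star> E (int i) \<in> add_line X (E m)"
    unfolding de ei using yi y(3) by (intro add_line_mem) auto
qed

text \<open>Within the split lattices the extension to a chamber can be carried out with vectors E m
  alone. The frame obtained is thus a reindexing of E, and the reindexing map inherits injectivity
  and periodicity.\<close>

lemma apt_in_chamber:
  assumes E: "pframe E" and A: "A \<in> apt E"
  shows "\<exists>f. affine n f \<and> A \<subseteq> ch (\<lambda>k. E (f k))"
proof -
  let ?X = "{X. lattice X \<and> split (\<lambda>i. E (int i)) X}"
  have "\<exists>F. pframe F \<and> range F \<subseteq> range E \<and> A \<subseteq> ch F"
  proof (rule extend_to_chamber[of ?X])
    show "P powi m \<star> x \<in> range E" if "x \<in> range E" for x m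
      using that pframe_periodic[OF E, of _ m] by (metis (no_types, lifting) rangeE rangeI)
    show "\<exists>x\<in>range E. x \<in> Y \<and> x \<notin> X" if "X \<in> ?X" "Y \<in> ?X" "X \<subset> Y" for X Y
      using split_sep[OF E, of X Y] that by blast
    show "sc (P powi m) X \<in> ?X" if "X \<in> ?X" for X m using that lattice_sc split_sc by simp
    show "add_line X x \<in> ?X" if "X \<in> ?X" "x \<in> range E" "P \<star> x \<in> X" for X x
      using that split_add_line[OF E] lattice_add_line(1) by blast
    show "simplex A" using A by (simp add: apt_def)
    show "\<Union>A \<subseteq> ?X" using A simplex_mem(1)[of A] by (auto simp: apt_def)
  qed simp
  then obtain F where F: "pframe F" "range F \<subseteq> range E" "A \<subseteq> ch F" by blast
  have "\<forall>k. \<exists>m. F k = E m" using F(2) by blast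
  then obtain f where f: "\<And>k. F k = E (f k)" by metis
  have Einj: "a = b" if "E a = E b" for a b
    using mem_std_iff[OF E, of a b] mem_std_iff[OF E, of b a] mem_std_iff[OF E, of a a] mem_std_iff[OF E, of b b] that by simp
  have Finj: "a = b" if "F a = F b" for a b
    using mem_std_iff[OF F(1), of a b] mem_std_iff[OF F(1), of b a] mem_std_iff[OF F(1), of a a] mem_std_iff[OF F(1), of b b] that by simp
  have "inj f" by (rule injI) (metis Finj f)
  moreover have "f (k + N) = f k + N" for k
  proof (rule Einj)
    have "E (f (k + N)) = P \<star> E (f k)" using F(1) f unfolding pframe_def by metis
    also have "\<dots> = E (f k + N)" using E unfolding pframe_def by metis
    finally show "E (f (k + N)) = E (f k + N)" .
  qed
  ultimately have "affine n f" by (simp add: affine_def)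
  moreover have "F = (\<lambda>k. E (f k))" using f by blast
  ultimately show ?thesis using F(3) by blast
qed

text \<open>Modulo the next lattice only the coordinate belonging to F k survives, and it is a unit
  multiple of F k for both vectors; so each step is one-dimensional over the residue field.\<close>

lemma std_gr_dim_one:
  assumes F: "pframe F" and x: "x \<in> std F k" "x \<notin> std F (k + 1)" and y: "y \<in> std F k" "y \<notin> std F (k + 1)"
  shows "\<exists>c\<in>unit_p. x - c \<star> y \<in> std F (k + 1)"
proof -
  obtain i where i: "i \<le> n" "int i = k mod N" "F k = P powi (k div N) \<star> F (int i)" by (rule pframe_residue[OF F])
  have k: "k = int i + N * (k div N)" using i(2) by simp
  note sub = submod_std[of F "k + 1"]
  have dec: "\<exists>a\<in>unit_p. z - a \<star> F k \<in> std F (k + 1)" if z: "z \<in> std F k" "z \<notin> std F (k + 1)" for z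
  proof -
    obtain c where c: "z = (\<Sum>i\<le>n. c i \<star> F (int i))" "\<forall>j\<le>n. c j = 0 \<or> k \<le> int j + N * val (c j)"
      using z(1) unfolding std_def by blast
    have oth: "c j = 0 \<or> k + 1 \<le> int j + N * val (c j)" if "j \<le> n" "j \<noteq> i" for j
    proof -
      have "int j + N * val (c j) \<noteq> k"
      proof
        assume "int j + N * val (c j) = k"
        then have "k mod N = int j mod N" by (metis mod_mult_self2)
        then show False using i(2) that by simp
      qed
      then show ?thesis using c(2) that(1) by force
    qed
    define a where "a = c i / P powi (k div N)"
    have zz: "z - a \<star> F k = (\<Sum>j\<le>n. (if j = i then 0 else c j) \<star> F (int j))"
    proof -
      have "a \<star> F k = c i \<star> F (int i)" unfolding i(3) by (simp add: a_def)
      also have "\<dots> = (\<Sum>j\<le>n. (if j = i then c i else 0) \<star> F (int j))"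
        using sum_delta_smul[of "{..n}" i "c i" "\<lambda>j. F (int j)"] i(1) by simp
      finally have "z - a \<star> F k = (\<Sum>j\<le>n. c j \<star> F (int j) - (if j = i then c i else 0) \<star> F (int j))"
        unfolding c(1) by (simp add: sum_subtractf)
      also have "\<dots> = (\<Sum>j\<le>n. (if j = i then 0 else c j) \<star> F (int j))" by (rule sum.cong) auto
      finally show ?thesis .
    qed
    have mem: "z - a \<star> F k \<in> std F (k + 1)"
      unfolding std_def zz using oth by (intro CollectI exI[of _ "\<lambda>j. if j = i then 0 else c j"]) auto
    have "\<not> (c i = 0 \<or> k + 1 \<le> int i + N * val (c i))"
    proof
      assume "c i = 0 \<or> k + 1 \<le> int i + N * val (c i)"
      then have "z \<in> std F (k + 1)" unfolding std_def using c(1) oth by blast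
      then show False using z(2) by simp
    qed
    then have ci: "c i \<noteq> 0" "int i + N * val (c i) = k" using c(2) i(1) by (blast, metis add_le_cancel_left linorder_not_le nle_le zle_add1_eq_le)
    then have "N * val (c i) = N * (k div N)" using k by linarith
    then have "val (c i) = k div N" by simp
    moreover have "val a + k div N = val (c i)"
      using val_mult[of a "P powi (k div N)"] ci(1) by (simp add: a_def)
    ultimately have "a \<in> unit_p" using ci(1) by (simp add: unit_p_iff a_def)
    then show ?thesis using mem by blast
  qed
  obtain a b where a: "a \<in> unit_p" "x - a \<star> F k \<in> std F (k + 1)" and b: "b \<in> unit_p" "y - b \<star> F k \<in> std F (k + 1)"
    using dec x y by meson
  have u: "a * (1 / b) \<in> unit_p" using unit_p_mult unit_p_inverse a(1) b(1) by blast
  have "x - (a * (1 / b)) \<star> y = (x - a \<star> F k) - (a * (1 / b)) \<star> (y - b \<star> F k)"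
    using unit_pD(2)[OF b(1)] by (simp add: smul_minus_right)
  also have "\<dots> \<in> std F (k + 1)" by (rule submodD(4)[OF sub a(2) submodD(3)[OF sub unit_pD(1)[OF u] b(2)]])
  finally show ?thesis using u by blast
qed

text \<open>
  Choosing in each step of the first chain a vector lying as deep as possible in the second chain
  forces the levels with respect to the second chain to be distinct modulo the period.
\<close>

lemma common_frame:
  assumes F: "pframe F" and G: "pframe G"
  shows "\<exists>E. pframe E \<and> (\<forall>k. split (\<lambda>i. E (int i)) (std F k) \<and> split (\<lambda>i. E (int i)) (std G k))"
proof -
  note X = pchain_std[OF F] and Y = pchain_std[OF G]
  have "\<exists>x. (x \<in> std F k \<and> x \<notin> std F (k + 1)) \<and>
      (\<forall>y. y \<in> std F k \<and> y \<notin> std F (k + 1) \<longrightarrow> lev (std G) y \<le> lev (std G) x)" for k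
  proof -
    \<comment> \<open>A deep lattice of the second chain lies inside \<open>std F (k + 1)\<close>,
      so vectors outside the latter have bounded level and one of largest level exists.\<close>
    obtain m where "sc (P ^ m) (std G 0) \<subseteq> std F (k + 1)"
      using lattice_commensurable[OF lattice_std[OF G] lattice_std[OF F]] by blast
    then have m: "std G (N * int m) \<subseteq> std F (k + 1)" using pchain_periodic[OF Y, of 0 "int m"] by simp
    have lt: "lev (std G) y < N * int m" if "y \<in> std F k" "y \<notin> std F (k + 1)" for y
    proof -
      have "y \<in> V" "y \<noteq> 0" using that std_subset_V[OF F] submodD(1)[OF submod_std] by auto
      moreover have "y \<notin> std G (N * int m)" using m that(2) by blast
      ultimately show ?thesis using lev_iff[OF Y] by (metis linorder_not_le)
    qed
    have "F k \<in> std F k \<and> F k \<notin> std F (k + 1)" by (simp add: mem_std_iff[OF F])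
    from ex_has_least_nat[of "\<lambda>x. x \<in> std F k \<and> x \<notin> std F (k + 1)", OF this, of "\<lambda>x. nat (N * int m - lev (std G) x)"]
    obtain x where x: "x \<in> std F k \<and> x \<notin> std F (k + 1)"
      "\<And>y. y \<in> std F k \<and> y \<notin> std F (k + 1) \<Longrightarrow> nat (N * int m - lev (std G) x) \<le> nat (N * int m - lev (std G) y)"
      by blast
    have "lev (std G) y \<le> lev (std G) x" if "y \<in> std F k \<and> y \<notin> std F (k + 1)" for y
      using x(2)[OF that] lt[of y] lt[of x] x(1) that by linarith
    then show ?thesis using x(1) by blast
  qed
  then obtain x where x: "\<And>k. x k \<in> std F k" "\<And>k. x k \<notin> std F (k + 1)"
    "\<And>k y. y \<in> std F k \<Longrightarrow> y \<notin> std F (k + 1) \<Longrightarrow> lev (std G) y \<le> lev (std G) (x k)" by metis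
  define E where "E = (\<lambda>k. P powi (k div N) \<star> x (k mod N))"
  have kk: "std F (k + j) = sc (P powi (k div N)) (std F (k mod N + j))" for k j
  proof -
    have "k + j = (k mod N + j) + N * (k div N)" using mult_div_mod_eq[of N k] by linarith
    then show ?thesis using pchain_periodic[OF X] by metis
  qed
  have E: "E k \<in> std F k" "E k \<notin> std F (k + 1)" for k
    using x(1)[of "k mod N"] x(2)[of "k mod N"] kk[of k 0] kk[of k 1] by (simp_all add: E_def)
  have Eper: "E (k + N) = P \<star> E k" for k
  proof -
    have "(k + N) div N = k div N + 1" "(k + N) mod N = k mod N" by simp_all
    then show ?thesis unfolding E_def by (simp add: power_int_add mult.commute)
  qed
  note fr = pchain_frame[OF X E Eper]
  have V: "E k \<in> V" "E k \<noteq> 0" for k using pframe_V[OF fr(1)] by blast+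
  have max: "lev (std G) y \<le> lev (std G) (E k)" if y: "y \<in> std F k" "y \<notin> std F (k + 1)" for k y
  proof -
    define t where "t = k div N"
    define z where "z = P powi (- t) \<star> y"
    have yz: "y = P powi t \<star> z" by (simp add: z_def power_int_minus)
    have "z \<in> std F (k mod N)" "z \<notin> std F (k mod N + 1)"
      using y kk[of k 0] kk[of k 1] unfolding yz t_def[symmetric] by simp_all
    then have "lev (std G) z \<le> lev (std G) (x (k mod N))" by (rule x(3))
    moreover have "z \<in> V" "z \<noteq> 0" "x (k mod N) \<in> V" "x (k mod N) \<noteq> 0"
      using \<open>z \<in> std F (k mod N)\<close> \<open>z \<notin> std F (k mod N + 1)\<close> x(1,2)[of "k mod N"] std_subset_V[OF F]
        submodD(1)[OF submod_std] by auto
    ultimately show ?thesis using lev_smul[OF Y] unfolding yz E_def t_def[symmetric] by simp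
  qed
  \<comment> \<open>If the levels agreed for k < l, subtracting a unit multiple of E l from E k
    would give a vector in the same step of the first chain but deeper in the second, against the
    choice of E k.\<close>
  have key: "\<not> (lev (std G) (E k) = lev (std G) (E l) \<and> k < l)" for k l
  proof
    assume a: "lev (std G) (E k) = lev (std G) (E l) \<and> k < l"
    define q where "q = lev (std G) (E k)"
    have q: "E k \<in> std G q" "E k \<notin> std G (q + 1)" "E l \<in> std G q" "E l \<notin> std G (q + 1)"
      using lev_iff[OF Y V] a by (simp_all add: q_def)
    obtain c where c: "c \<in> unit_p" "E k - c \<star> E l \<in> std G (q + 1)"
      using std_gr_dim_one[OF G q] by blast
    define z where "z = E k - c \<star> E l"
    have El: "c \<star> E l \<in> std F (k + 1)"
      using E(1)[of l] std_antimono[of "k + 1" l F] a submodD(3)[OF submod_std unit_pD(1)[OF c(1)]] by auto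
    have zz: "z \<in> std F k" "z \<notin> std F (k + 1)"
    proof -
      show "z \<in> std F k" unfolding z_def using E(1) El std_antimono[of k "k + 1" F] by (intro submodD(4)[OF submod_std]) auto
      show "z \<notin> std F (k + 1)"
      proof
        assume "z \<in> std F (k + 1)"
        from submodD(2)[OF submod_std this El] show False using E(2) by (simp add: z_def)
      qed
    qed
    have "z \<in> V" "z \<noteq> 0" using zz std_subset_V[OF F] submodD(1)[OF submod_std] by auto
    then have "q + 1 \<le> lev (std G) z" using c(2) lev_iff[OF Y] by (simp add: z_def)
    then show False using max[OF zz] by (simp add: q_def)
  qed
  have inj: "inj_on (\<lambda>i. lev (std G) (E (int i)) mod N) {..n}"
  proof (rule inj_onI)
    fix i j assume ij: "i \<in> {..n}" "j \<in> {..n}" "lev (std G) (E (int i)) mod N = lev (std G) (E (int j)) mod N"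
    then obtain t where "lev (std G) (E (int i)) = lev (std G) (E (int j)) + N * t" by (metis mod_eqE mult.commute)
    moreover have "E (int j + N * t) = P powi t \<star> E (int j)" using pframe_periodic[OF fr(1)] .
    ultimately have "lev (std G) (E (int i)) = lev (std G) (E (int j + N * t))" using lev_smul[OF Y V, of "P powi t"] by simp
    then have "int i = int j + N * t" using key by (metis linorder_neqE)
    then have "int i mod N = int j mod N" by simp
    then show "i = j" using ij by simp
  qed
  have "split (\<lambda>i. E (int i)) (std G k)" for k
    unfolding split_def
    using pchain_split[OF Y, of "{..n}" "\<lambda>i. E (int i)"] V inj by auto
  moreover have "split (\<lambda>i. E (int i)) (std F k)" for k
    using std_split[OF fr(1)] fr(2) by simp
  ultimately show ?thesis using fr(1) by blast
qed

lemma common_apt: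
  assumes "simplex A" "simplex B"
  shows "\<exists>E. pframe E \<and> A \<in> apt E \<and> B \<in> apt E"
proof -
  obtain F G where F: "pframe F" "A \<subseteq> ch F" and G: "pframe G" "B \<subseteq> ch G" using simplex_in_chamber assms by metis
  obtain E where E: "pframe E" "\<And>k. split (\<lambda>i. E (int i)) (std F k)" "\<And>k. split (\<lambda>i. E (int i)) (std G k)"
    using common_frame[OF F(1) G(1)] by blast
  have "\<Union>A \<subseteq> range (std F)" "\<Union>B \<subseteq> range (std G)"
    using Union_mono[OF F(2)] Union_mono[OF G(2)] Union_ch F(1) G(1) by simp_all
  then have "A \<in> apt E" "B \<in> apt E" unfolding apt_def using assms E(2,3) by (auto; blast)+
  then show ?thesis using E(1) by blast
qed

end

section \<open>Degrees and types\<close>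

context plocal
begin

definition bmat :: "(nat \<Rightarrow> nat \<Rightarrow> rat) \<Rightarrow> rat mat" where
  "bmat b = mat (Suc n) (Suc n) (\<lambda>(i, j). b j i)"

lemma bmat_carrier [simp]: "bmat b \<in> carrier_mat (Suc n) (Suc n)"
  by (simp add: bmat_def)

lemma det_bmat_neq_0: assumes b: "basis b" shows "det (bmat b) \<noteq> 0"
proof
  assume "det (bmat b) = 0"
  then obtain v where v: "v \<in> carrier_vec (Suc n)" "v \<noteq> 0\<^sub>v (Suc n)" "bmat b *\<^sub>v v = 0\<^sub>v (Suc n)"
    using det_0_iff_vec_prod_zero_field[OF bmat_carrier[of b]] by blast
  have "(\<Sum>j\<le>n. v $ j \<star> b j) i = 0" for i
  proof (cases "i \<le> n")
    case True
    have "(bmat b *\<^sub>v v) $ i = (\<Sum>j = 0..<Suc n. b j i * v $ j)"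
      using True v(1) by (simp add: bmat_def scalar_prod_def)
    moreover have "(bmat b *\<^sub>v v) $ i = 0" using v(3) True by simp
    ultimately have "(\<Sum>j = 0..<Suc n. b j i * v $ j) = 0" by simp
    then show ?thesis by (simp add: sum_fun_apply mult.commute lessThan_Suc_atMost atLeast0LessThan)
  next
    case False
    then have "b j i = 0" if "j \<le> n" for j using basis_V[OF b that] by (simp add: vspace_def)
    then show ?thesis by (simp add: sum_fun_apply)
  qed
  then have "(\<Sum>j\<le>n. v $ j \<star> b j) = 0" by (simp add: fun_eq_iff)
  moreover have "indep {..n} b" using b by (simp add: basis_def)
  ultimately have "v $ j = 0" if "j \<le> n" for j using indepD[of "{..n}" b "\<lambda>j. v $ j" j] that by simp
  then have "v = 0\<^sub>v (Suc n)" using v(1) by (intro eq_vecI) auto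
  then show False using v(2) by simp
qed

lemma bmat_combination:
  assumes "\<And>j. j \<le> n \<Longrightarrow> b' j = (\<Sum>k\<le>n. C k j \<star> b k)"
  shows "det (bmat b') = det (bmat b) * det (mat (Suc n) (Suc n) (\<lambda>(k, j). C k j))"
proof -
  have "bmat b' = bmat b * mat (Suc n) (Suc n) (\<lambda>(k, j). C k j)"
  proof (rule eq_matI)
    fix i j assume "i < dim_row (bmat b * mat (Suc n) (Suc n) (\<lambda>(k, j). C k j))"
      "j < dim_col (bmat b * mat (Suc n) (Suc n) (\<lambda>(k, j). C k j))"
    then have ij: "i < Suc n" "j < Suc n" by (auto simp: bmat_def)
    then have "bmat b' $$ (i, j) = (\<Sum>k\<le>n. C k j \<star> b k) i" using assms[of j] by (simp add: bmat_def)
    also have "\<dots> = (\<Sum>k = 0..<Suc n. b k i * C k j)"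
      by (simp add: sum_fun_apply mult.commute lessThan_Suc_atMost atLeast0LessThan)
    finally show "bmat b' $$ (i, j) = (bmat b * mat (Suc n) (Suc n) (\<lambda>(k, j). C k j)) $$ (i, j)"
      using ij by (simp add: bmat_def scalar_prod_def)
  qed (auto simp: bmat_def)
  then show ?thesis using det_mult[OF bmat_carrier, of "mat (Suc n) (Suc n) (\<lambda>(k, j). C k j)" b] by simp
qed

lemma det_ring_p:
  assumes "\<And>i j. i \<le> n \<Longrightarrow> j \<le> n \<Longrightarrow> C i j \<in> ring_p"
  shows "det (mat (Suc n) (Suc n) (\<lambda>(i, j). C i j)) \<in> ring_p"
proof -
  let ?M = "mat (Suc n) (Suc n) (\<lambda>(i, j). C i j)"
  have "det ?M = (\<Sum>q\<in>{q. q permutes {0..<Suc n}}. signof q * (\<Prod>i = 0..<Suc n. ?M $$ (i, q i)))"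
    by (rule det_def') simp
  also have "\<dots> \<in> ring_p"
  proof (intro ring_p_sum ring_p_mult ring_p_prod)
    fix q i assume q: "q \<in> {q. q permutes {0..<Suc n}}" and i: "i \<in> {0..<Suc n}"
    then have "q i \<in> {0..<Suc n}" using permutes_in_image by fastforce
    then show "?M $$ (i, q i) \<in> ring_p" using i assms by simp
  next
    fix q :: "nat \<Rightarrow> nat"
    show "signof q \<in> ring_p" using ring_p_uminus[OF ring_p_1] by (simp add: sign_def)
  qed
  finally show ?thesis .
qed

lemma latspan_mem: assumes "j \<le> n" shows "b j \<in> latspan b"
  unfolding latspan_def using sum_delta_smul[of "{..n}" j 1 b] assms
  by (intro CollectI exI[of _ "\<lambda>i. if i = j then 1 else 0"]) auto

text \<open>The coordinates of b' with respect to b are p-integral, so the determinants differ by a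
  factor from the local ring.\<close>

lemma val_det_le:
  assumes b: "basis b" "basis b'" and sub: "latspan b' \<subseteq> latspan b"
  shows "val (det (bmat b)) \<le> val (det (bmat b'))"
proof -
  have "\<exists>c. b' j = (\<Sum>k\<le>n. c k \<star> b k) \<and> (\<forall>k\<le>n. c k \<in> ring_p)" if "j \<le> n" for j
    using latspan_mem[OF that, of b'] sub unfolding latspan_def by blast
  then have "\<forall>j. \<exists>c. j \<le> n \<longrightarrow> b' j = (\<Sum>k\<le>n. c k \<star> b k) \<and> (\<forall>k\<le>n. c k \<in> ring_p)" by blast
  then obtain c where c: "\<And>j. j \<le> n \<Longrightarrow> b' j = (\<Sum>k\<le>n. c j k \<star> b k)" "\<And>j k. j \<le> n \<Longrightarrow> k \<le> n \<Longrightarrow> c j k \<in> ring_p"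
    by metis
  let ?D = "det (mat (Suc n) (Suc n) (\<lambda>(k, j). c j k))"
  have e: "det (bmat b') = det (bmat b) * ?D" by (rule bmat_combination) (rule c(1))
  have "?D \<in> ring_p" by (rule det_ring_p) (rule c(2))
  moreover have "?D \<noteq> 0" using e det_bmat_neq_0[OF b(2)] by auto
  ultimately show ?thesis using e det_bmat_neq_0[OF b(1)] by (simp add: val_mult ring_p_iff)
qed

text \<open>The signed length of X relative to \<open>L0\<close>, growing as X shrinks. Two bases of
  one lattice are related by p-integral matrices in both directions, so the chosen basis does not
  matter (\<open>deg_latspan\<close>).\<close>

definition deg :: "(nat \<Rightarrow> rat) set \<Rightarrow> int" where
  "deg X = val (det (bmat (SOME b. basis b \<and> latspan b = X)))"

lemma deg_latspan: assumes "basis b" shows "deg (latspan b) = val (det (bmat b))"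
proof -
  define b' where "b' = (SOME b'. basis b' \<and> latspan b' = latspan b)"
  have "basis b' \<and> latspan b' = latspan b"
    unfolding b'_def by (rule someI[of _ b]) (use assms in simp)
  then show ?thesis
    unfolding deg_def b'_def[symmetric] using val_det_le[of b b'] val_det_le[of b' b] assms by auto
qed

lemma latspanI: "x = (\<Sum>i\<le>n. c i \<star> b i) \<Longrightarrow> (\<And>i. i \<le> n \<Longrightarrow> c i \<in> ring_p) \<Longrightarrow> x \<in> latspan b"
  unfolding latspan_def by (rule CollectI, rule exI[of _ c]) simp

lemma stdI:
  "x = (\<Sum>i\<le>n. c i \<star> F (int i)) \<Longrightarrow> (\<And>i. i \<le> n \<Longrightarrow> val_ge (- ((int i - k) div N)) (c i)) \<Longrightarrow> x \<in> std F k"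
  unfolding std_alt by (rule CollectI, rule exI[of _ c]) simp

lemma std_latspan:
  assumes F: "pframe F"
  defines "b \<equiv> \<lambda>k i. P powi (- ((int i - k) div N)) \<star> F (int i)"
  shows "basis (b k)" "std F k = latspan (b k)"
proof -
  show "basis (b k)"
    using basis_lines(1)[OF pframe_basis[OF F], of id "\<lambda>i. P powi (- ((int i - k) div N))"] by (simp add: b_def)
  show "std F k = latspan (b k)"
  proof (intro equalityI subsetI)
    fix x assume "x \<in> std F k"
    then obtain c where c: "x = (\<Sum>i\<le>n. c i \<star> F (int i))" "\<forall>i\<le>n. val_ge (- ((int i - k) div N)) (c i)"
      unfolding std_alt by blast
    show "x \<in> latspan (b k)"
    proof (rule latspanI)
      show "x = (\<Sum>i\<le>n. (c i / P powi (- ((int i - k) div N))) \<star> b k i)"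
        unfolding c(1) by (rule sum.cong) (simp_all add: b_def)
      fix i assume "i \<le> n"
      then have "val_ge (- ((int i - k) div N)) (c i)" using c(2) by blast
      then show "c i / P powi (- ((int i - k) div N)) \<in> ring_p"
        by (simp add: val_ge_iff power_int_minus divide_inverse mult.commute)
    qed
  next
    fix x assume "x \<in> latspan (b k)"
    then obtain c where c: "x = (\<Sum>i\<le>n. c i \<star> b k i)" "\<forall>i\<le>n. c i \<in> ring_p" unfolding latspan_def by blast
    show "x \<in> std F k"
    proof (rule stdI)
      show "x = (\<Sum>i\<le>n. (c i * P powi (- ((int i - k) div N))) \<star> F (int i))"
        unfolding c(1) by (simp add: b_def)
      fix i assume "i \<le> n"
      then show "val_ge (- ((int i - k) div N)) (c i * P powi (- ((int i - k) div N)))"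
        using c(2) by (intro val_ge_mult) (simp_all add: val_ge_def)
    qed
  qed
qed

lemma div_pred: "(y - 1) div N = y div N - (if y mod N = 0 then 1 else 0)"
proof (cases "y mod N = 0")
  case True
  then have "y - 1 = N * (y div N - 1) + (N - 1)" using mult_div_mod_eq[of N y] by (simp add: algebra_simps)
  then have "(y - 1) div N = y div N - 1" by (rule int_div_pos_eq) simp_all
  then show ?thesis using True by simp
next
  case False
  then have "y - 1 = N * (y div N) + (y mod N - 1)" using mult_div_mod_eq[of N y] by linarith
  then have "(y - 1) div N = y div N"
    by (rule int_div_pos_eq) (use False pos_mod_sign[of N y] pos_mod_bound[of N y] in linarith)+
  then show ?thesis using False by simp
qed

lemma val_prod_P: "finite I \<Longrightarrow> val (\<Prod>i\<in>I. P powi t i) = sum t I"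
  by (induction I rule: finite_induct) (simp_all add: val_mult)

lemma deg_std_sum:
  assumes F: "pframe F"
  shows "deg (std F k) = (\<Sum>i\<le>n. - ((int i - k) div N)) + val (det (bmat (\<lambda>i. F (int i))))"
proof -
  define t where "t = (\<lambda>i. - ((int i - k) div N))"
  let ?D = "mat (Suc n) (Suc n) (\<lambda>(i, j). if i = j then P powi t i else 0)"
  have "det (bmat (\<lambda>i. P powi t i \<star> F (int i))) = det (bmat (\<lambda>i. F (int i))) * det ?D"
  proof (rule bmat_combination)
    fix j assume "j \<le> n"
    then show "P powi t j \<star> F (int j) = (\<Sum>i\<le>n. (if i = j then P powi t i else 0) \<star> F (int i))"
      using sum_delta_smul[of "{..n}" j "P powi t j" "\<lambda>i. F (int i)"] by (simp cong: if_cong)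
  qed
  moreover have "det ?D = (\<Prod>i\<in>{0..<Suc n}. P powi t i)"
    by (subst det_upper_triangular[of _ "Suc n"]) (auto simp: prod_list_diag_prod)
  moreover have "{0..<Suc n} = {..n}" by auto
  ultimately have "val (det (bmat (\<lambda>i. P powi t i \<star> F (int i)))) = val (det (bmat (\<lambda>i. F (int i)))) + sum t {..n}"
    using det_bmat_neq_0[OF pframe_basis[OF F]] by (simp add: val_mult val_prod_P)
  then show ?thesis
    using deg_latspan[OF std_latspan(1)[OF F, of k]] std_latspan(2)[OF F, of k] by (simp add: t_def)
qed

text \<open>In the explicit basis of the lattice exactly one exponent grows, namely that of the
  index congruent to k modulo n + 1.\<close>

lemma deg_std_succ:
  assumes F: "pframe F" shows "deg (std F (k + 1)) = deg (std F k) + 1"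
proof -
  define i0 where "i0 = nat (k mod N)"
  have i0: "i0 \<le> n" "int i0 = k mod N"
    using pos_mod_bound[of N k] pos_mod_sign[of N k] unfolding i0_def by linarith+
  have "- ((int i - (k + 1)) div N) = - ((int i - k) div N) + (if i = i0 then 1 else 0)" if "i \<le> n" for i
  proof -
    have "(int i - k) mod N = 0 \<longleftrightarrow> int i mod N = k mod N" by (simp add: mod_eq_dvd_iff mod_eq_0_iff_dvd)
    also have "\<dots> \<longleftrightarrow> i = i0" using that i0 by (metis int_ops(9) le_imp_less_Suc mod_less of_nat_eq_iff)
    finally show ?thesis using div_pred[of "int i - k"] by (simp add: algebra_simps)
  qed
  then have "(\<Sum>i\<le>n. - ((int i - (k + 1)) div N)) = (\<Sum>i\<le>n. - ((int i - k) div N)) + (\<Sum>i\<le>n. if i = i0 then 1 else 0)"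
    by (subst sum.distrib[symmetric], intro sum.cong) auto
  then show ?thesis unfolding deg_std_sum[OF F] using i0(1) by simp
qed

lemma deg_std: assumes F: "pframe F" shows "deg (std F k) = deg (std F 0) + k"
proof -
  have p: "deg (std F (l + int j)) = deg (std F l) + int j" for l j
  proof (induction j)
    case (Suc j)
    have "l + int (Suc j) = (l + int j) + 1" by simp
    then show ?case using deg_std_succ[OF F, of "l + int j"] Suc by (simp only:)
  qed simp
  show ?thesis using p[of 0 "nat k"] p[of k "nat (- k)"] by (cases "k \<ge> 0") simp_all
qed

text \<open>The class of X alone is a simplex, so it lies in a chamber, all of whose lattices come
  from a frame. This is the source of bases for lattices.\<close>

lemma lattice_std_ex: assumes "lattice X" shows "\<exists>F k. pframe F \<and> X = std F k"
proof -
  have c: "Y \<subseteq> Z \<or> Z \<subseteq> Y" if YZ: "Y \<in> cls X" "Z \<in> cls X" for Y Z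
  proof -
    obtain a b where ab: "Y = sc (P powi a) X" "Z = sc (P powi b) X" using YZ unfolding cls_def by blast
    show ?thesis unfolding ab using sc_powi_antimono[OF lattice_submod[OF assms]] by (meson linear)
  qed
  have "\<Union>{cls X} = cls X" by simp
  then have "simplex {cls X}" unfolding simplex_def using assms c by auto
  then obtain F where F: "pframe F" "{cls X} \<subseteq> ch F" using simplex_in_chamber by blast
  have "X \<in> \<Union>(ch F)" using F(2) cls_self by blast
  then show ?thesis unfolding Union_ch[OF F(1)] using F(1) by blast
qed

lemma lattice_latspan_ex: assumes "lattice X" shows "\<exists>b. basis b \<and> X = latspan b"
  using lattice_std_ex[OF assms] std_latspan by blast

lemma deg_sc: assumes "lattice X" shows "deg (sc (P powi m) X) = deg X + N * m"
proof -
  obtain F k where F: "pframe F" "X = std F k" using lattice_std_ex[OF assms] by blast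
  have "sc (P powi m) X = std F (k + N * m)" unfolding F(2) using pchain_periodic[OF pchain_std[OF F(1)]] by simp
  then show ?thesis using deg_std[OF F(1), of k] deg_std[OF F(1), of "k + N * m"] F(2) by simp
qed

text \<open>Scaling by p raises the degree by n + 1, so modulo n + 1 the degree depends on the class
  only.\<close>

definition vtype :: "(nat \<Rightarrow> rat) set set \<Rightarrow> nat" where
  "vtype v = nat (deg (SOME X. X \<in> v) mod N)"

lemma vtype_cls: assumes "lattice X" shows "vtype (cls X) = nat (deg X mod N)"
proof -
  have "(SOME Y. Y \<in> cls X) \<in> cls X" by (rule someI[of _ X]) simp
  then obtain m where "(SOME Y. Y \<in> cls X) = sc (P powi m) X" unfolding cls_def by blast
  then show ?thesis unfolding vtype_def using deg_sc[OF assms] by simp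
qed

lemma int_mod_atMost_bij: "bij_betw (\<lambda>k. nat ((d + int k) mod N)) {..n} {..n}"
proof -
  have "affine n (\<lambda>x. d + x)" by (simp add: affine_def inj_def)
  from affine_residue_bij[OF this] show ?thesis .
qed

lemma vtype_ch_bij: assumes F: "pframe F" shows "bij_betw vtype (ch F) {..n}"
proof -
  define v where "v = (\<lambda>k. cls (std F (int k)))"
  have t: "vtype (v k) = nat ((deg (std F 0) + int k) mod N)" for k
    unfolding v_def vtype_cls[OF lattice_std[OF F]] deg_std[OF F, of "int k"] ..
  have e: "vtype \<circ> v = (\<lambda>k. nat ((deg (std F 0) + int k) mod N))"
    by (rule ext) (simp only: comp_apply t)
  have bij: "bij_betw (vtype \<circ> v) {..n} {..n}" unfolding e by (rule int_mod_atMost_bij)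
  then have "inj_on vtype (v ` {..n})" unfolding bij_betw_def by (intro inj_on_imageI) simp
  moreover have "vtype ` v ` {..n} = {..n}" using bij unfolding bij_betw_def image_comp by simp
  ultimately show ?thesis unfolding ch_def v_def[symmetric] bij_betw_def by simp
qed

lemma card_ch: "pframe F \<Longrightarrow> card (ch F) = Suc n"
  using bij_betw_same_card[OF vtype_ch_bij] by simp

section \<open>Linear bijections, matrices and their effect on degrees\<close>

definition linear_bij :: "((nat \<Rightarrow> rat) \<Rightarrow> nat \<Rightarrow> rat) \<Rightarrow> bool" where
  "linear_bij g \<longleftrightarrow> bij_betw g V V \<and> (\<forall>x\<in>V. \<forall>y\<in>V. g (x + y) = g x + g y) \<and> (\<forall>c. \<forall>x\<in>V. g (c \<star> x) = c \<star> g x)"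

lemma linear_bijD:
  assumes "linear_bij g"
  shows "x \<in> V \<Longrightarrow> g x \<in> V" "inj_on g V" "g ` V = V"
    "x \<in> V \<Longrightarrow> g (c \<star> x) = c \<star> g x" "g 0 = 0"
    "(\<And>i. i \<in> I \<Longrightarrow> x' i \<in> V) \<Longrightarrow> g (\<Sum>i\<in>I. c' i \<star> x' i) = (\<Sum>i\<in>I. c' i \<star> g (x' i))"
proof -
  show s: "\<And>x c. x \<in> V \<Longrightarrow> g (c \<star> x) = c \<star> g x" using assms by (simp add: linear_bij_def)
  show "x \<in> V \<Longrightarrow> g x \<in> V" "inj_on g V" "g ` V = V"
    using assms by (auto simp: linear_bij_def bij_betw_def)
  show z: "g 0 = 0" using s[of 0 0] vspace_closed(1) by simp
  show "(\<And>i. i \<in> I \<Longrightarrow> x' i \<in> V) \<Longrightarrow> g (\<Sum>i\<in>I. c' i \<star> x' i) = (\<Sum>i\<in>I. c' i \<star> g (x' i))"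
  proof (induction I rule: infinite_finite_induct)
    case (insert i I)
    have "(\<Sum>i\<in>I. c' i \<star> x' i) \<in> V" "c' i \<star> x' i \<in> V" using insert by (auto intro!: vspace_closed)
    then have "g (c' i \<star> x' i + (\<Sum>i\<in>I. c' i \<star> x' i)) = g (c' i \<star> x' i) + g (\<Sum>i\<in>I. c' i \<star> x' i)"
      using assms by (simp add: linear_bij_def)
    moreover have "g (c' i \<star> x' i) = c' i \<star> g (x' i)" using insert.prems by (intro s) simp
    moreover have "g (\<Sum>i\<in>I. c' i \<star> x' i) = (\<Sum>i\<in>I. c' i \<star> g (x' i))" using insert.prems by (intro insert.IH) simp
    ultimately show ?case by (simp only: sum.insert[OF insert.hyps])
  qed (simp_all add: z)
qed

lemma linear_bij_basis: assumes g: "linear_bij g" and b: "basis b" shows "basis (\<lambda>i. g (b i))"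
  unfolding basis_def indep_def
proof (intro conjI allI impI ballI)
  fix i assume "i \<le> n"
  then show "g (b i) \<in> V" using linear_bijD(1)[OF g] basis_V[OF b] by simp
next
  fix c i assume s: "(\<Sum>i\<le>n. c i \<star> g (b i)) = 0" and i: "i \<in> {..n}"
  have "g (\<Sum>i\<le>n. c i \<star> b i) = g 0"
    using linear_bijD(6)[OF g, of "{..n}" b c] s basis_V[OF b] linear_bijD(5)[OF g] by simp
  moreover have "(\<Sum>i\<le>n. c i \<star> b i) \<in> V" using basis_V[OF b] by (auto intro!: vspace_closed)
  ultimately have "(\<Sum>i\<le>n. c i \<star> b i) = 0"
    using linear_bijD(2)[OF g] vspace_closed(1) by (meson inj_onD)
  then show "c i = 0" using b i indepD[of "{..n}" b c i] by (simp add: basis_def)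
qed

lemma linear_bij_latspan:
  assumes g: "linear_bij g" and b: "basis b" shows "g ` latspan b = latspan (\<lambda>i. g (b i))"
proof -
  have e: "g (\<Sum>i\<le>n. c i \<star> b i) = (\<Sum>i\<le>n. c i \<star> g (b i))" for c
    by (rule linear_bijD(6)[OF g]) (use basis_V[OF b] in simp)
  show ?thesis
  proof (intro equalityI subsetI)
    fix y assume "y \<in> g ` latspan b"
    then obtain c where c: "y = g (\<Sum>i\<le>n. c i \<star> b i)" "\<forall>i\<le>n. c i \<in> ring_p" unfolding latspan_def by blast
    show "y \<in> latspan (\<lambda>i. g (b i))" by (rule latspanI[OF c(1)[unfolded e]]) (use c(2) in blast)
  next
    fix y assume "y \<in> latspan (\<lambda>i. g (b i))"
    then obtain c where c: "y = (\<Sum>i\<le>n. c i \<star> g (b i))" "\<forall>i\<le>n. c i \<in> ring_p" unfolding latspan_def by blast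
    have "(\<Sum>i\<le>n. c i \<star> b i) \<in> latspan b" by (rule latspanI[OF HOL.refl]) (use c(2) in blast)
    then show "y \<in> g ` latspan b" unfolding c(1) e[symmetric] by (rule imageI)
  qed
qed

lemma linear_bij_lattice: assumes g: "linear_bij g" and X: "lattice X" shows "lattice (g ` X)"
proof -
  obtain b where b: "basis b" "X = latspan b" using lattice_latspan_ex[OF X] by blast
  show ?thesis unfolding b(2) linear_bij_latspan[OF g b(1)] by (rule lattice_latspan[OF linear_bij_basis[OF g b(1)]])
qed

lemma linear_bij_sc: assumes g: "linear_bij g" and X: "X \<subseteq> V" shows "g ` sc c X = sc c (g ` X)"
  unfolding sc_def image_image using linear_bijD(4)[OF g] X by (intro image_cong) auto

lemma linear_bij_cls: assumes g: "linear_bij g" and X: "X \<subseteq> V" shows "(`) g ` cls X = cls (g ` X)"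
  unfolding cls_def image_image linear_bij_sc[OF g X] ..

lemma linear_bij_simplex: assumes g: "linear_bij g" and A: "simplex A" shows "simplex ((`) ((`) g) ` A)"
proof -
  have "(`) g ` v \<in> cls ` Collect lattice" if vA: "v \<in> A" for v
  proof -
    obtain X where X: "X \<in> v" "lattice X" "v = cls X" by (rule simplex_nonempty_class[OF A vA])
    have "(`) g ` v = cls (g ` X)" unfolding X(3) by (rule linear_bij_cls[OF g lattice_V[OF X(2)]])
    then show ?thesis using linear_bij_lattice[OF g X(2)] by simp
  qed
  moreover have "X' \<subseteq> Y' \<or> Y' \<subseteq> X'" if XY: "X' \<in> \<Union>((`) ((`) g) ` A)" "Y' \<in> \<Union>((`) ((`) g) ` A)" for X' Y'
  proof -
    obtain X Y where "X \<in> \<Union>A" "X' = g ` X" "Y \<in> \<Union>A" "Y' = g ` Y" using XY by blast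
    then show ?thesis using A unfolding simplex_def by (meson image_mono)
  qed
  moreover have "finite ((`) ((`) g) ` A)" "(`) ((`) g) ` A \<noteq> {}" using A unfolding simplex_def by simp_all
  ultimately show ?thesis unfolding simplex_def by (intro conjI ballI subsetI) auto
qed

lemma linear_bij_inverse:
  assumes g: "linear_bij g"
  shows "linear_bij (the_inv_into V g)" "x \<in> V \<Longrightarrow> the_inv_into V g (g x) = x" "x \<in> V \<Longrightarrow> g (the_inv_into V g x) = x"
proof -
  have inj: "inj_on g V" and im: "g ` V = V" using linear_bijD[OF g] by simp_all
  let ?h = "the_inv_into V g"
  show hg: "\<And>x. x \<in> V \<Longrightarrow> ?h (g x) = x" using the_inv_into_f_f[OF inj] by simp
  show gh: "\<And>x. x \<in> V \<Longrightarrow> g (?h x) = x" using f_the_inv_into_f[OF inj] im by simp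
  have hV: "?h x \<in> V" if "x \<in> V" for x using the_inv_into_into[OF inj, of x V] im that by simp
  have "?h (x + y) = ?h x + ?h y" if "x \<in> V" "y \<in> V" for x y
  proof -
    have "g (?h x + ?h y) = x + y" using g hV gh that by (simp add: linear_bij_def)
    then show ?thesis using hg[of "?h x + ?h y"] hV that vspace_closed(2) by metis
  qed
  moreover have "?h (c \<star> x) = c \<star> ?h x" if "x \<in> V" for c x
  proof -
    have "g (c \<star> ?h x) = c \<star> x" using linear_bijD(4)[OF g] hV gh that by simp
    then show ?thesis using hg[of "c \<star> ?h x"] hV that vspace_closed(4) by metis
  qed
  moreover have "bij_betw ?h V V" using bij_betw_the_inv_into[of g V V] g by (simp add: linear_bij_def)
  ultimately show "linear_bij ?h" by (simp add: linear_bij_def)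
qed

definition act :: "rat mat \<Rightarrow> (nat \<Rightarrow> rat) \<Rightarrow> nat \<Rightarrow> rat" where
  "act M x = (\<lambda>i. if i \<le> n then \<Sum>j\<le>n. M $$ (i, j) * x j else 0)"

lemma act_V: "act M x \<in> V"
  by (simp add: act_def vspace_def)

lemma act_mult:
  assumes "A \<in> carrier_mat (Suc n) (Suc n)" "B \<in> carrier_mat (Suc n) (Suc n)"
  shows "act (A * B) x = act A (act B x)"
proof
  fix i
  show "act (A * B) x i = act A (act B x) i"
  proof (cases "i \<le> n")
    case True
    have "(A * B) $$ (i, j) = (\<Sum>k\<le>n. A $$ (i, k) * B $$ (k, j))" if "j \<le> n" for j
      using assms True that by (simp add: scalar_prod_def lessThan_Suc_atMost atLeast0LessThan)
    then have "act (A * B) x i = (\<Sum>j\<le>n. \<Sum>k\<le>n. A $$ (i, k) * B $$ (k, j) * x j)"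
      using True by (simp add: act_def sum_distrib_right)
    also have "\<dots> = (\<Sum>k\<le>n. \<Sum>j\<le>n. A $$ (i, k) * B $$ (k, j) * x j)" by (rule sum.swap)
    also have "\<dots> = act A (act B x) i"
      using True by (simp add: act_def sum_distrib_left mult.assoc)
    finally show ?thesis .
  qed (simp add: act_def)
qed

lemma act_one: "x \<in> V \<Longrightarrow> act (1\<^sub>m (Suc n)) x = x"
  by (auto simp: act_def vspace_def fun_eq_iff if_distrib[of "\<lambda>a. a * _"] cong: if_cong)

lemma act_linear_bij:
  assumes M: "M \<in> carrier_mat (Suc n) (Suc n)" and M': "M' \<in> carrier_mat (Suc n) (Suc n)"
    and inv: "M * M' = 1\<^sub>m (Suc n)" "M' * M = 1\<^sub>m (Suc n)"
  shows "linear_bij (act M)"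
proof -
  have "bij_betw (act M) V V"
    by (rule bij_betw_byWitness[of _ "act M'"])
      (auto simp: act_mult[OF M M', symmetric] act_mult[OF M' M, symmetric] inv act_one act_V)
  moreover have "act M (x + y) = act M x + act M y" for x y
    by (auto simp: act_def fun_eq_iff sum.distrib algebra_simps)
  moreover have "act M (c \<star> x) = c \<star> act M x" for x c
    by (auto simp: act_def fun_eq_iff sum_distrib_left algebra_simps)
  ultimately show ?thesis by (simp add: linear_bij_def)
qed

text \<open>The basis matrix is multiplied by M. In particular a determinant of valuation 0
  preserves degrees and types.\<close>

lemma deg_act:
  assumes M: "M \<in> carrier_mat (Suc n) (Suc n)" and lin: "linear_bij (act M)" and X: "lattice X"
  shows "deg (act M ` X) = deg X + val (det M)"
proof -
  obtain b where b: "basis b" "X = latspan b" using lattice_latspan_ex[OF X] by blast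
  note b' = linear_bij_basis[OF lin b(1)]
  have "bmat (\<lambda>i. act M (b i)) = M * bmat b"
    using M by (intro eq_matI)
      (auto simp: bmat_def act_def scalar_prod_def lessThan_Suc_atMost atLeast0LessThan)
  then have d: "det (bmat (\<lambda>i. act M (b i))) = det M * det (bmat b)" using det_mult[OF M bmat_carrier] by simp
  then have "det M \<noteq> 0" using det_bmat_neq_0[OF b'] by auto
  then have "val (det (bmat (\<lambda>i. act M (b i)))) = val (det (bmat b)) + val (det M)"
    using d det_bmat_neq_0[OF b(1)] by (simp add: val_mult)
  then show ?thesis unfolding b(2) linear_bij_latspan[OF lin b(1)] deg_latspan[OF b'] deg_latspan[OF b(1)] .
qed

text \<open>A lattice is spanned by n + 1 rational vectors, coded as a list of lists. Countability
  is what lets the building be moved into any infinite vertex type.\<close>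

lemma countable_lattices: "countable (Collect lattice)"
proof -
  define vec where "vec = (\<lambda>l :: rat list. \<lambda>j. if j < length l then l ! j else 0)"
  define L where "L = (\<lambda>ll :: rat list list. latspan (\<lambda>i. vec (ll ! i)))"
  have "X \<in> range L" if X: "lattice X" for X
  proof -
    obtain b where b: "basis b" "X = latspan b" using lattice_latspan_ex[OF X] by blast
    define ll where "ll = map (\<lambda>i. map (b i) [0..<Suc n]) [0..<Suc n]"
    have "vec (ll ! i) = b i" if "i \<le> n" for i
    proof
      fix j
      have "ll ! i = map (b i) [0..<Suc n]" using that unfolding ll_def by (subst nth_map) (auto simp del: upt_Suc)
      then show "vec (ll ! i) j = b i j"
        using basis_V[OF b(1) that] by (auto simp: vec_def vspace_def simp del: upt_Suc)
    qed
    then have "latspan (\<lambda>i. vec (ll ! i)) = latspan b" unfolding latspan_def by simp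
    then show ?thesis using b(2) unfolding L_def by blast
  qed
  then have "Collect lattice \<subseteq> range L" by blast
  moreover have "countable (range L)" by simp
  ultimately show ?thesis using countable_subset by blast
qed

end

section \<open>Isomorphisms of apartments\<close>

context plocal
begin

lemma basis_change:
  assumes b: "basis b" and b2: "basis b2"
  shows "\<exists>g. linear_bij g \<and> (\<forall>c. g (\<Sum>i\<le>n. c i \<star> b i) = (\<Sum>i\<le>n. c i \<star> b2 i))"
proof -
  define co where "co = (\<lambda>x. SOME c. x = (\<Sum>i\<le>n. c i \<star> b i))"
  define g where "g = (\<lambda>x. \<Sum>i\<le>n. co x i \<star> b2 i)"
  have co: "x = (\<Sum>i\<le>n. co x i \<star> b i)" if "x \<in> V" for x
    unfolding co_def by (rule someI_ex[OF basis_span[OF b that]])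
  have sV: "(\<Sum>i\<le>n. c i \<star> b i) \<in> V" for c using basis_V[OF b] by (auto intro!: vspace_closed)
  have sV2: "(\<Sum>i\<le>n. c i \<star> b2 i) \<in> V" for c using basis_V[OF b2] by (auto intro!: vspace_closed)
  have g: "g (\<Sum>i\<le>n. c i \<star> b i) = (\<Sum>i\<le>n. c i \<star> b2 i)" for c
  proof -
    have "co (\<Sum>i\<le>n. c i \<star> b i) i = c i" if "i \<le> n" for i
      using basis_unique[OF b co[OF sV, of c, symmetric] that] .
    then show ?thesis unfolding g_def by (intro sum.cong) auto
  qed
  have "bij_betw g V V"
    unfolding bij_betw_def
  proof
    show "inj_on g V"
    proof (rule inj_onI)
      fix x y assume xy: "x \<in> V" "y \<in> V" "g x = g y"
      then have "co x i = co y i" if "i \<le> n" for i using basis_unique[OF b2 _ that] unfolding g_def by blast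
      then have "(\<Sum>i\<le>n. co x i \<star> b i) = (\<Sum>i\<le>n. co y i \<star> b i)" by (intro sum.cong) auto
      then show "x = y" using co xy by metis
    qed
    show "g ` V = V"
    proof (intro equalityI subsetI)
      fix y assume "y \<in> V"
      then obtain c where "y = (\<Sum>i\<le>n. c i \<star> b2 i)" using basis_span[OF b2] by blast
      then have "y = g (\<Sum>i\<le>n. c i \<star> b i)" by (simp add: g)
      then show "y \<in> g ` V" using sV by blast
    qed (use sV2 in \<open>auto simp: g_def\<close>)
  qed
  moreover have "g (x + y) = g x + g y" if "x \<in> V" "y \<in> V" for x y
  proof -
    have "x + y = (\<Sum>i\<le>n. (co x i + co y i) \<star> b i)"
      by (subst co[OF that(1)], subst co[OF that(2)]) (simp add: smul_add_left sum.distrib)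
    then show ?thesis using g[of "\<lambda>i. co x i + co y i"] by (simp add: g_def smul_add_left sum.distrib)
  qed
  moreover have "g (c \<star> x) = c \<star> g x" if "x \<in> V" for c x
  proof -
    have "c \<star> x = (\<Sum>i\<le>n. (c * co x i) \<star> b i)"
      by (subst co[OF that]) (simp add: smul_sum)
    then show ?thesis using g[of "\<lambda>i. c * co x i"] by (simp add: g_def smul_sum)
  qed
  ultimately show ?thesis using g unfolding linear_bij_def by blast
qed

text \<open>If c had valuation at most 0, a p-integral scalar would carry c x to a unit multiple of
  x and put x into X.\<close>

lemma notin_val:
  assumes X: "submod X" and x: "x \<notin> X" "c \<star> x \<in> X"
  shows "val_ge 1 c"
proof (cases "c = 0")
  case False
  then have m: "P powi val c \<star> x \<in> X" using submod_powi_mem_iff[OF X] x(2) by blast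
  have "\<not> val c \<le> 0"
  proof
    assume v: "val c \<le> 0"
    have "P powi (- val c) \<star> (P powi val c \<star> x) \<in> X" by (rule submodD(3)[OF X _ m]) (use v in simp)
    then show False using x(1) by (simp add: power_int_minus)
  qed
  then show ?thesis by (simp add: val_ge_def)
qed (simp add: val_ge_def)

text \<open>Each frame vector is rescaled by the power of p that just brings it into X0. This
  normalises the bases of two apartments against a lattice that belongs to both.\<close>

lemma adapted_basis:
  assumes E: "pframe E" and X0: "lattice X0"
  shows "\<exists>b. basis b \<and> (\<forall>i\<le>n. b i \<in> X0 \<and> b i \<notin> sc P X0) \<and> (\<forall>X. split b X \<longleftrightarrow> split (\<lambda>i. E (int i)) X)"
proof -
  have "\<exists>m. P powi m \<star> E (int i) \<in> X0 \<and> P powi (m - 1) \<star> E (int i) \<notin> X0" for i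
  proof -
    obtain k where k: "P ^ k \<star> E (int i) \<in> X0" using lattice_absorb[OF X0 pframe_V(1)[OF E]] by blast
    obtain l where l: "P powi (- int l) \<star> E (int i) \<notin> X0" using lattice_bounded[OF X0 pframe_V(2)[OF E]] by blast
    show ?thesis using int_step[of "\<lambda>m. P powi m \<star> E (int i) \<in> X0" "int k" "- int l"] k l by simp
  qed
  then obtain m where m: "\<And>i. P powi m i \<star> E (int i) \<in> X0" "\<And>i. P powi (m i - 1) \<star> E (int i) \<notin> X0" by metis
  define b where "b = (\<lambda>i. P powi m i \<star> E (int i))"
  have "b i \<notin> sc P X0" for i
  proof -
    have "(1 / P) \<star> b i = P powi (m i - 1) \<star> E (int i)" by (simp add: b_def power_int_diff)
    then show ?thesis using m(2)[of i] by (simp add: mem_sc_iff)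
  qed
  moreover have "basis b" "split b X \<longleftrightarrow> split (\<lambda>i. E (int i)) X" for X
    using basis_lines[OF pframe_basis[OF E], of id "\<lambda>i. P powi m i"] by (simp_all add: b_def)
  ultimately show ?thesis using m(1) by (intro exI[of _ b]) (simp add: b_def)
qed

lemma simplex_comparable: "simplex A \<Longrightarrow> X \<in> \<Union>A \<Longrightarrow> Y \<in> \<Union>A \<Longrightarrow> X \<subseteq> Y \<or> Y \<subseteq> X"
  unfolding simplex_def by blast

lemma chain_Union_submod:
  assumes "S \<noteq> {}" "\<And>X. X \<in> S \<Longrightarrow> submod X" "\<And>X Y. X \<in> S \<Longrightarrow> Y \<in> S \<Longrightarrow> X \<subseteq> Y \<or> Y \<subseteq> X"
  shows "submod (\<Union>S)"
  unfolding submod_def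
proof (intro conjI ballI)
  show "0 \<in> \<Union>S" using assms(1,2) submodD(1) by blast
  fix x assume x: "x \<in> \<Union>S"
  then obtain X where X: "x \<in> X" "X \<in> S" by blast
  {
    fix y assume "y \<in> \<Union>S"
    then obtain Y where Y: "y \<in> Y" "Y \<in> S" by blast
    consider "X \<subseteq> Y" | "Y \<subseteq> X" using assms(3) X(2) Y(2) by blast
    then show "x + y \<in> \<Union>S"
    proof cases
      case 1
      then have "x + y \<in> Y" using submodD(2)[OF assms(2)[OF Y(2)]] X(1) Y(1) by blast
      then show ?thesis using Y(2) by blast
    next
      case 2
      then have "x + y \<in> X" using submodD(2)[OF assms(2)[OF X(2)]] X(1) Y(1) by blast
      then show ?thesis using X(2) by blast
    qed
  }
  fix c assume "c \<in> ring_p"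
  then have "c \<star> x \<in> X" using submodD(3)[OF assms(2)[OF X(2)] _ X(1)] by blast
  then show "c \<star> x \<in> \<Union>S" using X(2) by blast
qed

text \<open>
  The number of basis vectors lying in exactly the lattices of \<open>c\<close> is the dimension over the
  field with \<open>p\<close> elements of the quotient of \<open>\<Inter>c\<close> by the part \<open>H\<close> covered by the remaining
  lattices, hence does not depend on the basis. The dimensions are compared by counting residues.
\<close>

lemma cell_card_le:
  assumes A: "simplex A" and B: "simplex B" and X0: "X0 \<in> \<Union>A"
    and b: "basis b" "\<And>i. i \<le> n \<Longrightarrow> b i \<in> X0" "\<And>i. i \<le> n \<Longrightarrow> b i \<notin> sc P X0"
    and b': "basis b'" "\<And>i. i \<le> n \<Longrightarrow> b' i \<in> X0" "\<And>i. i \<le> n \<Longrightarrow> b' i \<notin> sc P X0"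
    and sp: "\<And>X. X \<in> \<Union>A \<union> \<Union>B \<Longrightarrow> split b X" "\<And>X. X \<in> \<Union>A \<union> \<Union>B \<Longrightarrow> split b' X"
  defines "cell \<equiv> \<lambda>x. {X \<in> \<Union>A \<union> \<Union>B. x \<in> X}"
  shows "card {i \<in> {..n}. cell (b i) = c} \<le> card {i \<in> {..n}. cell (b' i) = c}"
proof -
  define S S' where "S = {i \<in> {..n}. cell (b i) = c}" and "S' = {i \<in> {..n}. cell (b' i) = c}"
  have fin: "finite S" "finite S'" and Sn: "\<And>i. i \<in> S \<Longrightarrow> i \<le> n" "\<And>i. i \<in> S' \<Longrightarrow> i \<le> n" by (auto simp: S_def S'_def)
  show ?thesis
  proof (cases "S = {}")
    case True
    then show ?thesis unfolding S_def[symmetric] by simp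
  next
    case False
    then obtain j0 where j0: "j0 \<le> n" "cell (b j0) = c" by (auto simp: S_def)
    have lat: "lattice X" if "X \<in> \<Union>A \<union> \<Union>B" for X using that simplex_mem(1)[OF A] simplex_mem(1)[OF B] by blast
    note sub = lattice_submod[OF lat]
    have scX0: "sc P X0 \<in> \<Union>A" using simplex_mem(3)[OF A X0, of 1] by simp
    have cF: "c \<subseteq> \<Union>A \<union> \<Union>B" using j0 by (auto simp: cell_def)
    have X0c: "X0 \<in> c" "sc P X0 \<notin> c" using j0 b X0 by (auto simp: cell_def)
    define Y where "Y = \<Inter>c"
    \<comment> \<open>The parts of the two chains outside c. Unions of chains are submodules, so no
      largest member has to be exhibited.\<close>
    define L where "L = \<Union>{X \<in> \<Union>A. X \<notin> c}"
    define M where "M = \<Union>{X \<in> \<Union>B. X \<notin> c}"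
    have subY: "submod Y"
      unfolding Y_def submod_def using cF submodD(1,2,3)[OF sub] by (meson InterE InterI subsetD)
    have subL: "submod L" unfolding L_def
    proof (rule chain_Union_submod)
      show "{X \<in> \<Union>A. X \<notin> c} \<noteq> {}" using scX0 X0c by blast
      show "submod X" if "X \<in> {X \<in> \<Union>A. X \<notin> c}" for X using sub that by blast
      show "X \<subseteq> Z \<or> Z \<subseteq> X" if "X \<in> {X \<in> \<Union>A. X \<notin> c}" "Z \<in> {X \<in> \<Union>A. X \<notin> c}" for X Z
        by (rule simplex_comparable[OF A]) (use that in blast)+
    qed
    have subM: "submod M" unfolding M_def
    proof (rule chain_Union_submod)
      obtain v where vB: "v \<in> B" using B unfolding simplex_def by blast
      obtain Z where Z: "Z \<in> v" "lattice Z" "v = cls Z" by (rule simplex_nonempty_class[OF B vB])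
      have ZB: "Z \<in> \<Union>B" using vB Z(1) by (rule UnionI)
      \<comment> \<open>A sufficiently deep representative of a vertex of B misses b j0, so the
        chain of B also has a member outside c.\<close>
      obtain m where "P powi (- int m) \<star> b j0 \<notin> Z" using lattice_bounded[OF Z(2) basis_neq_0[OF b(1) j0(1)]] by blast
      then have nZ: "b j0 \<notin> sc (P powi int m) Z" by (simp add: mem_sc_iff power_int_minus divide_inverse)
      have "sc (P powi int m) Z \<in> \<Union>B" by (rule simplex_mem(3)[OF B ZB])
      moreover have "sc (P powi int m) Z \<notin> c"
      proof
        assume "sc (P powi int m) Z \<in> c"
        then show False using nZ unfolding j0(2)[symmetric] cell_def by blast
      qed
      ultimately show "{X \<in> \<Union>B. X \<notin> c} \<noteq> {}" by blast
      show "submod X" if "X \<in> {X \<in> \<Union>B. X \<notin> c}" for X using sub that by blast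
      show "X \<subseteq> Z \<or> Z \<subseteq> X" if "X \<in> {X \<in> \<Union>B. X \<notin> c}" "Z \<in> {X \<in> \<Union>B. X \<notin> c}" for X Z
        by (rule simplex_comparable[OF B]) (use that in blast)+
    qed
    define H where "H = {x + y | x y. x \<in> Y \<inter> L \<and> y \<in> Y \<inter> M}"
    have HL: "x \<in> H" if "x \<in> Y" "x \<in> L" for x
    proof -
      have "x + 0 \<in> H" unfolding H_def using that submodD(1)[OF subY] submodD(1)[OF subM] by blast
      then show ?thesis by simp
    qed
    have HM: "x \<in> H" if "x \<in> Y" "x \<in> M" for x
    proof -
      have "0 + x \<in> H" unfolding H_def using that submodD(1)[OF subY] submodD(1)[OF subL] by blast
      then show ?thesis by simp
    qed
    have subH: "submod H"
      unfolding submod_def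
    proof (intro conjI ballI)
      show "0 \<in> H" using HL submodD(1)[OF subY] submodD(1)[OF subL] by blast
      fix u assume "u \<in> H"
      then obtain x y where u: "u = x + y" "x \<in> Y" "x \<in> L" "y \<in> Y" "y \<in> M" unfolding H_def by blast
      {
        fix v assume "v \<in> H"
        then obtain x' y' where v: "v = x' + y'" "x' \<in> Y" "x' \<in> L" "y' \<in> Y" "y' \<in> M" unfolding H_def by blast
        have "x + x' \<in> Y" "x + x' \<in> L" "y + y' \<in> Y" "y + y' \<in> M"
          using submodD(2)[OF subY] submodD(2)[OF subL] submodD(2)[OF subM] u v by blast+
        moreover have "u + v = (x + x') + (y + y')" by (simp add: u v)
        ultimately show "u + v \<in> H" unfolding H_def by blast
      }
      fix d assume d: "d \<in> ring_p"
      have "d \<star> x \<in> Y" "d \<star> x \<in> L" "d \<star> y \<in> Y" "d \<star> y \<in> M"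
        using submodD(3)[OF subY d] submodD(3)[OF subL d] submodD(3)[OF subM d] u by blast+
      moreover have "d \<star> u = d \<star> x + d \<star> y" by (simp add: u smul_add_right)
      ultimately show "d \<star> u \<in> H" unfolding H_def by blast
    qed
    \<comment> \<open>A vector b j with j \<in> S lies in no lattice outside c, so its coefficients
      in elements of L and of M are divisible by p. These vectors thus stay independent modulo p and
      H.\<close>
    have comp: "val_ge 1 (e j)" if h: "(\<Sum>i\<le>n. e i \<star> b i) \<in> H" and j: "j \<in> S" for e j
    proof -
      obtain x y where xy: "(\<Sum>i\<le>n. e i \<star> b i) = x + y" "x \<in> Y" "x \<in> L" "y \<in> Y" "y \<in> M"
        using h unfolding H_def by blast
      obtain X where X: "x \<in> X" "X \<in> \<Union>A" "X \<notin> c" using xy(3) unfolding L_def by blast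
      obtain Z where Z: "y \<in> Z" "Z \<in> \<Union>B" "Z \<notin> c" using xy(5) unfolding M_def by blast
      have FX: "X \<in> \<Union>A \<union> \<Union>B" and FZ: "Z \<in> \<Union>A \<union> \<Union>B" using X Z by blast+
      obtain f where f: "x = (\<Sum>i\<le>n. f i \<star> b i)" using basis_span[OF b(1)] lattice_V[OF lat[OF FX]] X(1) by blast
      obtain g where g: "y = (\<Sum>i\<le>n. g i \<star> b i)" using basis_span[OF b(1)] lattice_V[OF lat[OF FZ]] Z(1) by blast
      have jn: "j \<le> n" "cell (b j) = c" using j by (auto simp: S_def)
      have "b j \<notin> X" "b j \<notin> Z" using X Z FX FZ jn(2) by (auto simp: cell_def)
      moreover have "f j \<star> b j \<in> X" by (rule splitD[OF sp(1)[OF FX] X(1)[unfolded f] jn(1)])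
      moreover have "g j \<star> b j \<in> Z" by (rule splitD[OF sp(1)[OF FZ] Z(1)[unfolded g] jn(1)])
      ultimately have v: "val_ge 1 (f j)" "val_ge 1 (g j)" using notin_val[OF sub] FX FZ by blast+
      have "(\<Sum>i\<le>n. e i \<star> b i) = (\<Sum>i\<le>n. (f i + g i) \<star> b i)"
        unfolding xy(1) f g by (simp add: smul_add_left sum.distrib)
      from basis_unique[OF b(1) this jn(1)] show ?thesis using val_ge_add[OF v] by simp
    qed
    define D where "D = S \<rightarrow>\<^sub>E {..<p}"
    define D' where "D' = S' \<rightarrow>\<^sub>E {..<p}"
    define vec where "vec = (\<lambda>d. \<Sum>i\<le>n. (if i \<in> S then of_nat (d i) else 0) \<star> b i)"
    define vec' where "vec' = (\<lambda>d. \<Sum>i\<le>n. (if i \<in> S' then of_nat (d i) else 0) \<star> b' i)"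
    have vecY: "vec d \<in> Y" for d unfolding vec_def
    proof (rule submodD(5)[OF subY])
      fix i assume i: "i \<in> {..n}"
      show "(if i \<in> S then of_nat (d i) else 0) \<star> b i \<in> Y"
      proof (cases "i \<in> S")
        case True
        then have "b i \<in> Y" unfolding Y_def S_def cell_def by blast
        then show ?thesis using True submodD(3)[OF subY ring_p_of_nat] by simp
      qed (simp add: submodD(1)[OF subY])
    qed
    \<comment> \<open>Digit combinations of the b' i with i \<in> S' represent Y modulo H. Every
      other coordinate is either a multiple of p, which lands in L, or a unit; in the latter case b'
      i lies in Y and also in some lattice outside c, hence in H.\<close>
    have approx: "\<exists>d\<in>D'. y - vec' d \<in> H" if y: "y \<in> Y" for y
    proof -
      have yX0: "y \<in> X0" using y X0c unfolding Y_def by blast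
      have X0F: "X0 \<in> \<Union>A \<union> \<Union>B" using X0 by blast
      obtain t where t: "y = (\<Sum>i\<le>n. t i \<star> b' i)" using basis_span[OF b'(1)] lattice_V[OF lat[OF X0F]] yX0 by blast
      have tY: "t i \<star> b' i \<in> Y" if i: "i \<le> n" for i
        unfolding Y_def
      proof (rule InterI)
        fix X assume X: "X \<in> c"
        then have "y \<in> X" using y unfolding Y_def by blast
        then show "t i \<star> b' i \<in> X" using splitD[OF sp(2) _ i, of X t] X cF t by blast
      qed
      have tR: "t i \<in> ring_p" if i: "i \<le> n" for i
      proof -
        have "t i \<star> b' i \<in> X0" using tY[OF i] X0c unfolding Y_def by blast
        then have "P \<star> (t i \<star> b' i) \<in> sc P X0" by (simp only: smul_mem_sc[OF P_neq_0])
        then have "val_ge 1 (P * t i)"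
          using notin_val[OF sub b'(3)[OF i], of "P * t i"] scX0 by simp
        then show ?thesis by (simp add: val_ge_iff power_int_minus flip: mult.assoc)
      qed
      have "\<forall>i. \<exists>a s. i \<le> n \<longrightarrow> a < p \<and> s \<in> ring_p \<and> t i = of_nat a + P * s"
        using digit_exists[OF tR] by blast
      then obtain a s where as: "\<And>i. i \<le> n \<Longrightarrow> a i < p" "\<And>i. i \<le> n \<Longrightarrow> s i \<in> ring_p"
        "\<And>i. i \<le> n \<Longrightarrow> t i = of_nat (a i) + P * s i" by metis
      define d where "d = restrict a S'"
      have "d \<in> D'" unfolding D'_def d_def using as(1) Sn(2) by auto
      moreover have "y - vec' d \<in> H"
      proof -
        have "y - vec' d = (\<Sum>i\<le>n. (t i - (if i \<in> S' then of_nat (d i) else 0)) \<star> b' i)"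
          unfolding t vec'_def by (simp add: smul_minus_left sum_subtractf)
        also have "\<dots> \<in> H"
        proof (rule submodD(5)[OF subH])
          fix i assume "i \<in> {..n}"
          then have i: "i \<le> n" by simp
          have PL: "(P * r) \<star> b' i \<in> L" if "r \<in> ring_p" for r
          proof -
            have "r \<star> b' i \<in> X0" using submodD(3)[OF sub[OF X0F] that b'(2)[OF i]] .
            then have "P \<star> (r \<star> b' i) \<in> sc P X0" by (simp only: smul_mem_sc[OF P_neq_0])
            then show ?thesis unfolding L_def using scX0 X0c(2) by auto
          qed
          show "(t i - (if i \<in> S' then of_nat (d i) else 0)) \<star> b' i \<in> H"
          proof (cases "i \<in> S'")
            case True
            then have bY: "b' i \<in> Y" unfolding Y_def S'_def cell_def by blast
            have e: "t i - of_nat (d i) = P * s i" using as(3)[OF i] True by (simp add: d_def)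
            have "t i \<star> b' i - of_nat (d i) \<star> b' i \<in> Y"
              by (rule submodD(4)[OF subY tY[OF i] submodD(3)[OF subY ring_p_of_nat bY]])
            then have "(P * s i) \<star> b' i \<in> Y" unfolding smul_minus_left[symmetric] e .
            then show ?thesis using HL[OF _ PL[OF as(2)[OF i]]] True e by simp
          next
            case False
            show ?thesis
            proof (cases "t i \<in> unit_p")
              case True
              then have bY: "b' i \<in> Y" using submod_unit_smul[OF subY] tY[OF i] by blast
              then have "c \<subseteq> cell (b' i)" using cF unfolding Y_def cell_def by blast
              moreover have "cell (b' i) \<noteq> c" using False i by (simp add: S'_def)
              ultimately obtain X where "X \<in> \<Union>A \<union> \<Union>B" "b' i \<in> X" "X \<notin> c" unfolding cell_def by blast
              then have "b' i \<in> L \<or> b' i \<in> M" unfolding L_def M_def by blast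
              then have "b' i \<in> H" using HL HM bY by blast
              then show ?thesis using submodD(3)[OF subH tR[OF i]] False by simp
            next
              case nu: False
              obtain r where "r \<in> ring_p" "t i = P * r" using unit_or_P_mult[OF tR[OF i] nu] by blast
              then show ?thesis using HL[OF tY[OF i]] PL False by simp
            qed
          qed
        qed
        finally show ?thesis .
      qed
      ultimately show ?thesis by blast
    qed
    have "\<forall>d. \<exists>d'. d' \<in> D' \<and> vec d - vec' d' \<in> H" using approx[OF vecY] by blast
    then obtain F where F: "\<And>d. F d \<in> D'" "\<And>d. vec d - vec' (F d) \<in> H" by metis
    \<comment> \<open>Digit vectors with the same approximation differ by an element of H, so their
      digits agree modulo p and hence coincide.\<close>
    have "inj_on F D"
    proof (rule inj_onI)
      fix d1 d2 assume d: "d1 \<in> D" "d2 \<in> D" "F d1 = F d2"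
      have "(vec d1 - vec' (F d1)) - (vec d2 - vec' (F d2)) \<in> H" by (rule submodD(4)[OF subH F(2) F(2)])
      then have "vec d1 - vec d2 \<in> H" using d(3) by simp
      moreover have "vec d1 - vec d2 = (\<Sum>i\<le>n. (if i \<in> S then of_nat (d1 i) - of_nat (d2 i) else 0) \<star> b i)"
        unfolding vec_def sum_subtractf[symmetric] by (rule sum.cong) (simp_all add: smul_minus_left)
      ultimately have h: "(\<Sum>i\<le>n. (if i \<in> S then of_nat (d1 i) - of_nat (d2 i) else 0) \<star> b i) \<in> H" by simp
      show "d1 = d2"
      proof
        fix i
        show "d1 i = d2 i"
        proof (cases "i \<in> S")
          case True
          have "val_ge 1 (of_nat (d1 i) - of_nat (d2 i))" using comp[OF h True] True by simp
          then have "of_nat (d1 i) - of_nat (d2 i) \<notin> unit_p" by (auto simp: val_ge_def unit_p_iff)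
          moreover have "d1 i < p" "d2 i < p" using d(1,2) True unfolding D_def by auto
          ultimately show ?thesis using digit_diff_unit by blast
        next
          case False
          then show ?thesis using d(1,2) unfolding D_def by (auto simp: PiE_def extensional_def)
        qed
      qed
    qed
    moreover have "F ` D \<subseteq> D'" using F(1) by blast
    moreover have "finite D'" unfolding D'_def using fin by (intro finite_PiE) auto
    ultimately have "card D \<le> card D'" by (rule card_inj_on_le)
    then have "p ^ card S \<le> p ^ card S'" unfolding D_def D'_def using fin by (simp add: card_PiE)
    then have "card S \<le> card S'" using prime_gt_1_nat[OF prime] by simp
    then show ?thesis by (simp add: S_def S'_def)
  qed
qed

section \<open>Linear bijections between apartments\<close>

lemma linear_bij_split:
  assumes g: "linear_bij g" and b: "basis b" and X: "X \<subseteq> V" "split b X"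
  shows "split (\<lambda>i. g (b i)) (g ` X)"
  unfolding split_def
proof (intro allI impI)
  fix c i assume c: "(\<Sum>i\<le>n. c i \<star> g (b i)) \<in> g ` X" and i: "i \<le> n"
  have sV: "(\<Sum>i\<le>n. c i \<star> b i) \<in> V" using basis_V[OF b] by (auto intro!: vspace_closed)
  have "g (\<Sum>i\<le>n. c i \<star> b i) \<in> g ` X" using c linear_bijD(6)[OF g, of "{..n}" b c] basis_V[OF b] by simp
  then have "(\<Sum>i\<le>n. c i \<star> b i) \<in> X" using inj_on_image_mem_iff[OF linear_bijD(2)[OF g] sV X(1)] by simp
  then have "c i \<star> b i \<in> X" by (rule splitD[OF X(2) _ i])
  then have "g (c i \<star> b i) \<in> g ` X" by blast
  then show "c i \<star> g (b i) \<in> g ` X" using linear_bijD(4)[OF g basis_V[OF b i]] by simp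
qed

lemma split_cong: "(\<And>i. i \<le> n \<Longrightarrow> b i = b' i) \<Longrightarrow> split b X \<longleftrightarrow> split b' X"
  unfolding split_def by simp

lemma linear_bij_apt:
  assumes g: "linear_bij g" and b: "basis b" and gb: "\<And>i. i \<le> n \<Longrightarrow> g (b i) = b' i"
    and spb: "\<And>X. split b X \<longleftrightarrow> split (\<lambda>i. E (int i)) X"
    and sp: "\<And>X. split b' X \<longleftrightarrow> split (\<lambda>i. E' (int i)) X"
    and A: "A \<in> apt E"
  shows "(`) ((`) g) ` A \<in> apt E'"
proof -
  have sA: "simplex A" and spA: "\<And>X. X \<in> \<Union>A \<Longrightarrow> split b X" using A unfolding spb by (auto simp: apt_def)
  have "split (\<lambda>i. E' (int i)) Y" if Y: "Y \<in> \<Union>((`) ((`) g) ` A)" for Y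
  proof -
    obtain X where X: "X \<in> \<Union>A" "Y = g ` X" using Y by blast
    have "split (\<lambda>i. g (b i)) (g ` X)"
      by (rule linear_bij_split[OF g b lattice_V[OF simplex_mem(1)[OF sA X(1)]] spA[OF X(1)]])
    then show ?thesis unfolding X(2) sp[symmetric] using split_cong[of "\<lambda>i. g (b i)" b'] gb by blast
  qed
  then show ?thesis unfolding apt_def using linear_bij_simplex[OF g sA] by blast
qed

lemma linear_bij_vertex_inverse:
  assumes g: "linear_bij g" and v: "\<And>X. X \<in> v \<Longrightarrow> X \<subseteq> V"
  shows "(`) (the_inv_into V g) ` ((`) g ` v) = v" "(`) g ` ((`) (the_inv_into V g) ` v) = v"
proof -
  have "the_inv_into V g ` (g ` X) = X" "g ` (the_inv_into V g ` X) = X" if "X \<in> v" for X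
  proof -
    have "the_inv_into V g (g x) = x" "g (the_inv_into V g x) = x" if "x \<in> X" for x
      using linear_bij_inverse(2,3)[OF g, of x] v[OF \<open>X \<in> v\<close>] that by blast+
    then show "the_inv_into V g ` (g ` X) = X" "g ` (the_inv_into V g ` X) = X"
      by (simp_all add: image_image)
  qed
  then show "(`) (the_inv_into V g) ` ((`) g ` v) = v" "(`) g ` ((`) (the_inv_into V g) ` v) = v"
    by (simp_all add: image_image[of "(`) _"])
qed

lemma apt_vertex_V: assumes "v \<in> \<Union>(apt E)" "X \<in> v" shows "X \<subseteq> V"
proof -
  obtain A where "simplex A" "v \<in> A" using assms(1) unfolding apt_def by blast
  then show ?thesis using simplex_mem(1)[of A X] assms(2) lattice_V by blast
qed

lemma linear_bij_complex_iso:
  assumes g: "linear_bij g" and b: "basis b" and b': "basis b'" and gb: "\<And>i. i \<le> n \<Longrightarrow> g (b i) = b' i"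
    and sp: "\<And>X. split b X \<longleftrightarrow> split (\<lambda>i. E (int i)) X"
    and sp': "\<And>X. split b' X \<longleftrightarrow> split (\<lambda>i. E' (int i)) X"
  shows "complex_iso (apt E) (apt E') ((`) ((`) g))"
proof -
  let ?h = "the_inv_into V g"
  have h: "linear_bij ?h" by (rule linear_bij_inverse(1)[OF g])
  have hb: "?h (b' i) = b i" if "i \<le> n" for i
    using linear_bij_inverse(2)[OF g basis_V[OF b that]] gb[OF that] by simp
  have inv1: "(`) ?h ` ((`) g ` v) = v" if "v \<in> \<Union>(apt E)" for v
    using linear_bij_vertex_inverse(1)[OF g] apt_vertex_V[OF that] by blast
  have inv2: "(`) g ` ((`) ?h ` v) = v" if "v \<in> \<Union>(apt E')" for v
    using linear_bij_vertex_inverse(2)[OF g] apt_vertex_V[OF that] by blast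
  have fw: "(`) ((`) g) ` A \<in> apt E'" if "A \<in> apt E" for A by (rule linear_bij_apt[OF g b gb sp sp' that])
  have bw: "(`) ((`) ?h) ` A \<in> apt E" if "A \<in> apt E'" for A by (rule linear_bij_apt[OF h b' hb sp' sp that])
  have bij: "bij_betw ((`) ((`) g)) (\<Union>(apt E)) (\<Union>(apt E'))"
  proof (rule bij_betw_byWitness[of _ "(`) ((`) ?h)"])
    show "(`) ((`) g) ` \<Union>(apt E) \<subseteq> \<Union>(apt E')"
    proof
      fix w assume "w \<in> (`) ((`) g) ` \<Union>(apt E)"
      then obtain A v where "A \<in> apt E" "v \<in> A" "w = (`) g ` v" by blast
      then show "w \<in> \<Union>(apt E')" using fw by blast
    qed
    show "(`) ((`) ?h) ` \<Union>(apt E') \<subseteq> \<Union>(apt E)"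
    proof
      fix w assume "w \<in> (`) ((`) ?h) ` \<Union>(apt E')"
      then obtain A v where "A \<in> apt E'" "v \<in> A" "w = (`) ?h ` v" by blast
      then show "w \<in> \<Union>(apt E)" using bw by blast
    qed
    show "\<forall>v\<in>\<Union>(apt E). (`) ?h ` ((`) g ` v) = v" by (intro ballI inv1)
    show "\<forall>v\<in>\<Union>(apt E'). (`) g ` ((`) ?h ` v) = v" by (intro ballI inv2)
  qed
  have bk: "A \<in> apt E" if A: "A \<subseteq> \<Union>(apt E)" "(`) ((`) g) ` A \<in> apt E'" for A
  proof -
    have "(`) ((`) ?h) ` ((`) ((`) g) ` A) = (\<lambda>v. (`) ?h ` ((`) g ` v)) ` A" by (rule image_image)
    also have "\<dots> = (\<lambda>v. v) ` A"
    proof (rule image_cong[OF HOL.refl])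
      fix v assume "v \<in> A"
      then have "v \<in> \<Union>(apt E)" by (rule subsetD[OF A(1)])
      then show "(`) ?h ` ((`) g ` v) = v" by (rule inv1)
    qed
    finally show ?thesis using bw[OF A(2)] by simp
  qed
  show ?thesis
    unfolding complex_iso_def
  proof (intro conjI allI impI iffI)
    fix A assume "A \<subseteq> \<Union>(apt E)" "(`) ((`) g) ` A \<in> apt E'"
    then show "A \<in> apt E" by (rule bk)
  qed (rule bij, rule fw)
qed

text \<open>The two adapted bases have equally many vectors in each cell, that is, lying in the same
  lattices of A and B. The linear map matching them cell by cell takes one apartment to the other
  and fixes each of these lattices.\<close>

lemma apt_iso:
  assumes E: "pframe E" and E': "pframe E'"
    and A: "A \<in> apt E" "A \<in> apt E'" and B: "B \<in> apt E" "B \<in> apt E'"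
  shows "\<exists>f. complex_iso (apt E) (apt E') f \<and> (\<forall>v\<in>A \<union> B. f v = v)"
proof -
  have sA: "simplex A" and sB: "simplex B" using A B by (auto simp: apt_def)
  have spE: "split (\<lambda>i. E (int i)) X" and spE': "split (\<lambda>i. E' (int i)) X" if "X \<in> \<Union>A \<union> \<Union>B" for X
    using that A B unfolding apt_def by blast+
  obtain v0 where "v0 \<in> A" using sA unfolding simplex_def by blast
  obtain X0 where X0: "X0 \<in> \<Union>A" using simplex_nonempty_class[OF sA \<open>v0 \<in> A\<close>] \<open>v0 \<in> A\<close> by (metis UnionI)
  have lX0: "lattice X0" by (rule simplex_mem(1)[OF sA X0])
  obtain b where b: "basis b" "\<And>i. i \<le> n \<Longrightarrow> b i \<in> X0" "\<And>i. i \<le> n \<Longrightarrow> b i \<notin> sc P X0"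
    "\<And>X. split b X \<longleftrightarrow> split (\<lambda>i. E (int i)) X" using adapted_basis[OF E lX0] by blast
  obtain b' where b': "basis b'" "\<And>i. i \<le> n \<Longrightarrow> b' i \<in> X0" "\<And>i. i \<le> n \<Longrightarrow> b' i \<notin> sc P X0"
    "\<And>X. split b' X \<longleftrightarrow> split (\<lambda>i. E' (int i)) X" using adapted_basis[OF E' lX0] by blast
  define cell where "cell = (\<lambda>x. {X \<in> \<Union>A \<union> \<Union>B. x \<in> X})"
  have sp: "split b X" "split b' X" if "X \<in> \<Union>A \<union> \<Union>B" for X
    unfolding b(4) b'(4) using spE[OF that] spE'[OF that] .
  have card: "card {i \<in> {..n}. cell (b i) = c} = card {i \<in> {..n}. cell (b' i) = c}" for c
    unfolding cell_def
    using cell_card_le[OF sA sB X0 b(1-3) b'(1-3) sp, of c] cell_card_le[OF sA sB X0 b'(1-3) b(1-3) sp(2,1), of c]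
    by (rule antisym)
  have "image_mset (\<lambda>i. cell (b i)) (mset_set {..n}) = image_mset (\<lambda>i. cell (b' i)) (mset_set {..n})"
    by (rule multiset_eqI) (simp only: count_image_mset_eq_card_vimage[OF finite_atMost] card)
  then obtain \<pi> where \<pi>: "\<pi> permutes {..n}" "\<forall>i\<in>{..n}. cell (b i) = cell (b' (\<pi> i))"
    using image_mset_eq_implies_permutes[of "{..n}" "\<lambda>i. cell (b i)" "\<lambda>i. cell (b' i)"] by blast
  define b2 where "b2 = (\<lambda>i. b' (\<pi> i))"
  have b2: "basis b2" "\<And>X. split b2 X \<longleftrightarrow> split b' X"
    using basis_lines[OF b'(1) permutes_imp_bij[OF \<pi>(1)], of "\<lambda>_. 1"] by (simp_all add: b2_def)
  obtain g where g: "linear_bij g" "\<And>c. g (\<Sum>i\<le>n. c i \<star> b i) = (\<Sum>i\<le>n. c i \<star> b2 i)"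
    using basis_change[OF b(1) b2(1)] by blast
  have gb: "g (b i) = b2 i" if "i \<le> n" for i
    using g(2)[of "\<lambda>j. if j = i then 1 else 0"] sum_delta_smul[of "{..n}" i 1 b] sum_delta_smul[of "{..n}" i 1 b2] that by simp
  \<comment> \<open>Instead of the vector the lattice is rescaled: the result again represents a
    vertex of A or B, and there the cells are known to agree.\<close>
  have same: "x \<star> b i \<in> X \<longleftrightarrow> x \<star> b2 i \<in> X" if i: "i \<le> n" and X: "X \<in> \<Union>A \<union> \<Union>B" for x i X
  proof (cases "x = 0")
    case False
    have sX: "submod X" using X simplex_mem(1)[OF sA] simplex_mem(1)[OF sB] lattice_submod by blast
    have F: "sc (P powi (- val x)) X \<in> \<Union>A \<union> \<Union>B" using X simplex_mem(3)[OF sA] simplex_mem(3)[OF sB] by blast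
    have "x \<star> y \<in> X \<longleftrightarrow> y \<in> sc (P powi (- val x)) X" for y
      unfolding submod_powi_mem_iff[OF sX False] by (simp add: mem_sc_iff power_int_minus divide_inverse)
    moreover have "b i \<in> sc (P powi (- val x)) X \<longleftrightarrow> b2 i \<in> sc (P powi (- val x)) X"
      using \<pi>(2) i F unfolding b2_def cell_def by blast
    ultimately show ?thesis by simp
  qed simp
  have fixed: "g ` X = X" if X: "X \<in> \<Union>A \<union> \<Union>B" for X
  proof -
    have lX: "lattice X" using X simplex_mem(1)[OF sA] simplex_mem(1)[OF sB] by blast
    note sX = lattice_submod[OF lX]
    have spb2: "split b2 X" unfolding b2(2) by (rule sp(2)[OF X])
    show ?thesis
    proof (intro equalityI subsetI)
      fix y assume "y \<in> g ` X"
      then obtain x where x: "x \<in> X" "y = g x" by blast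
      obtain c where c: "x = (\<Sum>i\<le>n. c i \<star> b i)" using basis_span[OF b(1)] lattice_V[OF lX] x(1) by blast
      have "c i \<star> b2 i \<in> X" if "i \<le> n" for i
        using splitD[OF sp(1)[OF X] x(1)[unfolded c] that] same[OF that X] by simp
      then show "y \<in> X" unfolding x(2) c g(2) by (intro submodD(5)[OF sX]) simp
    next
      fix y assume y: "y \<in> X"
      obtain c where c: "y = (\<Sum>i\<le>n. c i \<star> b2 i)" using basis_span[OF b2(1)] lattice_V[OF lX] y by blast
      have "c i \<star> b i \<in> X" if "i \<le> n" for i
        using splitD[OF spb2 y[unfolded c] that] same[OF that X] by simp
      then have "(\<Sum>i\<le>n. c i \<star> b i) \<in> X" by (intro submodD(5)[OF sX]) simp
      then show "y \<in> g ` X" using g(2)[of c] c by (metis image_eqI)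
    qed
  qed
  have sp2: "split b2 X \<longleftrightarrow> split (\<lambda>i. E' (int i)) X" for X unfolding b2(2) b'(4) ..
  have "complex_iso (apt E) (apt E') ((`) ((`) g))" by (rule linear_bij_complex_iso[OF g(1) b(1) b2(1) gb b(4) sp2])
  moreover have "(`) g ` v = v" if v: "v \<in> A \<union> B" for v
  proof -
    have "g ` X = X" if "X \<in> v" for X using fixed v that by blast
    then show ?thesis by simp
  qed
  ultimately show ?thesis by blast
qed

end

section \<open>Apartments as Coxeter complexes\<close>

context plocal
begin

lemma affine_surj: assumes "affine n f" obtains x where "f x = y"
proof -
  have "nat (y mod N) \<in> {..n}" using pos_mod_bound[of N y] by (simp only: atMost_iff) linarith
  then obtain i where i: "nat (f (int i) mod N) = nat (y mod N)"
    using affine_residue_bij[OF assms] unfolding bij_betw_def by (metis (no_types, lifting) imageE)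
  then have "f (int i) mod N = y mod N"
    using pos_mod_sign[of N y] pos_mod_sign[of N "f (int i)"] by (simp add: eq_nat_nat_iff)
  then have "N dvd y - f (int i)" by (metis mod_eq_dvd_iff)
  then obtain t where "y - f (int i) = N * t" by (rule dvdE)
  then have "f (int i + N * t) = y" using affine_mult[OF assms] by simp
  then show ?thesis by (rule that)
qed

text \<open>Both lattices are split by E, so they coincide as soon as they contain the same frame
  vectors E (f x); membership means k \<le> x for the one and l \<le> f x for the other.\<close>

lemma std_affine_eq_iff:
  assumes E: "pframe E" and f: "affine n f"
  shows "std (\<lambda>k. E (f k)) k = std E l \<longleftrightarrow> (\<forall>x. l \<le> f x \<longleftrightarrow> k \<le> x)"
proof
  note Ef = pframe_affine(1)[OF E f]
  have m: "E (f x) \<in> std E l \<longleftrightarrow> l \<le> f x" "E (f x) \<in> std (\<lambda>k. E (f k)) k \<longleftrightarrow> k \<le> x" for x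
    using mem_std_iff[OF E] mem_std_iff[OF Ef, of x k] by simp_all
  {
    assume "std (\<lambda>k. E (f k)) k = std E l"
    then show "\<forall>x. l \<le> f x \<longleftrightarrow> k \<le> x" using m by simp
  }
  assume r: "\<forall>x. l \<le> f x \<longleftrightarrow> k \<le> x"
  have same: "E y \<in> std E l \<longleftrightarrow> E y \<in> std (\<lambda>k. E (f k)) k" for y
  proof -
    obtain x where x: "f x = y" by (rule affine_surj[OF f])
    show ?thesis unfolding x[symmetric] m using r by simp
  qed
  have sp: "split (\<lambda>i. E (int i)) (std (\<lambda>k. E (f k)) k)"
    using std_split[OF Ef, of k] pframe_affine(2)[OF E f] by simp
  have "std (\<lambda>k. E (f k)) k \<subseteq> std E l"
    using split_sep[OF E lattice_std[OF E] lattice_std[OF Ef] sp] same by blast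
  moreover have "std E l \<subseteq> std (\<lambda>k. E (f k)) k"
    using split_sep[OF E lattice_std[OF Ef] lattice_std[OF E] std_split[OF E]] same by blast
  ultimately show "std (\<lambda>k. E (f k)) k = std E l" by blast
qed

lemma ch_alt: assumes "pframe F" shows "ch F = cls ` range (std F)"
proof (intro equalityI subsetI)
  fix v assume "v \<in> cls ` range (std F)"
  then obtain X where X: "X \<in> \<Union>(ch F)" "v = cls X" unfolding Union_ch[OF assms] by blast
  then show "v \<in> ch F" using simplex_mem(2)[OF simplex_ch[OF assms]] by simp
qed (auto simp: ch_def)

text \<open>A simple reflection leaves unchanged the lattice at any index k \<noteq> i between 0 and
  n, which exists as n \<ge> 1. Degrees grow by one along each chain, so agreement at k gives
  agreement at 0.\<close>

lemma deg_cgen: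
  assumes E: "pframe E" and i: "i \<le> n"
  shows "deg (std (\<lambda>k. E (cgen n i k)) 0) = deg (std E 0)"
proof -
  define k where "k = (if i = 0 then 1 else 0 :: nat)"
  have k: "k \<le> n" "k \<noteq> i" using n1 by (auto simp: k_def)
  have aff: "affine n (cgen n i)" by (rule affine_cgen[OF n1 i])
  have "std (\<lambda>k. E (cgen n i k)) (int k) = std E (int k)"
    unfolding std_affine_eq_iff[OF E aff] using cgen_ge_iff[OF n1 i k] by simp
  then show ?thesis
    using deg_std[OF E, of "int k"] deg_std[OF pframe_affine(1)[OF E aff], of "int k"] by simp
qed

lemma deg_cperm:
  assumes "pframe E" "w \<in> lists {..n}"
  shows "deg (std (\<lambda>k. E (cperm n w k)) 0) = deg (std E 0)"
  using assms
proof (induction w arbitrary: E)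
  case (Cons i w)
  then have i: "i \<le> n" by simp
  have "pframe (\<lambda>k. E (cgen n i k))" by (rule pframe_affine(1)[OF Cons.prems(1) affine_cgen[OF n1 i]])
  from Cons.IH[OF this] Cons.prems(2) show ?case using deg_cgen[OF Cons.prems(1) i] by simp
qed simp

abbreviation perm_frame :: "(int \<Rightarrow> nat \<Rightarrow> rat) \<Rightarrow> nat list \<Rightarrow> int \<Rightarrow> nat \<Rightarrow> rat" where
  "perm_frame E w \<equiv> \<lambda>k. E (cperm n w k)"

lemma pframe_perm: "pframe E \<Longrightarrow> w \<in> lists {..n} \<Longrightarrow> pframe (perm_frame E w)"
  by (rule pframe_affine(1)[OF _ affine_cperm[OF n1]])

text \<open>A class fixes its lattice only up to scaling, but both chains have the same degree at
  index 0. Comparing degrees makes the scaling trivial and the labels equal.\<close>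

lemma vertex_eq:
  assumes E: "pframe E" and w: "w \<in> lists {..n}" "u \<in> lists {..n}" and k: "k \<le> n" "l \<le> n"
    and eq: "cls (std (perm_frame E w) (int k)) = cls (std (perm_frame E u) (int l))"
  shows "k = l" "std (perm_frame E w) (int k) = std (perm_frame E u) (int k)"
proof -
  note Ew = pframe_perm[OF E w(1)] and Eu = pframe_perm[OF E w(2)]
  obtain m where m: "std (perm_frame E u) (int l) = sc (P powi m) (std (perm_frame E w) (int k))"
    using eq unfolding cls_eq_iff by blast
  then have m': "std (perm_frame E u) (int l) = std (perm_frame E w) (int k + N * m)"
    using pchain_periodic[OF pchain_std[OF Ew]] by simp
  then have e: "int l = int k + N * m"
    using deg_std[OF Eu, of "int l"] deg_std[OF Ew, of "int k + N * m"] deg_cperm[OF E w(1)] deg_cperm[OF E w(2)] by simp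
  have "int l mod N = int k mod N" unfolding e by (rule mod_mult_self2)
  moreover have "int l mod N = int l" "int k mod N = int k" using k by (simp_all add: mod_pos_pos_trivial)
  ultimately show "k = l" by (simp only: of_nat_eq_iff)
  moreover from this have "int k + N * m = int k" using e by metis
  ultimately show "std (perm_frame E w) (int k) = std (perm_frame E u) (int k)"
    using m' by metis
qed

lemma cperm_rev: assumes "w \<in> lists {..n}" shows "cperm n w (cperm n (rev w) x) = x"
proof -
  have "rev w \<in> lists {..n}" using assms by auto
  from coxeter_eq_cperm[OF n1 coxeter_eq_rev_append[OF this]] show ?thesis
    by (simp add: cperm_append fun_eq_iff)
qed

lemma perm_frame_std_eq_iff:
  assumes E: "pframe E" and w: "w \<in> lists {..n}" "u \<in> lists {..n}"
  shows "std (perm_frame E w) k = std (perm_frame E u) k \<longleftrightarrow> (\<forall>x. k \<le> cperm n (rev w @ u) x \<longleftrightarrow> k \<le> x)"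
proof -
  have l: "rev w @ u \<in> lists {..n}" using w by auto
  have e: "perm_frame E u = (\<lambda>x. perm_frame E w (cperm n (rev w @ u) x))"
    using cperm_rev[OF w(1)] by (simp add: cperm_append)
  show ?thesis
    using std_affine_eq_iff[OF pframe_perm[OF E w(1)] affine_cperm[OF n1 l], of k k] unfolding e[symmetric] by auto
qed

text \<open>The reindexing of a chamber is only an extended affine permutation. Precomposition with
  a translation keeps the chamber and adjusts its degree to that of E; the translation left after
  sorting then preserves the degree, so it is trivial and the chamber comes from a Coxeter
  word.\<close>

lemma apt_in_perm_chamber:
  assumes E: "pframe E" and A: "A \<in> apt E"
  shows "\<exists>w\<in>lists {..n}. A \<subseteq> ch (perm_frame E w)"
proof -
  obtain f where f: "affine n f" "A \<subseteq> ch (\<lambda>k. E (f k))" using apt_in_chamber[OF E A] by blast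
  note Ef = pframe_affine(1)[OF E f(1)]
  define c where "c = deg (std (\<lambda>k. E (f k)) 0) - deg (std E 0)"
  define h where "h = (\<lambda>x. f (x - c))"
  have sh: "affine n (\<lambda>x. x - c)" by (simp add: affine_def inj_def)
  have h: "affine n h" unfolding h_def using affine_comp[OF f(1) sh] by (simp add: comp_def)
  note Eh = pframe_affine(1)[OF E h]
  have std_h: "std (\<lambda>k. E (h k)) k = std (\<lambda>k. E (f k)) (k - c)" for k
    unfolding h_def using std_affine_eq_iff[OF Ef sh, of k "k - c"] by simp
  have "range (std (\<lambda>k. E (h k))) = range (std (\<lambda>k. E (f k)))"
  proof (intro equalityI subsetI)
    fix X assume "X \<in> range (std (\<lambda>k. E (f k)))"
    then obtain k where "X = std (\<lambda>k. E (f k)) k" by blast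
    then have "X = std (\<lambda>k. E (h k)) (k + c)" unfolding std_h by simp
    then show "X \<in> range (std (\<lambda>k. E (h k)))" by blast
  qed (auto simp: std_h)
  then have chh: "A \<subseteq> ch (\<lambda>k. E (h k))" using f(2) unfolding ch_alt[OF Ef] ch_alt[OF Eh] by simp
  have degh: "deg (std (\<lambda>k. E (h k)) 0) = deg (std E 0)"
    unfolding std_h using deg_std[OF Ef, of "0 - c"] by (simp add: c_def)
  obtain w where w: "descent_word n h w" using descent_word_exists[OF n1 h] by blast
  have wl: "w \<in> lists {..n}" by (rule descent_word_lists[OF w])
  obtain e where e: "\<And>x. h (cperm n w x) = x + e" using descent_word_shift[OF n1 h w] by blast
  have se: "affine n (\<lambda>x. x + e)" by (simp add: affine_def inj_def)
  have "deg (std (\<lambda>k. E (h (cperm n w k))) 0) = deg (std E 0)"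
    using deg_cperm[OF Eh wl] degh by simp
  moreover have "std (\<lambda>k. E (h (cperm n w k))) 0 = std E e"
    unfolding e using std_affine_eq_iff[OF E se, of 0 e] by simp
  ultimately have "e = 0" using deg_std[OF E, of e] by simp
  then have "h x = cperm n (rev w) x" for x
    using e[of "cperm n (rev w) x"] cperm_rev[OF wl] by simp
  then have "(\<lambda>k. E (h k)) = perm_frame E (rev w)" by simp
  moreover have "rev w \<in> lists {..n}" using wl by auto
  ultimately show ?thesis using chh by auto
qed

section \<open>Cosets of parabolic subgroups and the chambers around a simplex\<close>

lemma generate_coxeter:
  assumes "J \<subseteq> {..n}"
  shows "generate (coxeter_group n) (coxeter_gen n ` J) = coxeter_class n ` lists J"
proof (intro equalityI subsetI)
  interpret W: group "coxeter_group n" by (rule group_coxeter_group)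
  have carr: "coxeter_class n w \<in> carrier (coxeter_group n)" if "w \<in> lists {..n}" for w
    using that by (simp add: coxeter_group_def)
  have Jl: "lists J \<subseteq> lists {..n}" using assms by (rule lists_mono)
  fix x assume "x \<in> generate (coxeter_group n) (coxeter_gen n ` J)"
  then show "x \<in> coxeter_class n ` lists J"
  proof (induction rule: generate.induct)
    case one
    have "\<one>\<^bsub>coxeter_group n\<^esub> = coxeter_class n []" by (simp add: coxeter_group_def)
    then show ?case by simp
  next
    case (incl h)
    then obtain i where i: "i \<in> J" "h = coxeter_class n [i]" unfolding coxeter_gen_def by blast
    then have "[i] \<in> lists J" by simp
    then show ?case unfolding i(2) by (rule imageI)
  next
    case (inv h)
    then obtain i where i: "i \<in> J" "h = coxeter_class n [i]" unfolding coxeter_gen_def by blast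
    then have il: "[i] \<in> lists {..n}" using assms by auto
    have "coxeter_eq n ([i] @ [i]) []" using coxeter_eq_rev_append[OF il] by simp
    then have "h \<otimes>\<^bsub>coxeter_group n\<^esub> h = \<one>\<^bsub>coxeter_group n\<^esub>"
      unfolding i(2) coxeter_mult_class[OF il il]
      using il coxeter_class_eq_iff[of "[i] @ [i]" n "[]"] by (simp add: coxeter_group_def)
    then have "inv\<^bsub>coxeter_group n\<^esub> h = h" using W.inv_equality carr[OF il] i(2) by blast
    moreover have "[i] \<in> lists J" using i(1) by simp
    ultimately show ?case using i(2) by auto
  next
    case (eng h1 h2)
    then obtain u v where "u \<in> lists J" "v \<in> lists J" "h1 = coxeter_class n u" "h2 = coxeter_class n v" by blast
    moreover from this have "h1 \<otimes>\<^bsub>coxeter_group n\<^esub> h2 = coxeter_class n (u @ v)"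
      using coxeter_mult_class Jl by blast
    ultimately show ?case by auto
  qed
next
  have Jl: "lists J \<subseteq> lists {..n}" using assms by (rule lists_mono)
  fix x assume "x \<in> coxeter_class n ` lists J"
  then obtain v where v: "v \<in> lists J" "x = coxeter_class n v" by blast
  have "coxeter_class n v \<in> generate (coxeter_group n) (coxeter_gen n ` J)" using v(1)
  proof (induction v)
    case Nil
    have "\<one>\<^bsub>coxeter_group n\<^esub> = coxeter_class n []" by (simp add: coxeter_group_def)
    then show ?case using generate.one[of "coxeter_group n"] by metis
  next
    case (Cons i v)
    have l: "[i] \<in> lists {..n}" "v \<in> lists {..n}" using Cons Jl assms by auto
    have "coxeter_class n [i] \<in> generate (coxeter_group n) (coxeter_gen n ` J)"
      using Cons by (intro generate.incl) (auto simp: coxeter_gen_def)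
    then have "coxeter_class n [i] \<otimes>\<^bsub>coxeter_group n\<^esub> coxeter_class n v \<in> generate (coxeter_group n) (coxeter_gen n ` J)"
      using Cons by (intro generate.eng) auto
    then show ?case unfolding coxeter_mult_class[OF l] by simp
  qed
  then show "x \<in> generate (coxeter_group n) (coxeter_gen n ` J)" using v(2) by simp
qed

lemma coxeter_coset:
  assumes "w \<in> lists {..n}" "J \<subseteq> {..n}"
  shows "coxeter_class n w <#\<^bsub>coxeter_group n\<^esub> generate (coxeter_group n) (coxeter_gen n ` J)
    = {coxeter_class n (w @ v) | v. v \<in> lists J}"
proof -
  have "coxeter_class n w \<otimes>\<^bsub>coxeter_group n\<^esub> coxeter_class n v = coxeter_class n (w @ v)" if "v \<in> lists J" for v
    using coxeter_mult_class[OF assms(1)] that assms(2) lists_mono by blast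
  then show ?thesis unfolding generate_coxeter[OF assms(2)] l_coset_def by auto
qed

text \<open>A simplex of an apartment corresponds to the set of the chambers containing it.\<close>

definition chambers :: "(int \<Rightarrow> nat \<Rightarrow> rat) \<Rightarrow> (nat \<Rightarrow> rat) set set set \<Rightarrow> nat list set set" where
  "chambers E A = {coxeter_class n w | w. w \<in> lists {..n} \<and> A \<subseteq> ch (perm_frame E w)}"

lemma chambers_iff:
  assumes "w \<in> lists {..n}"
  shows "coxeter_class n w \<in> chambers E A \<longleftrightarrow> A \<subseteq> ch (perm_frame E w)"
proof
  assume "coxeter_class n w \<in> chambers E A"
  then obtain u where u: "coxeter_class n w = coxeter_class n u" "A \<subseteq> ch (perm_frame E u)"
    unfolding chambers_def by blast
  then have "cperm n w = cperm n u" using coxeter_class_eq_iff[OF assms] coxeter_eq_cperm[OF n1] by blast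
  then show "A \<subseteq> ch (perm_frame E w)" using u(2) by simp
qed (use assms in \<open>auto simp: chambers_def\<close>)

text \<open>The chamber of u shares with that of w the vertices labelled outside J exactly if the
  product of the inverse of w with u preserves the half-lines at these labels, that is, lies in the
  parabolic subgroup of J.\<close>

lemma chambers_coset:
  assumes E: "pframe E" and w: "w \<in> lists {..n}" and J: "J \<subset> {..n}"
    and A: "A = (\<lambda>k. cls (std (perm_frame E w) (int k))) ` ({..n} - J)"
  shows "chambers E A = coxeter_class n w <#\<^bsub>coxeter_group n\<^esub> generate (coxeter_group n) (coxeter_gen n ` J)"
proof -
  have Jn: "J \<subseteq> {..n}" using J by blast
  have rw: "rev w \<in> lists {..n}" using w by auto
  have key: "A \<subseteq> ch (perm_frame E u) \<longleftrightarrow> (\<exists>v\<in>lists J. coxeter_eq n (rev w @ u) v)" if u: "u \<in> lists {..n}" for u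
  proof -
    have "A \<subseteq> ch (perm_frame E u) \<longleftrightarrow> (\<forall>k\<in>{..n} - J. std (perm_frame E w) (int k) = std (perm_frame E u) (int k))"
    proof
      assume a: "A \<subseteq> ch (perm_frame E u)"
      show "\<forall>k\<in>{..n} - J. std (perm_frame E w) (int k) = std (perm_frame E u) (int k)"
      proof
        fix k assume k: "k \<in> {..n} - J"
        then have "cls (std (perm_frame E w) (int k)) \<in> ch (perm_frame E u)" using a A by blast
        then obtain l where "l \<le> n" "cls (std (perm_frame E w) (int k)) = cls (std (perm_frame E u) (int l))"
          unfolding ch_def by blast
        then show "std (perm_frame E w) (int k) = std (perm_frame E u) (int k)"
          using vertex_eq(2)[OF E w u] k by blast
      qed
    qed (auto simp: A ch_def)
    also have "\<dots> \<longleftrightarrow> (\<forall>k\<in>{..n} - J. \<forall>x. int k \<le> cperm n (rev w @ u) x \<longleftrightarrow> int k \<le> x)"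
      unfolding perm_frame_std_eq_iff[OF E w u] ..
    also have "\<dots> \<longleftrightarrow> (\<exists>v\<in>lists J. coxeter_eq n (rev w @ u) v)"
      by (rule cperm_parabolic_iff[OF n1 J]) (use rw u in simp)
    finally show ?thesis .
  qed
  have cancel: "coxeter_eq n (w @ rev w @ u) u" if "u \<in> lists {..n}" for u
    using coxeter_eq_append_context[OF coxeter_eq_rev_append[OF rw], of "[]" u] that by simp
  have cancel': "coxeter_eq n (rev w @ w @ u) u" if "u \<in> lists {..n}" for u
    using coxeter_eq_append_context[OF coxeter_eq_rev_append[OF w], of "[]" u] that by simp
  show ?thesis unfolding coxeter_coset[OF w Jn]
  proof (intro equalityI subsetI)
    fix x assume "x \<in> chambers E A"
    then obtain u where u: "u \<in> lists {..n}" "x = coxeter_class n u" "A \<subseteq> ch (perm_frame E u)"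
      unfolding chambers_def by blast
    then obtain v where v: "v \<in> lists J" "coxeter_eq n (rev w @ u) v" using key by blast
    have "coxeter_eq n (w @ rev w @ u) (w @ v)"
      using coxeter_eq_append_context[OF v(2) w, of "[]"] by simp
    then have "coxeter_eq n u (w @ v)" using cancel[OF u(1)] coxeter_eq.sym coxeter_eq.trans by metis
    then have "x = coxeter_class n (w @ v)" using coxeter_class_eq_iff[OF u(1)] u(2) by simp
    then show "x \<in> {coxeter_class n (w @ v) | v. v \<in> lists J}" using v(1) by blast
  next
    fix x assume "x \<in> {coxeter_class n (w @ v) | v. v \<in> lists J}"
    then obtain v where v: "v \<in> lists J" "x = coxeter_class n (w @ v)" by blast
    have vl: "v \<in> lists {..n}" using v(1) Jn lists_mono by blast
    have wv: "w @ v \<in> lists {..n}" using w vl by simp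
    have "A \<subseteq> ch (perm_frame E (w @ v))" using key[OF wv] cancel'[OF vl] v(1) by blast
    then show "x \<in> chambers E A" unfolding v(2) chambers_iff[OF wv] .
  qed
qed

lemma face_decomposition:
  assumes "A \<subseteq> ch F" "A \<noteq> {}"
  obtains J where "J \<subset> {..n}" "A = (\<lambda>k. cls (std F (int k))) ` ({..n} - J)"
proof
  let ?J = "{k \<in> {..n}. cls (std F (int k)) \<notin> A}"
  show "A = (\<lambda>k. cls (std F (int k))) ` ({..n} - ?J)"
    using assms(1) by (auto simp: ch_def)
  then show "?J \<subset> {..n}" using assms(2) by blast
qed

text \<open>Suppose a vertex v of A, with label k, is missing from B. For a chamber w around B, the
  neighbour \<open>w @ [k]\<close> has all vertices of w except the one labelled k, so it contains B
  but not A.\<close>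

lemma chambers_antimono_iff:
  assumes E: "pframe E" and A: "A \<in> apt E" and B: "B \<in> apt E"
  shows "A \<subseteq> B \<longleftrightarrow> chambers E B \<subseteq> chambers E A"
proof
  assume "A \<subseteq> B" then show "chambers E B \<subseteq> chambers E A" unfolding chambers_def by blast
next
  assume sub: "chambers E B \<subseteq> chambers E A"
  obtain w where w: "w \<in> lists {..n}" "B \<subseteq> ch (perm_frame E w)" using apt_in_perm_chamber[OF E B] by blast
  then have Aw: "A \<subseteq> ch (perm_frame E w)" using sub chambers_iff by blast
  show "A \<subseteq> B"
  proof
    fix v assume v: "v \<in> A"
    then obtain k where k: "k \<le> n" "v = cls (std (perm_frame E w) (int k))" using Aw unfolding ch_def by blast
    show "v \<in> B"
    proof (rule ccontr)
      assume nv: "v \<notin> B"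
      define u where "u = w @ [k]"
      have u: "u \<in> lists {..n}" using w k by (simp add: u_def)
      have ru: "rev w @ w \<in> lists {..n}" using w by auto
      have e: "cperm n (rev w @ u) = cgen n k"
        using coxeter_eq_cperm[OF n1 coxeter_eq_rev_append[OF w(1)]] by (auto simp: u_def cperm_append fun_eq_iff)
      have "B \<subseteq> ch (perm_frame E u)"
      proof
        fix v' assume v': "v' \<in> B"
        then obtain l where l: "l \<le> n" "v' = cls (std (perm_frame E w) (int l))" using w(2) unfolding ch_def by blast
        have "l \<noteq> k" using v' nv l k by blast
        then have "std (perm_frame E w) (int l) = std (perm_frame E u) (int l)"
          unfolding perm_frame_std_eq_iff[OF E w(1) u] e using cgen_ge_iff[OF n1 k(1) l(1)] by simp
        then show "v' \<in> ch (perm_frame E u)" unfolding ch_def l(2) using l(1) by simp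
      qed
      then have "coxeter_class n u \<in> chambers E A" using chambers_iff[OF u] sub by blast
      then have "v \<in> ch (perm_frame E u)" using chambers_iff[OF u] v by blast
      then obtain l where l: "l \<le> n" "cls (std (perm_frame E w) (int k)) = cls (std (perm_frame E u) (int l))"
        unfolding ch_def k(2) by blast
      have "std (perm_frame E w) (int k) = std (perm_frame E u) (int k)"
        by (rule vertex_eq(2)[OF E w(1) u k(1) l])
      then have "int k \<le> cgen n k (int k) \<longleftrightarrow> int k \<le> int k"
        unfolding perm_frame_std_eq_iff[OF E w(1) u] e by blast
      then show False using cgen_at(1)[OF n1 k(1)] by simp
    qed
  qed
qed

lemma apt_is_coxeter_complex:
  assumes E: "pframe E" shows "is_coxeter_complex n (apt E)"
proof -
  have "chambers E A \<in> coxeter_complex n" if A: "A \<in> apt E" for A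
  proof -
    obtain w where w: "w \<in> lists {..n}" "A \<subseteq> ch (perm_frame E w)" using apt_in_perm_chamber[OF E A] by blast
    have "A \<noteq> {}" using A unfolding apt_def simplex_def by blast
    then obtain J where J: "J \<subset> {..n}" "A = (\<lambda>k. cls (std (perm_frame E w) (int k))) ` ({..n} - J)"
      using face_decomposition[OF w(2)] by blast
    have "coxeter_class n w \<in> carrier (coxeter_group n)" using w(1) by (simp add: coxeter_group_def)
    then show ?thesis unfolding coxeter_complex_def chambers_coset[OF E w(1) J] using J(1) by blast
  qed
  moreover have "x \<in> chambers E ` apt E" if x: "x \<in> coxeter_complex n" for x
  proof -
    obtain w J where w: "w \<in> lists {..n}" "J \<subset> {..n}"
      and xw: "x = coxeter_class n w <#\<^bsub>coxeter_group n\<^esub> generate (coxeter_group n) (coxeter_gen n ` J)"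
      using x unfolding coxeter_complex_def by (auto simp: coxeter_group_def)
    define A where "A = (\<lambda>k. cls (std (perm_frame E w) (int k))) ` ({..n} - J)"
    have C: "ch (perm_frame E w) \<in> apt E" by (rule ch_in_apt[OF E affine_cperm[OF n1 w(1)]])
    have "A \<subseteq> ch (perm_frame E w)" "A \<noteq> {}" using w(2) by (auto simp: A_def ch_def)
    then have "A \<in> apt E" using C simplex_subset unfolding apt_def by blast
    moreover have "x = chambers E A" unfolding xw chambers_coset[OF E w A_def] ..
    ultimately show ?thesis by blast
  qed
  moreover have "inj_on (chambers E) (apt E)"
    by (rule inj_onI) (metis chambers_antimono_iff[OF E] subset_antisym order_refl)
  ultimately have "bij_betw (chambers E) (apt E) (coxeter_complex n)" unfolding bij_betw_def by blast
  then show ?thesis unfolding is_coxeter_complex_def using chambers_antimono_iff[OF E] by blast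
qed

section \<open>The building of lattice classes\<close>

definition bt :: "(nat \<Rightarrow> rat) set set set set" where
  "bt = Collect simplex"

lemma abstract_complex_bt: "abstract_complex bt"
proof -
  have "B \<in> bt" if "A \<in> bt" "B \<noteq> {}" "B \<subseteq> A" for A B
    using that simplex_subset[of A B] unfolding bt_def by blast
  moreover have "finite A \<and> A \<noteq> {}" if "A \<in> bt" for A using that unfolding bt_def simplex_def by blast
  ultimately show ?thesis unfolding abstract_complex_def by blast
qed

lemma abstract_complex_apt: "abstract_complex (apt E)"
proof -
  have "B \<in> apt E" if "A \<in> apt E" "B \<noteq> {}" "B \<subseteq> A" for A B
    using that simplex_subset[of A B] unfolding apt_def by blast
  moreover have "finite A \<and> A \<noteq> {}" if "A \<in> apt E" for A using that unfolding apt_def simplex_def by blast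
  ultimately show ?thesis unfolding abstract_complex_def by blast
qed

text \<open>Over the p-adic completion this is the Bruhat-Tits building of the special linear group.
  The apartments here are those of rational frames, which by \<open>common_frame\<close> already
  connect any two simplices.\<close>

theorem building_bt: "building n bt"
proof -
  have "apartment_system n bt (apt ` Collect pframe)"
    unfolding apartment_system_def
  proof (intro conjI ballI allI impI)
    fix \<Sigma> assume "\<Sigma> \<in> apt ` Collect pframe"
    then obtain E where E: "pframe E" "\<Sigma> = apt E" by blast
    show "abstract_complex \<Sigma>" unfolding E(2) by (rule abstract_complex_apt)
    show "\<Sigma> \<subseteq> bt" unfolding E(2) apt_def bt_def by blast
    show "is_coxeter_complex n \<Sigma>" unfolding E(2) by (rule apt_is_coxeter_complex[OF E(1)])
  next
    show "bt = \<Union>(apt ` Collect pframe)"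
    proof (intro equalityI subsetI)
      fix A assume "A \<in> bt"
      then have "simplex A" by (simp add: bt_def)
      then obtain E where "pframe E" "A \<in> apt E" using common_apt[of A A] by blast
      then show "A \<in> \<Union>(apt ` Collect pframe)" by blast
    qed (auto simp: apt_def bt_def)
  next
    fix A B assume "A \<in> bt" "B \<in> bt"
    then show "\<exists>\<Sigma>\<in>apt ` Collect pframe. A \<in> \<Sigma> \<and> B \<in> \<Sigma>" using common_apt[of A B] by (auto simp: bt_def)
  next
    fix \<Sigma> \<Sigma>' A B
    assume "\<Sigma> \<in> apt ` Collect pframe" "\<Sigma>' \<in> apt ` Collect pframe"
    then obtain E E' where E: "pframe E" "\<Sigma> = apt E" and E': "pframe E'" "\<Sigma>' = apt E'" by blast
    assume "A \<in> \<Sigma> \<and> B \<in> \<Sigma> \<and> A \<in> \<Sigma>' \<and> B \<in> \<Sigma>'"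
    then show "\<exists>f. complex_iso \<Sigma> \<Sigma>' f \<and> (\<forall>v\<in>A \<union> B. f v = v)"
      using apt_iso[OF E(1) E'(1), of A B] unfolding E(2) E'(2) by blast
  qed
  moreover have "bt \<noteq> {}"
  proof -
    have "simplex {cls L0}"
      using simplex_subset[OF _ _ , of _ "{cls L0}"] lattice_std_ex[OF lattice_L0] simplex_ch Union_ch simplex_mem(2)
      by (metis empty_not_insert empty_subsetI insert_subset rangeI)
    then show ?thesis by (auto simp: bt_def)
  qed
  ultimately show ?thesis unfolding building_def using abstract_complex_bt by blast
qed

lemma chamber_bt: assumes "chamber bt C" shows "\<exists>F. pframe F \<and> C = ch F"
proof -
  have C: "simplex C" "\<And>A. simplex A \<Longrightarrow> C \<subseteq> A \<Longrightarrow> A = C" using assms by (auto simp: chamber_def bt_def)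
  obtain F where "pframe F" "C \<subseteq> ch F" using simplex_in_chamber[OF C(1)] by blast
  then show ?thesis using C(2)[OF simplex_ch] by blast
qed

lemma type_function_bt: "type_function n bt vtype"
  unfolding type_function_def using chamber_bt vtype_ch_bij by blast

lemma countable_bt: "countable (\<Union>bt)"
proof -
  have "\<Union>bt \<subseteq> cls ` Collect lattice" unfolding bt_def simplex_def by blast
  then show ?thesis by (rule countable_subset[OF _ countable_image[OF countable_lattices]])
qed

end

section \<open>Transport along injections\<close>

lemma complex_image_inj:
  assumes inj: "inj_on h (\<Union>K)" and "A \<in> K" "B \<in> K"
  shows "h ` A \<subseteq> h ` B \<longleftrightarrow> A \<subseteq> B" "h ` A = h ` B \<longleftrightarrow> A = B"
proof -
  have AB: "A \<subseteq> \<Union>K" "B \<subseteq> \<Union>K" using assms(2,3) by blast+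
  show "h ` A = h ` B \<longleftrightarrow> A = B" by (rule inj_on_image_eq_iff[OF inj AB])
  show "h ` A \<subseteq> h ` B \<longleftrightarrow> A \<subseteq> B"
  proof
    assume sub: "h ` A \<subseteq> h ` B"
    show "A \<subseteq> B"
    proof
      fix x assume x: "x \<in> A"
      then have "x \<in> \<Union>K" using AB(1) by (rule subsetD[rotated])
      moreover have "h x \<in> h ` B" using sub x by (rule subsetD[OF _ imageI])
      ultimately show "x \<in> B" using inj_on_image_mem_iff[OF inj _ AB(2)] by simp
    qed
  qed (rule image_mono)
qed

lemma Union_image_image: "\<Union>((`) h ` K) = h ` \<Union>K"
  by blast

lemma abstract_complex_image:
  assumes "abstract_complex K" shows "abstract_complex ((`) h ` K)"
proof -
  have "B \<in> (`) h ` K" if AB: "A \<in> K" "B \<noteq> {}" "B \<subseteq> h ` A" for A B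
  proof -
    obtain B' where "B' \<subseteq> A" "B = h ` B'" using AB(3) by (meson subset_imageE)
    moreover from this have "B' \<noteq> {}" using AB(2) by blast
    ultimately show ?thesis using assms AB(1) unfolding abstract_complex_def by blast
  qed
  note faces = this
  show ?thesis
    unfolding abstract_complex_def
  proof (intro conjI ballI allI impI)
    fix A' assume "A' \<in> (`) h ` K"
    then obtain A where A: "A \<in> K" "A' = h ` A" by blast
    then show "finite A'" "A' \<noteq> {}" using assms unfolding abstract_complex_def by simp_all
    fix B assume "B \<noteq> {} \<and> B \<subseteq> A'"
    then show "B \<in> (`) h ` K" using faces[OF A(1)] unfolding A(2) by simp
  qed
qed

lemma is_coxeter_complex_image:
  assumes "is_coxeter_complex n K" and inj: "inj_on h (\<Union>K)"
  shows "is_coxeter_complex n ((`) h ` K)"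
proof -
  obtain f where f0: "bij_betw f K (coxeter_complex n) \<and> (\<forall>A\<in>K. \<forall>B\<in>K. A \<subseteq> B \<longleftrightarrow> f B \<subseteq> f A)"
    using assms(1) unfolding is_coxeter_complex_def by (rule exE)
  then have f: "bij_betw f K (coxeter_complex n)" "\<And>A B. A \<in> K \<Longrightarrow> B \<in> K \<Longrightarrow> A \<subseteq> B \<longleftrightarrow> f B \<subseteq> f A"
    by simp_all
  have inj': "inj_on ((`) h) K"
  proof (rule inj_onI)
    fix A B assume "A \<in> K" "B \<in> K" "h ` A = h ` B"
    then show "A = B" using complex_image_inj(2)[OF inj \<open>A \<in> K\<close> \<open>B \<in> K\<close>] by simp
  qed
  let ?k = "the_inv_into K ((`) h)"
  have k: "?k (h ` A) = A" if "A \<in> K" for A using the_inv_into_f_f[OF inj' that] .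
  have "bij_betw ?k ((`) h ` K) K" by (rule bij_betw_the_inv_into) (use inj' in \<open>simp add: bij_betw_def\<close>)
  then have "bij_betw (f \<circ> ?k) ((`) h ` K) (coxeter_complex n)" using f(1) by (rule bij_betw_trans)
  moreover have "h ` A \<subseteq> h ` B \<longleftrightarrow> (f \<circ> ?k) (h ` B) \<subseteq> (f \<circ> ?k) (h ` A)" if "A \<in> K" "B \<in> K" for A B
    using complex_image_inj(1)[OF inj that] f(2)[OF that] k that by simp
  ultimately show ?thesis unfolding is_coxeter_complex_def by (intro exI[of _ "f \<circ> ?k"]) auto
qed

lemma complex_iso_image:
  assumes f: "complex_iso K L f" and inj: "inj_on h (\<Union>K \<union> \<Union>L)"
  shows "complex_iso ((`) h ` K) ((`) h ` L) (\<lambda>v. h (f (the_inv_into (\<Union>K \<union> \<Union>L) h v)))"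
proof -
  let ?k = "the_inv_into (\<Union>K \<union> \<Union>L) h"
  let ?g = "\<lambda>v. h (f (?k v))"
  have k: "?k (h v) = v" if "v \<in> \<Union>K \<union> \<Union>L" for v by (rule the_inv_into_f_f[OF inj that])
  have bij: "bij_betw f (\<Union>K) (\<Union>L)" and f2: "\<And>A. A \<subseteq> \<Union>K \<Longrightarrow> A \<in> K \<longleftrightarrow> f ` A \<in> L"
    using f unfolding complex_iso_def by blast+
  have injK: "inj_on h (\<Union>K)" and injL: "inj_on h (\<Union>L)" using inj by (auto intro: inj_on_subset)
  have gk: "?g (h v) = h (f v)" if "v \<in> \<Union>K" for v using k[of v] that by simp
  have gim: "?g ` h ` A = h ` f ` A" if AK: "A \<subseteq> \<Union>K" for A
    unfolding image_image
  proof (rule image_cong[OF HOL.refl])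
    fix v assume "v \<in> A"
    then have "v \<in> \<Union>K" using AK by blast
    then show "?g (h v) = h (f v)" by (rule gk)
  qed
  have "inj_on ?g (h ` \<Union>K)"
  proof (rule inj_onI)
    fix x y assume "x \<in> h ` \<Union>K" "y \<in> h ` \<Union>K" and e: "?g x = ?g y"
    then obtain u v where uv: "u \<in> \<Union>K" "v \<in> \<Union>K" "x = h u" "y = h v" by blast
    then have "h (f u) = h (f v)" using e gk by simp
    moreover have "f u \<in> \<Union>L" "f v \<in> \<Union>L" using uv bij bij_betwE by blast+
    ultimately have "f u = f v" using injL by (meson inj_onD)
    then have "u = v" using bij uv unfolding bij_betw_def by (meson inj_onD)
    then show "x = y" using uv by simp
  qed
  moreover have "?g ` h ` \<Union>K = h ` \<Union>L" unfolding gim[OF subset_refl] using bij by (simp add: bij_betw_def)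
  ultimately have "bij_betw ?g (\<Union>((`) h ` K)) (\<Union>((`) h ` L))" unfolding Union_image_image bij_betw_def by blast
  moreover have "A \<in> (`) h ` K \<longleftrightarrow> ?g ` A \<in> (`) h ` L" if A: "A \<subseteq> \<Union>((`) h ` K)" for A
  proof -
    have "A \<subseteq> h ` \<Union>K" using A unfolding Union_image_image .
    then obtain B where B: "B \<subseteq> \<Union>K" "A = h ` B" by (meson subset_imageE)
    have fB: "f ` B \<subseteq> \<Union>L" using image_mono[OF B(1), of f] unfolding bij_betw_imp_surj_on[OF bij] .
    have "A \<in> (`) h ` K \<longleftrightarrow> B \<in> K"
    proof
      assume "A \<in> (`) h ` K"
      then obtain C where C: "C \<in> K" "h ` B = h ` C" using B(2) by blast
      then have "B = C" using inj_on_image_eq_iff[OF injK B(1), of C] by blast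
      then show "B \<in> K" using C by simp
    qed (use B in blast)
    also have "\<dots> \<longleftrightarrow> f ` B \<in> L" by (rule f2[OF B(1)])
    also have "\<dots> \<longleftrightarrow> h ` f ` B \<in> (`) h ` L"
    proof
      assume "h ` f ` B \<in> (`) h ` L"
      then obtain C where C: "C \<in> L" "h ` f ` B = h ` C" by blast
      then have "f ` B = C" using inj_on_image_eq_iff[OF injL fB, of C] by blast
      then show "f ` B \<in> L" using C by simp
    qed blast
    finally show ?thesis unfolding B(2) gim[OF B(1)] .
  qed
  ultimately show ?thesis unfolding complex_iso_def by blast
qed

lemma building_image:
  assumes "building n K" and inj: "inj_on h (\<Union>K)"
  shows "building n ((`) h ` K)"
proof -
  obtain \<A> where K: "abstract_complex K" "K \<noteq> {}" and A: "apartment_system n K \<A>"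
    using assms(1) unfolding building_def by blast
  have apt: "abstract_complex \<Sigma>" "\<Sigma> \<subseteq> K" "is_coxeter_complex n \<Sigma>" if "\<Sigma> \<in> \<A>" for \<Sigma>
    using A that unfolding apartment_system_def by blast+
  have U: "K = \<Union>\<A>" using A unfolding apartment_system_def by blast
  have common: "\<exists>\<Sigma>\<in>\<A>. X \<in> \<Sigma> \<and> Y \<in> \<Sigma>" if "X \<in> K" "Y \<in> K" for X Y
    using A that unfolding apartment_system_def by blast
  have iso: "\<exists>f. complex_iso \<Sigma> \<Sigma>' f \<and> (\<forall>v\<in>X \<union> Y. f v = v)"
    if "\<Sigma> \<in> \<A>" "\<Sigma>' \<in> \<A>" "X \<in> \<Sigma>" "Y \<in> \<Sigma>" "X \<in> \<Sigma>'" "Y \<in> \<Sigma>'" for \<Sigma> \<Sigma>' X Y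
    using A that unfolding apartment_system_def by blast
  have sub: "\<Union>\<Sigma> \<subseteq> \<Union>K" if "\<Sigma> \<in> \<A>" for \<Sigma> using apt(2)[OF that] by blast
  have mem: "X \<in> \<Sigma>" if X: "\<Sigma> \<in> \<A>" "X \<in> K" "h ` X \<in> (`) h ` \<Sigma>" for X \<Sigma>
  proof -
    obtain Y where Y: "Y \<in> \<Sigma>" "h ` X = h ` Y" using X(3) by blast
    then have "X = Y" using complex_image_inj(2)[OF inj X(2)] apt(2)[OF X(1)] by blast
    then show ?thesis using Y by simp
  qed
  have "apartment_system n ((`) h ` K) ((`) ((`) h) ` \<A>)"
    unfolding apartment_system_def
  proof (intro conjI ballI allI impI)
    fix S assume "S \<in> (`) ((`) h) ` \<A>"
    then obtain \<Sigma> where S: "\<Sigma> \<in> \<A>" "S = (`) h ` \<Sigma>" by blast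
    show "abstract_complex S" unfolding S(2) by (rule abstract_complex_image[OF apt(1)[OF S(1)]])
    show "S \<subseteq> (`) h ` K" unfolding S(2) using apt(2)[OF S(1)] by blast
    show "is_coxeter_complex n S" unfolding S(2)
      by (rule is_coxeter_complex_image[OF apt(3)[OF S(1)] inj_on_subset[OF inj sub[OF S(1)]]])
  next
    show "(`) h ` K = \<Union>((`) ((`) h) ` \<A>)" unfolding U by blast
  next
    fix X' Y' assume "X' \<in> (`) h ` K" "Y' \<in> (`) h ` K"
    then obtain X Y where XY: "X \<in> K" "Y \<in> K" "X' = h ` X" "Y' = h ` Y" by blast
    obtain \<Sigma> where S: "\<Sigma> \<in> \<A>" "X \<in> \<Sigma>" "Y \<in> \<Sigma>" using common[OF XY(1,2)] by blast
    then have "X' \<in> (`) h ` \<Sigma>" "Y' \<in> (`) h ` \<Sigma>" using XY by blast+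
    then show "\<exists>S\<in>(`) ((`) h) ` \<A>. X' \<in> S \<and> Y' \<in> S" using S(1) by blast
  next
    fix S S' X' Y'
    assume "S \<in> (`) ((`) h) ` \<A>" "S' \<in> (`) ((`) h) ` \<A>"
    then obtain \<Sigma> \<Sigma>' where S: "\<Sigma> \<in> \<A>" "S = (`) h ` \<Sigma>" "\<Sigma>' \<in> \<A>" "S' = (`) h ` \<Sigma>'" by blast
    assume XY': "X' \<in> S \<and> Y' \<in> S \<and> X' \<in> S' \<and> Y' \<in> S'"
    then obtain X Y where XY: "X \<in> \<Sigma>" "Y \<in> \<Sigma>" "X' = h ` X" "Y' = h ` Y" using S(2) by blast
    have K: "X \<in> K" "Y \<in> K" using XY apt(2)[OF S(1)] by blast+
    have XY2: "X \<in> \<Sigma>'" "Y \<in> \<Sigma>'" using mem[OF S(3) K(1)] mem[OF S(3) K(2)] XY' XY(3,4) S(4) by blast+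
    obtain f where f: "complex_iso \<Sigma> \<Sigma>' f" "\<forall>v\<in>X \<union> Y. f v = v" using iso[OF S(1,3) XY(1,2) XY2] by blast
    have inj2: "inj_on h (\<Union>\<Sigma> \<union> \<Union>\<Sigma>')" using inj_on_subset[OF inj] sub[OF S(1)] sub[OF S(3)] by simp
    let ?g = "\<lambda>v. h (f (the_inv_into (\<Union>\<Sigma> \<union> \<Union>\<Sigma>') h v))"
    have "complex_iso S S' ?g" unfolding S(2,4) by (rule complex_iso_image[OF f(1) inj2])
    moreover have "?g v' = v'" if v': "v' \<in> X' \<union> Y'" for v'
    proof -
      obtain v where v: "v \<in> X \<union> Y" "v' = h v" using v' XY(3,4) by blast
      have "v \<in> \<Union>\<Sigma> \<union> \<Union>\<Sigma>'" using v(1) XY(1,2) by blast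
      then have "the_inv_into (\<Union>\<Sigma> \<union> \<Union>\<Sigma>') h v' = v" unfolding v(2) by (rule the_inv_into_f_f[OF inj2])
      then show ?thesis using f(2) v by simp
    qed
    ultimately show "\<exists>f. complex_iso S S' f \<and> (\<forall>v\<in>X' \<union> Y'. f v = v)" by blast
  qed
  moreover have "(`) h ` K \<noteq> {}" using K(2) by simp
  ultimately show ?thesis unfolding building_def using abstract_complex_image[OF K(1)] by blast
qed

lemma chamber_image_iff:
  assumes inj: "inj_on h (\<Union>K)" and C: "C \<in> K"
  shows "chamber ((`) h ` K) (h ` C) \<longleftrightarrow> chamber K C"
proof -
  have "(\<forall>A\<in>(`) h ` K. h ` C \<subseteq> A \<longrightarrow> A = h ` C) \<longleftrightarrow> (\<forall>A\<in>K. C \<subseteq> A \<longrightarrow> A = C)"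
    using complex_image_inj[OF inj C] complex_image_inj(2)[OF inj _ C] by simp
  moreover have "h ` C \<in> (`) h ` K" using C by (rule imageI)
  ultimately show ?thesis unfolding chamber_def using C by (simp only: simp_thms)
qed

text \<open>
  The action is transported along the injection \<open>h\<close>, and a fixed point in the realisation forces
  the vertices of its supporting simplex to be fixed, since these have pairwise distinct types.
\<close>

lemma property_FB_fixed_vertex:
  fixes K :: "'w set set" and G :: "('g, 'm) monoid_scheme"
  assumes FB: "property_FB TYPE('v) n G" and inf: "infinite (UNIV :: 'v set)" and G: "group G"
    and K: "building n K" "type_function n K \<tau>" "countable (\<Union>K)"
    and chambers: "\<And>A. A \<in> K \<Longrightarrow> \<exists>C. chamber K C \<and> A \<subseteq> C"
    and bij: "\<And>g. g \<in> carrier G \<Longrightarrow> bij_betw (\<phi> g) (\<Union>K) (\<Union>K)"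
    and hom: "\<And>g h v. g \<in> carrier G \<Longrightarrow> h \<in> carrier G \<Longrightarrow> v \<in> \<Union>K \<Longrightarrow> \<phi> (g \<otimes>\<^bsub>G\<^esub> h) v = \<phi> g (\<phi> h v)"
    and simp: "\<And>g A. g \<in> carrier G \<Longrightarrow> A \<in> K \<Longrightarrow> \<phi> g ` A \<in> K"
    and type: "\<And>g v. g \<in> carrier G \<Longrightarrow> v \<in> \<Union>K \<Longrightarrow> \<tau> (\<phi> g v) = \<tau> v"
  shows "\<exists>v\<in>\<Union>K. \<forall>g\<in>carrier G. \<phi> g v = v"
proof -
  \<comment> \<open>The countably many vertices are numbered, and the numbers are placed in the
    infinite type that the property of G speaks about.\<close>
  obtain e :: "nat \<Rightarrow> 'v" where e: "inj e" using infinite_countable_subset[OF inf] by blast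
  obtain c :: "'w \<Rightarrow> nat" where c: "inj_on c (\<Union>K)" using K(3) by (auto simp: countable_def)
  define h where "h = e \<circ> c"
  have inj: "inj_on h (\<Union>K)" unfolding h_def using c e by (meson comp_inj_on inj_on_subset subset_UNIV)
  let ?k = "the_inv_into (\<Union>K) h"
  let ?K = "(`) h ` K"
  have k: "?k (h v) = v" if "v \<in> \<Union>K" for v by (rule the_inv_into_f_f[OF inj that])
  have UK: "\<Union>?K = h ` \<Union>K" by (rule Union_image_image)
  \<comment> \<open>Restricted to the new vertex set, since the elements of \<open>BijGroup\<close>
    are extensional functions.\<close>
  define \<psi> where "\<psi> = (\<lambda>g. restrict (\<lambda>v. h (\<phi> g (?k v))) (\<Union>?K))"
  have psi: "\<psi> g (h v) = h (\<phi> g v)" if "v \<in> \<Union>K" for g v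
  proof -
    have "h v \<in> \<Union>?K" unfolding UK using that by blast
    then show ?thesis unfolding \<psi>_def using k[OF that] by simp
  qed
  have \<phi>K: "\<phi> g v \<in> \<Union>K" if "g \<in> carrier G" "v \<in> \<Union>K" for g v
    using bij[OF that(1)] that(2) bij_betwE by blast
  have psi_bij: "bij_betw (\<psi> g) (\<Union>?K) (\<Union>?K)" if g: "g \<in> carrier G" for g
    unfolding bij_betw_def UK
  proof
    show "inj_on (\<psi> g) (h ` \<Union>K)"
    proof (rule inj_onI)
      fix x y assume "x \<in> h ` \<Union>K" "y \<in> h ` \<Union>K" and e: "\<psi> g x = \<psi> g y"
      then obtain u v where uv: "u \<in> \<Union>K" "v \<in> \<Union>K" "x = h u" "y = h v" by blast
      have "h (\<phi> g u) = h (\<phi> g v)" using e unfolding uv(3,4) psi[OF uv(1)] psi[OF uv(2)] .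
      then have "\<phi> g u = \<phi> g v" using inj_onD[OF inj _ \<phi>K[OF g uv(1)] \<phi>K[OF g uv(2)]] by blast
      then have "u = v" using bij[OF g] uv unfolding bij_betw_def by (meson inj_onD)
      then show "x = y" using uv by simp
    qed
    have "\<psi> g ` h ` \<Union>K = h ` \<phi> g ` \<Union>K" unfolding image_image by (rule image_cong) (simp_all add: psi)
    then show "\<psi> g ` h ` \<Union>K = h ` \<Union>K" using bij[OF g] by (simp add: bij_betw_def)
  qed
  have psi_im: "\<psi> g ` h ` A = h ` \<phi> g ` A" if "A \<in> K" for g A
    unfolding image_image by (rule image_cong) (use that psi in blast)+
  have "group_action G (\<Union>?K) \<psi>"
    unfolding group_action_def group_hom_def group_hom_axioms_def
  proof (intro conjI G group_BijGroup)
    show "\<psi> \<in> hom G (BijGroup (\<Union>?K))"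
    proof (rule homI)
      fix g assume g: "g \<in> carrier G"
      show "\<psi> g \<in> carrier (BijGroup (\<Union>?K))"
        using psi_bij[OF g] by (simp add: BijGroup_def Bij_def \<psi>_def)
    next
      fix g g' assume g: "g \<in> carrier G" "g' \<in> carrier G"
      have B: "\<psi> g \<in> Bij (\<Union>?K)" "\<psi> g' \<in> Bij (\<Union>?K)"
        using psi_bij g by (simp_all add: Bij_def \<psi>_def)
      have "\<psi> (g \<otimes>\<^bsub>G\<^esub> g') = compose (\<Union>?K) (\<psi> g) (\<psi> g')"
      proof
        fix v'
        show "\<psi> (g \<otimes>\<^bsub>G\<^esub> g') v' = compose (\<Union>?K) (\<psi> g) (\<psi> g') v'"
        proof (cases "v' \<in> \<Union>?K")
          case True
          then obtain v where v: "v \<in> \<Union>K" "v' = h v" unfolding UK by blast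
          have "compose (\<Union>?K) (\<psi> g) (\<psi> g') v' = \<psi> g (\<psi> g' v')" using True by (simp add: compose_def)
          also have "\<dots> = h (\<phi> g (\<phi> g' v))" unfolding v(2) psi[OF v(1)] psi[OF \<phi>K[OF g(2) v(1)]] ..
          also have "\<dots> = \<psi> (g \<otimes>\<^bsub>G\<^esub> g') v'" unfolding v(2) psi[OF v(1)] using hom[OF g v(1)] by simp
          finally show ?thesis by simp
        next
          case False
          then show ?thesis by (simp add: \<psi>_def compose_def restrict_def)
        qed
      qed
      then show "\<psi> (g \<otimes>\<^bsub>G\<^esub> g') = \<psi> g \<otimes>\<^bsub>BijGroup (\<Union>?K)\<^esub> \<psi> g'"
        using B by (simp add: BijGroup_def)
    qed
  qed
  moreover have "\<psi> g ` A \<in> ?K" if g: "g \<in> carrier G" and A: "A \<in> ?K" for g A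
  proof -
    obtain B where B: "B \<in> K" "A = h ` B" using A by blast
    show ?thesis unfolding B(2) psi_im[OF B(1)] using simp[OF g B(1)] by blast
  qed
  ultimately have act: "simplicial_action G ?K \<psi>" unfolding simplicial_action_def by blast
  have tf: "type_function n ?K (\<tau> \<circ> ?k)"
    unfolding type_function_def
  proof (intro allI impI)
    fix C' assume C': "chamber ?K C'"
    then obtain C where C: "C \<in> K" "C' = h ` C" unfolding chamber_def by blast
    then have "chamber K C" using C' chamber_image_iff[OF inj C(1)] by simp
    then have "bij_betw \<tau> C {..n}" using K(2) unfolding type_function_def by blast
    moreover have "bij_betw ?k C' C"
    proof -
      have "C \<subseteq> \<Union>K" using C(1) by blast
      then have "inj_on h C" using inj inj_on_subset by blast
      moreover have "?k v = the_inv_into C h v" if v: "v \<in> C'" for v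
      proof -
        obtain u where u: "u \<in> C" "v = h u" using v C(2) by blast
        then show ?thesis using k[of u] the_inv_into_f_f[OF \<open>inj_on h C\<close> u(1)] \<open>C \<subseteq> \<Union>K\<close> by auto
      qed
      ultimately show ?thesis
        using bij_betw_the_inv_into[of h C C'] C(2) bij_betw_cong[of C' ?k "the_inv_into C h" C] by (simp add: bij_betw_def)
    qed
    ultimately show "bij_betw (\<tau> \<circ> ?k) C' {..n}" using bij_betw_trans by blast
  qed
  have tp: "type_preserving G ?K (\<tau> \<circ> ?k) \<psi>"
    unfolding type_preserving_def
  proof (intro ballI)
    fix g v' assume g: "g \<in> carrier G" and "v' \<in> \<Union>?K"
    then obtain v where v: "v \<in> \<Union>K" "v' = h v" unfolding UK by blast
    show "(\<tau> \<circ> ?k) (\<psi> g v') = (\<tau> \<circ> ?k) v'"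
      unfolding v(2) psi[OF v(1)] comp_apply k[OF v(1)] k[OF \<phi>K[OF g v(1)]] by (rule type[OF g v(1)])
  qed
  have "has_fixed_point G ?K \<psi>"
    using FB building_image[OF K(1) inj] tf act tp unfolding property_FB_def by blast
  then obtain x where x: "x \<in> realisation ?K" "\<And>g. g \<in> carrier G \<Longrightarrow> realisation_map (\<psi> g) x = x"
    unfolding has_fixed_point_def by blast
  then have "{v. x v \<noteq> 0} \<in> ?K" unfolding realisation_def by blast
  then obtain A where A: "A \<in> K" "{v. x v \<noteq> 0} = h ` A" by blast
  obtain C where C: "chamber K C" "A \<subseteq> C" using chambers[OF A(1)] by blast
  have "inj_on \<tau> C" using K(2) C(1) unfolding type_function_def bij_betw_def by blast
  then have tinj: "inj_on \<tau> A" using C(2) inj_on_subset by blast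
  have "A \<noteq> {}" using K(1) A(1) unfolding building_def abstract_complex_def by blast
  then obtain v where v: "v \<in> A" by blast
  then have vK: "v \<in> \<Union>K" using A(1) by blast
  have "\<phi> g v = v" if g: "g \<in> carrier G" for g
  proof -
    \<comment> \<open>As the coordinate at the image of v is non-zero, some vertex u of the
      supporting simplex must be mapped to v; u and v have the same type and lie in one
      chamber.\<close>
    have "x (h v) \<noteq> 0" using A(2) v by blast
    moreover have "realisation_map (\<psi> g) x (h v) = x (h v)" by (simp only: x(2)[OF g])
    ultimately have "(\<Sum>u | x u \<noteq> 0 \<and> \<psi> g u = h v. x u) \<noteq> 0"
      unfolding realisation_map_def by (simp only: not_False_eq_True)
    then have "{u. x u \<noteq> 0 \<and> \<psi> g u = h v} \<noteq> {}" by (metis sum.empty)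
    then obtain u' where u': "x u' \<noteq> 0" "\<psi> g u' = h v" by blast
    then obtain u where u: "u \<in> A" "u' = h u" using A(2) by blast
    have uK: "u \<in> \<Union>K" using u(1) A(1) by blast
    have "h (\<phi> g u) = h v" using u'(2) unfolding u(2) psi[OF uK] .
    then have e: "\<phi> g u = v" using inj_onD[OF inj _ \<phi>K[OF g uK] vK] by blast
    then have "\<tau> u = \<tau> v" using type[OF g uK] by simp
    then have "u = v" using inj_onD[OF tinj _ u(1) v] by blast
    then show ?thesis using e by simp
  qed
  then show ?thesis using vK by blast
qed

section \<open>Invariant quadratic forms\<close>

definition mat_app :: "nat \<Rightarrow> rat mat \<Rightarrow> (nat \<Rightarrow> rat) \<Rightarrow> nat \<Rightarrow> rat" where
  "mat_app n M x = (\<lambda>i. \<Sum>j\<le>n. M $$ (i, j) * x j)"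

definition quad :: "nat \<Rightarrow> rat mat \<Rightarrow> (nat \<Rightarrow> rat) \<Rightarrow> rat" where
  "quad n A x = (\<Sum>i\<le>n. \<Sum>j\<le>n. A $$ (i, j) * x i * x j)"

text \<open>The bilinear form q(x + y) - q(x) - q(y). Its matrix is A plus its transpose, hence
  symmetric even if A is not.\<close>

definition polar :: "nat \<Rightarrow> rat mat \<Rightarrow> (nat \<Rightarrow> rat) \<Rightarrow> (nat \<Rightarrow> rat) \<Rightarrow> rat" where
  "polar n A x y = (\<Sum>i\<le>n. \<Sum>j\<le>n. (A $$ (i, j) + A $$ (j, i)) * x i * y j)"

lemma mat_app_vec:
  assumes "M \<in> carrier_mat (Suc n) (Suc n)"
  shows "M *\<^sub>v vec (Suc n) x = vec (Suc n) (mat_app n M x)"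
  using assms
  by (intro eq_vecI) (auto simp: mat_app_def scalar_prod_def lessThan_Suc_atMost atLeast0LessThan simp del: sum.lessThan_Suc)

lemma quad_vec:
  assumes "A \<in> carrier_mat (Suc n) (Suc n)"
  shows "vec (Suc n) x \<bullet> (A *\<^sub>v vec (Suc n) x) = quad n A x"
proof -
  have "vec (Suc n) x \<bullet> (A *\<^sub>v vec (Suc n) x) = (\<Sum>i\<in>{0..<Suc n}. x i * mat_app n A x i)"
    unfolding mat_app_vec[OF assms] by (simp add: scalar_prod_def del: sum.op_ivl_Suc)
  also have "{0..<Suc n} = {..n}" by auto
  also have "(\<Sum>i\<le>n. x i * mat_app n A x i) = quad n A x"
    by (simp add: mat_app_def quad_def sum_distrib_left mult_ac)
  finally show ?thesis .
qed

lemma quad_combination: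
  "quad n A (\<lambda>i. a * x i + b * y i) = a\<^sup>2 * quad n A x + a * b * polar n A x y + b\<^sup>2 * quad n A y"
proof -
  have "(\<Sum>i\<le>n. \<Sum>j\<le>n. A $$ (j, i) * x i * y j) = (\<Sum>i\<le>n. \<Sum>j\<le>n. A $$ (i, j) * y i * x j)"
    by (subst sum.swap) (simp add: mult_ac)
  then have "polar n A x y = (\<Sum>i\<le>n. \<Sum>j\<le>n. A $$ (i, j) * x i * y j) + (\<Sum>i\<le>n. \<Sum>j\<le>n. A $$ (i, j) * y i * x j)"
    by (simp add: polar_def distrib_right sum.distrib)
  moreover have "quad n A (\<lambda>i. a * x i + b * y i) = a\<^sup>2 * quad n A x
      + a * b * ((\<Sum>i\<le>n. \<Sum>j\<le>n. A $$ (i, j) * x i * y j) + (\<Sum>i\<le>n. \<Sum>j\<le>n. A $$ (i, j) * y i * x j)) + b\<^sup>2 * quad n A y"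
    unfolding quad_def by (simp add: sum.distrib[symmetric] sum_distrib_left power2_eq_square algebra_simps)
  ultimately show ?thesis by simp
qed

lemma polar_self: "polar n A x x = 2 * quad n A x"
  using quad_combination[of n A 1 x 1 x] quad_combination[of n A 2 x 0 x] by simp

lemma mat_app_add: "mat_app n M (\<lambda>i. x i + y i) = (\<lambda>i. mat_app n M x i + mat_app n M y i)"
  by (simp add: mat_app_def distrib_left sum.distrib)

lemma mat_app_std_vec: "j \<le> n \<Longrightarrow> mat_app n M (std_vec j) i = M $$ (i, j)"
proof -
  assume j: "j \<le> n"
  have "(\<Sum>k\<le>n. M $$ (i, k) * (if k = j then 1 else 0)) = (\<Sum>k\<le>n. if k = j then M $$ (i, k) else 0)"
    by (rule sum.cong) auto
  then show ?thesis using j by (simp add: mat_app_def std_vec_def)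
qed

lemma polar_std_vec: assumes "i \<le> n" "j \<le> n" shows "polar n A (std_vec i) (std_vec j) = A $$ (i, j) + A $$ (j, i)"
proof -
  have delta: "(\<Sum>l\<le>n. f l * std_vec m l) = f m" if "m \<le> n" for f and m
  proof -
    have "(\<Sum>l\<le>n. f l * std_vec m l) = (\<Sum>l\<le>n. if l = m then f l else 0)"
      by (rule sum.cong) (auto simp: std_vec_def)
    then show ?thesis using that by simp
  qed
  show ?thesis unfolding polar_def by (simp only: delta[OF assms(1)] delta[OF assms(2)])
qed

text \<open>The Gram matrix S of the polar form is invertible by definiteness, and invariance gives
  S = M^T S M; taking determinants yields the first claim. For the second, each coordinate is the
  pairing with a fixed dual vector, so Cauchy-Schwarz bounds the column M e_j by the value of the
  form at e_j, which M does not change.\<close>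

lemma invariant_form_det_bounded:
  assumes q: "quadratic_form (Suc n) q" "positive_definite (Suc n) q"
    and H: "H \<subseteq> carrier_mat (Suc n) (Suc n)" "invariant_form (Suc n) H q"
  shows "\<forall>M\<in>H. (det M)\<^sup>2 = 1" "\<exists>C. \<forall>M\<in>H. \<forall>i\<le>n. \<forall>j\<le>n. (M $$ (i, j))\<^sup>2 \<le> C"
proof -
  obtain A where A: "A \<in> carrier_mat (Suc n) (Suc n)" "\<forall>v\<in>carrier_vec (Suc n). q v = v \<bullet> (A *\<^sub>v v)"
    using q(1) unfolding quadratic_form_def by blast
  have qQ: "q (vec (Suc n) x) = quad n A x" for x using A(2) quad_vec[OF A(1)] by simp
  have pos: "quad n A x > 0" if i: "i \<le> n" "x i \<noteq> 0" for x i
  proof -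
    have "vec (Suc n) x $ i \<noteq> 0" using i by simp
    then have "vec (Suc n) x \<noteq> 0\<^sub>v (Suc n)" using i(1) by (metis index_zero_vec(1) le_imp_less_Suc)
    then have "q (vec (Suc n) x) > 0" using q(2) unfolding positive_definite_def by simp
    then show ?thesis unfolding qQ .
  qed
  have nonneg: "quad n A x \<ge> 0" for x
  proof (cases "\<exists>i\<le>n. x i \<noteq> 0")
    case True
    then show ?thesis using pos by (meson less_imp_le)
  qed (simp add: quad_def)
  have invQ: "quad n A (mat_app n M x) = quad n A x" if M: "M \<in> H" for M x
  proof -
    have "q (M *\<^sub>v vec (Suc n) x) = q (vec (Suc n) x)" using H(2) M unfolding invariant_form_def by simp
    then show ?thesis using mat_app_vec H(1) M qQ by (metis subsetD)
  qed
  have invB: "polar n A (mat_app n M x) (mat_app n M y) = polar n A x y" if M: "M \<in> H" for M x y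
    using quad_combination[of n A 1 x 1 y] quad_combination[of n A 1 "mat_app n M x" 1 "mat_app n M y"]
      invQ[OF M, of x] invQ[OF M, of y] invQ[OF M, of "\<lambda>i. x i + y i"] by (simp add: mat_app_add)
  define S where "S = mat (Suc n) (Suc n) (\<lambda>(i, j). A $$ (i, j) + A $$ (j, i))"
  have S: "S \<in> carrier_mat (Suc n) (Suc n)" by (simp add: S_def)
  have polarS: "polar n A x y = (\<Sum>i\<le>n. x i * mat_app n S y i)" for x y
    unfolding polar_def mat_app_def by (intro sum.cong) (auto simp: S_def sum_distrib_left mult_ac)
  have detS: "det S \<noteq> 0"
  proof
    assume "det S = 0"
    then obtain v where v: "v \<in> carrier_vec (Suc n)" "v \<noteq> 0\<^sub>v (Suc n)" "S *\<^sub>v v = 0\<^sub>v (Suc n)"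
      using det_0_iff_vec_prod_zero_field[OF S] by blast
    define x where "x = (\<lambda>i. v $ i)"
    have vx: "v = vec (Suc n) x" using v(1) by (auto simp: x_def)
    have "mat_app n S x i = 0" if "i \<le> n" for i
    proof -
      have "vec (Suc n) (mat_app n S x) $ i = 0\<^sub>v (Suc n) $ i"
        using v(3) unfolding vx mat_app_vec[OF S] by simp
      then show ?thesis using that by simp
    qed
    then have "polar n A x x = 0" unfolding polarS by simp
    then have "quad n A x = 0" by (simp add: polar_self)
    moreover obtain i where "i \<le> n" "x i \<noteq> 0"
    proof -
      have "\<exists>i<Suc n. x i \<noteq> 0"
      proof (rule ccontr)
        assume "\<not> (\<exists>i<Suc n. x i \<noteq> 0)"
        then have "v = 0\<^sub>v (Suc n)" unfolding vx by (intro eq_vecI) auto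
        then show False using v(2) by simp
      qed
      then show ?thesis using that by (meson less_Suc_eq_le)
    qed
    ultimately show False using pos by (metis less_irrefl)
  qed
  show "\<forall>M\<in>H. (det M)\<^sup>2 = 1"
  proof
    fix M assume M: "M \<in> H"
    have Mc: "M \<in> carrier_mat (Suc n) (Suc n)" using H(1) M by blast
    have "transpose_mat M * (S * M) = S"
    proof (rule eq_matI)
      fix i j assume "i < dim_row S" "j < dim_col S"
      then have ij: "i \<le> n" "j \<le> n" by (simp_all add: S_def)
      have "(transpose_mat M * (S * M)) $$ (i, j) = (\<Sum>k\<in>{0..<Suc n}. M $$ (k, i) * (\<Sum>l\<in>{0..<Suc n}. S $$ (k, l) * M $$ (l, j)))"
        using Mc S ij by (simp add: scalar_prod_def del: sum.op_ivl_Suc)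
      also have "{0..<Suc n} = {..n}" by auto
      also have "(\<Sum>k\<le>n. M $$ (k, i) * (\<Sum>l\<le>n. S $$ (k, l) * M $$ (l, j)))
          = (\<Sum>k\<le>n. mat_app n M (std_vec i) k * mat_app n S (mat_app n M (std_vec j)) k)"
        unfolding mat_app_std_vec[OF ij(1)] mat_app_def[of n S] mat_app_std_vec[OF ij(2)] ..
      also have "\<dots> = polar n A (std_vec i) (std_vec j)" unfolding polarS[symmetric] by (rule invB[OF M])
      also have "\<dots> = S $$ (i, j)" using ij by (simp add: polar_std_vec S_def)
      finally show "(transpose_mat M * (S * M)) $$ (i, j) = S $$ (i, j)" .
    qed (use Mc S in auto)
    then have "det S = det (transpose_mat M) * (det S * det M)"
      using det_mult[of "transpose_mat M" "Suc n" "S * M"] det_mult[OF S Mc] Mc S by simp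
    then have "det S = det M * (det S * det M)" using det_transpose[OF Mc] by simp
    then show "(det M)\<^sup>2 = 1" using detS by (simp add: power2_eq_square)
  qed
  have "S \<in> Units (ring_mat TYPE(rat) (Suc n) ())" by (rule det_non_zero_imp_unit[OF S detS])
  then obtain S' where S': "S' \<in> carrier_mat (Suc n) (Suc n)" "S * S' = 1\<^sub>m (Suc n)"
    unfolding Units_def ring_mat_def by auto
  \<comment> \<open>The columns of the inverse Gram matrix: pairing with the i-th one reads off the
    i-th coordinate.\<close>
  define w where "w = (\<lambda>i k. S' $$ (k, i))"
  have Bw: "polar n A x (w i) = x i" if i: "i \<le> n" for x i
  proof -
    have "mat_app n S (w i) k = (if k = i then 1 else 0)" if k: "k \<le> n" for k
    proof -
      have "(S * S') $$ (k, i) = (\<Sum>l\<in>{0..<Suc n}. S $$ (k, l) * S' $$ (l, i))"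
        using S S'(1) i k by (simp add: scalar_prod_def del: sum.op_ivl_Suc)
      also have "{0..<Suc n} = {..n}" by auto
      finally show ?thesis using S'(2) i k by (simp add: mat_app_def w_def)
    qed
    then have "polar n A x (w i) = (\<Sum>k\<le>n. if k = i then x k else 0)"
      unfolding polarS by (intro sum.cong) auto
    then show ?thesis using i by simp
  qed
  have cs: "(x i)\<^sup>2 \<le> 4 * quad n A (w i) * quad n A x" if i: "i \<le> n" for x i
  proof -
    have "\<exists>k\<le>n. w i k \<noteq> 0"
    proof (rule ccontr)
      assume "\<not> (\<exists>k\<le>n. w i k \<noteq> 0)"
      then have "polar n A (std_vec i) (w i) = 0" by (simp add: polar_def)
      then show False using Bw[OF i] by (simp add: std_vec_def)
    qed
    then have Qw: "quad n A (w i) > 0" using pos by blast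
    \<comment> \<open>Up to the factor 2 q(w i), this vector is the component of x orthogonal to w
      i; that the form is nonnegative there is Cauchy-Schwarz.\<close>
    have "0 \<le> quad n A (\<lambda>k. (2 * quad n A (w i)) * x k + (- x i) * w i k)" by (rule nonneg)
    also have "\<dots> = quad n A (w i) * (4 * quad n A (w i) * quad n A x - (x i)\<^sup>2)"
      unfolding quad_combination Bw[OF i] by (simp add: power2_eq_square algebra_simps)
    finally show ?thesis using Qw by (simp add: zero_le_mult_iff)
  qed
  \<comment> \<open>The individual bounds are nonnegative, so their sum bounds every entry at
    once.\<close>
  define C where "C = (\<Sum>i\<le>n. \<Sum>j\<le>n. 4 * quad n A (w i) * quad n A (std_vec j))"
  have "(M $$ (i, j))\<^sup>2 \<le> C" if M: "M \<in> H" and ij: "i \<le> n" "j \<le> n" for M i j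
  proof -
    have "(M $$ (i, j))\<^sup>2 \<le> 4 * quad n A (w i) * quad n A (std_vec j)"
      using cs[OF ij(1), of "mat_app n M (std_vec j)"] unfolding invQ[OF M] mat_app_std_vec[OF ij(2)] .
    also have "\<dots> \<le> (\<Sum>j\<le>n. 4 * quad n A (w i) * quad n A (std_vec j))"
      by (rule member_le_sum[of j "{..n}" "\<lambda>j. 4 * quad n A (w i) * quad n A (std_vec j)"]) (use ij nonneg in auto)
    also have "\<dots> \<le> C" unfolding C_def
      by (rule member_le_sum[of i "{..n}" "\<lambda>i. \<Sum>j\<le>n. 4 * quad n A (w i) * quad n A (std_vec j)"])
        (use ij nonneg in \<open>auto intro!: sum_nonneg\<close>)
    finally show ?thesis .
  qed
  then show "\<exists>C. \<forall>M\<in>H. \<forall>i\<le>n. \<forall>j\<le>n. (M $$ (i, j))\<^sup>2 \<le> C" by blast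
qed

section \<open>Bounded denominators\<close>

context plocal
begin

lemma vertex_image_bij:
  assumes g: "linear_bij g" shows "bij_betw ((`) ((`) g)) (\<Union>bt) (\<Union>bt)"
proof -
  let ?h = "the_inv_into V g"
  have h: "linear_bij ?h" by (rule linear_bij_inverse(1)[OF g])
  have V: "X \<subseteq> V" if "v \<in> \<Union>bt" "X \<in> v" for v X
  proof -
    obtain A where A: "simplex A" "v \<in> A" using \<open>v \<in> \<Union>bt\<close> unfolding bt_def by blast
    have "X \<in> \<Union>A" using A(2) that(2) by (rule UnionI)
    then show ?thesis using simplex_mem(1)[OF A(1)] lattice_V by blast
  qed
  have im: "(`) f ` v \<in> \<Union>bt" if f: "linear_bij f" and v: "v \<in> \<Union>bt" for f v
  proof -
    obtain A where A: "simplex A" "v \<in> A" using v unfolding bt_def by blast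
    have "(`) ((`) f) ` A \<in> bt" using linear_bij_simplex[OF f A(1)] by (simp add: bt_def)
    moreover have "(`) f ` v \<in> (`) ((`) f) ` A" using A(2) by (rule imageI)
    ultimately show ?thesis by (rule UnionI)
  qed
  show ?thesis
  proof (rule bij_betw_byWitness[of _ "(`) ((`) ?h)"])
    show "\<forall>v\<in>\<Union>bt. (`) ?h ` ((`) g ` v) = v" by (intro ballI linear_bij_vertex_inverse(1)[OF g] V)
    show "\<forall>v\<in>\<Union>bt. (`) g ` ((`) ?h ` v) = v" by (intro ballI linear_bij_vertex_inverse(2)[OF g] V)
    show "(`) ((`) g) ` \<Union>bt \<subseteq> \<Union>bt" by (intro image_subsetI im[OF g])
    show "(`) ((`) ?h) ` \<Union>bt \<subseteq> \<Union>bt" by (intro image_subsetI im[OF h])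
  qed
qed

lemma GL_ratD:
  assumes "M \<in> carrier (GL_rat (Suc n))"
  shows "M \<in> carrier_mat (Suc n) (Suc n)" "linear_bij (act M)"
proof -
  have "M \<in> carrier_mat (Suc n) (Suc n) \<and> (\<exists>M'\<in>carrier_mat (Suc n) (Suc n). M' * M = 1\<^sub>m (Suc n) \<and> M * M' = 1\<^sub>m (Suc n))"
    using assms by (simp add: GL_rat_def units_of_def Units_def ring_mat_def)
  then show "M \<in> carrier_mat (Suc n) (Suc n)" "linear_bij (act M)" using act_linear_bij by blast+
qed

lemma bt_vertex: assumes "v \<in> \<Union>bt" obtains X where "lattice X" "v = cls X"
proof -
  obtain A where A: "simplex A" "v \<in> A" using assms unfolding bt_def by blast
  show ?thesis by (rule simplex_nonempty_class[OF A]) (rule that)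
qed

text \<open>It already has n + 1 vertices, the largest number possible for a simplex.\<close>

lemma chamber_ch: assumes F: "pframe F" shows "chamber bt (ch F)"
  unfolding chamber_def bt_def
proof (intro conjI ballI impI)
  show "ch F \<in> Collect simplex" using simplex_ch[OF F] by simp
  fix A assume A: "A \<in> Collect simplex" "ch F \<subseteq> A"
  then have "finite A" by (simp add: simplex_def)
  moreover have "card A \<le> card (ch F)" using simplex_card[of A] A(1) card_ch[OF F] by simp
  ultimately show "A = ch F" using card_seteq[of A "ch F"] A(2) by simp
qed

text \<open>A fixed vertex is only a class, so a group element takes its representative X to p^m X.
  Determinants of valuation 0 preserve the degree, which forces m = 0.\<close>

lemma fixed_lattice:
  fixes G :: "('g, 'm) monoid_scheme"
  assumes FB: "property_FB TYPE('v) n G" and inf: "infinite (UNIV :: 'v set)" and G: "group G"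
    and \<rho>: "\<rho> \<in> hom G (GL_rat (Suc n))" and det: "\<And>g. g \<in> carrier G \<Longrightarrow> val (det (\<rho> g)) = 0"
  shows "\<exists>X. lattice X \<and> (\<forall>g\<in>carrier G. act (\<rho> g) ` X = X)"
proof -
  have GL: "\<rho> g \<in> carrier (GL_rat (Suc n))" if "g \<in> carrier G" for g using \<rho> that by (auto simp: hom_def)
  note mat = GL_ratD(1)[OF GL] and lin = GL_ratD(2)[OF GL]
  have mult: "act (\<rho> (g \<otimes>\<^bsub>G\<^esub> h)) x = act (\<rho> g) (act (\<rho> h) x)" if "g \<in> carrier G" "h \<in> carrier G" for g h x
  proof -
    have "\<rho> (g \<otimes>\<^bsub>G\<^esub> h) = \<rho> g * \<rho> h" using hom_mult[OF \<rho> that] by (simp add: GL_rat_def units_of_def ring_mat_def)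
    then show ?thesis using act_mult[OF mat mat] that by simp
  qed
  have "\<exists>v\<in>\<Union>bt. \<forall>g\<in>carrier G. (`) (act (\<rho> g)) ` v = v"
  proof (rule property_FB_fixed_vertex[OF FB inf G building_bt type_function_bt countable_bt])
    fix A assume "A \<in> bt"
    then obtain F where F: "pframe F" "A \<subseteq> ch F" using simplex_in_chamber[of A] by (auto simp: bt_def)
    then show "\<exists>C. chamber bt C \<and> A \<subseteq> C" using chamber_ch by blast
  next
    fix g assume g: "g \<in> carrier G"
    show "bij_betw ((`) ((`) (act (\<rho> g)))) (\<Union>bt) (\<Union>bt)" by (rule vertex_image_bij[OF lin[OF g]])
    show "(`) ((`) (act (\<rho> g))) ` A \<in> bt" if "A \<in> bt" for A
      using linear_bij_simplex[OF lin[OF g]] that by (simp add: bt_def)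
    show "vtype ((`) (act (\<rho> g)) ` v) = vtype v" if v: "v \<in> \<Union>bt" for v
    proof -
      obtain X where X: "lattice X" "v = cls X" by (rule bt_vertex[OF v])
      have "(`) (act (\<rho> g)) ` v = cls (act (\<rho> g) ` X)" unfolding X(2) by (rule linear_bij_cls[OF lin[OF g] lattice_V[OF X(1)]])
      then show ?thesis
        using vtype_cls[OF X(1)] vtype_cls[OF linear_bij_lattice[OF lin[OF g] X(1)]]
          deg_act[OF mat[OF g] lin[OF g] X(1)] det[OF g] X(2) by simp
    qed
    fix h v assume h: "h \<in> carrier G"
    have "act (\<rho> (g \<otimes>\<^bsub>G\<^esub> h)) ` X = act (\<rho> g) ` act (\<rho> h) ` X" for X
      unfolding image_image by (rule image_cong[OF HOL.refl]) (rule mult[OF g h])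
    then show "(`) (act (\<rho> (g \<otimes>\<^bsub>G\<^esub> h))) ` v = (`) (act (\<rho> g)) ` ((`) (act (\<rho> h)) ` v)"
      by (simp add: image_image[of "(`) _"])
  qed
  then obtain v where v: "v \<in> \<Union>bt" and v': "\<forall>g\<in>carrier G. (`) (act (\<rho> g)) ` v = v" by (rule bexE)
  obtain X where X: "lattice X" "v = cls X" by (rule bt_vertex[OF v])
  have "act (\<rho> g) ` X = X" if g: "g \<in> carrier G" for g
  proof -
    have "X \<in> v" unfolding X(2) by simp
    then have "act (\<rho> g) ` X \<in> (`) (act (\<rho> g)) ` v" by (rule imageI)
    then have "act (\<rho> g) ` X \<in> v" by (simp only: bspec[OF v' g])
    then have "act (\<rho> g) ` X \<in> cls X" by (simp only: X(2))
    then obtain m where m: "act (\<rho> g) ` X = sc (P powi m) X" unfolding cls_def by blast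
    then have "deg X = deg X + N * m"
      using deg_act[OF mat[OF g] lin[OF g] X(1)] det[OF g] deg_sc[OF X(1), of m] by simp
    then have "m = 0" by simp
    then show ?thesis using m by simp
  qed
  then show ?thesis using X(1) by blast
qed

text \<open>If p^m takes \<open>L0\<close> into X and X into \<open>L0\<close>, then a matrix
  stabilising X sends p^m e_j into X, so p^(2 m) M e_j is p-integral. The exponent depends on X
  alone.\<close>

lemma fixed_lattice_entries:
  assumes X: "lattice X"
  shows "\<exists>c. \<forall>M. act M ` X = X \<longrightarrow> (\<forall>i\<le>n. \<forall>j\<le>n. P ^ c * M $$ (i, j) \<in> ring_p)"
proof -
  obtain m where m: "sc (P ^ m) L0 \<subseteq> X" "sc (P ^ m) X \<subseteq> L0" using X unfolding lattice_def by blast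
  have "P ^ (m + m) * M $$ (i, j) \<in> ring_p" if M: "act M ` X = X" and ij: "i \<le> n" "j \<le> n" for M i j
  proof -
    have "std_vec j \<in> L0" using ij(2) by (auto simp: L0_def vspace_def std_vec_def)
    then have "P ^ m \<star> std_vec j \<in> X" using m(1) by (auto simp: sc_def)
    then have "act M (P ^ m \<star> std_vec j) \<in> X" using M by blast
    then have "P ^ m \<star> act M (P ^ m \<star> std_vec j) \<in> L0" using m(2) unfolding sc_def by blast
    then have "(P ^ m \<star> act M (P ^ m \<star> std_vec j)) i \<in> ring_p" unfolding L0_def by blast
    moreover have "(P ^ m \<star> act M (P ^ m \<star> std_vec j)) i = P ^ (m + m) * M $$ (i, j)"
    proof -
      have "(\<Sum>k\<le>n. M $$ (i, k) * (P ^ m * std_vec j k)) = (\<Sum>k\<le>n. if k = j then P ^ m * M $$ (i, k) else 0)"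
        by (rule sum.cong) (auto simp: std_vec_def)
      then show ?thesis using ij by (simp add: act_def power_add)
    qed
    ultimately show ?thesis by simp
  qed
  then show ?thesis by blast
qed

end

section \<open>From all primes together to finitely many matrices\<close>

lemma finite_bad_primes:
  fixes T :: "rat set" and n :: nat
  assumes "finite T" and n: "n \<ge> 1"
  shows "finite {p. prime p \<and> \<not> T \<subseteq> plocal.ring_p p}"
proof -
  have "x \<in> plocal.ring_p p" if p: "prime p" "\<not> int p dvd snd (quotient_of x)" for p x
  proof -
    interpret plocal p n using p(1) n by unfold_locales
    obtain a b where ab: "quotient_of x = (a, b)" by (cases "quotient_of x")
    then have "x = of_int a / of_int b" by (rule quotient_of_div)
    then show ?thesis unfolding ring_p_def using p(2) ab by auto
  qed
  then have sub: "{p. prime p \<and> \<not> T \<subseteq> plocal.ring_p p} \<subseteq> (\<Union>x\<in>T. {p. int p dvd snd (quotient_of x)})" by blast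
  have "finite {p. int p dvd snd (quotient_of x)}" for x :: rat
  proof -
    have pos: "snd (quotient_of x) > 0" by (cases "quotient_of x") (simp add: quotient_of_denom_pos)
    have "{p. int p dvd snd (quotient_of x)} \<subseteq> {..nat (snd (quotient_of x))}"
      using pos by (auto dest!: zdvd_imp_le)
    then show ?thesis by (rule finite_subset) simp
  qed
  then have "finite (\<Union>x\<in>T. {p. int p dvd snd (quotient_of x)})" using assms(1) by (intro finite_UN_I)
  then show ?thesis by (rule finite_subset[OF sub])
qed

text \<open>A prime dividing the reduced denominator would, by p-integrality of x, divide the
  numerator as well.\<close>

lemma rat_integral_of_local:
  fixes n :: nat
  assumes n: "n \<ge> 1" and loc: "\<And>p. prime p \<Longrightarrow> x \<in> plocal.ring_p p"
  shows "x \<in> \<int>"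
proof -
  obtain a b where ab: "quotient_of x = (a, b)" by (cases "quotient_of x")
  have x: "x = of_int a / of_int b" and b: "b > 0" and cop: "coprime a b"
    using quotient_of_div[OF ab] quotient_of_denom_pos[OF ab] quotient_of_coprime[OF ab] by simp_all
  have "b = 1"
  proof (rule ccontr)
    assume "b \<noteq> 1"
    then have "nat b \<noteq> 1" using b by simp
    then obtain p where p: "prime p" "p dvd nat b" using prime_factor_nat by blast
    then have pb: "int p dvd b" using b by (metis int_nat_eq int_dvd_int_iff less_imp_le)
    interpret plocal p n using p(1) n by unfold_locales
    obtain c d where cd: "x = of_int c / of_int d" "\<not> int p dvd d" using loc[OF p(1)] unfolding ring_p_def by blast
    then have "d \<noteq> 0" by auto
    then have "(of_int (a * d) :: rat) = of_int (c * b)" using x cd(1) b by (simp add: field_simps)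
    then have "a * d = c * b" by (simp only: of_int_eq_iff)
    then have "int p dvd a * d" using pb by simp
    then have "int p dvd a" using cd(2) prime_int prime_dvd_mult_iff by blast
    then have "is_unit (int p)" using cop pb coprime_common_divisor by blast
    then show False using prime_int not_prime_unit by blast
  qed
  then show ?thesis using x by simp
qed

text \<open>Each D M i j is an integer k with k^2 \<le> D^2 C, so all entries come from one finite
  set.\<close>

lemma finite_bounded_matrices:
  assumes H: "H \<subseteq> carrier_mat d d" and D: "D \<noteq> (0 :: rat)"
    and int: "\<And>M i j. M \<in> H \<Longrightarrow> i < d \<Longrightarrow> j < d \<Longrightarrow> D * M $$ (i, j) \<in> \<int>"
    and bound: "\<And>M i j. M \<in> H \<Longrightarrow> i < d \<Longrightarrow> j < d \<Longrightarrow> (M $$ (i, j))\<^sup>2 \<le> C"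
  shows "finite H"
proof -
  define R where "R = \<lceil>D\<^sup>2 * C\<rceil>"
  define F where "F = (\<lambda>k. of_int k / D) ` {- R..R}"
  have entry: "M $$ (i, j) \<in> F" if M: "M \<in> H" "i < d" "j < d" for M i j
  proof -
    obtain k where k: "D * M $$ (i, j) = of_int k" using int[OF M] by (auto elim: Ints_cases)
    have "of_int (k\<^sup>2) = D\<^sup>2 * (M $$ (i, j))\<^sup>2" using k by (simp add: power_mult_distrib[symmetric])
    also have "\<dots> \<le> D\<^sup>2 * C" using bound[OF M] by (intro mult_left_mono) auto
    also have "\<dots> \<le> of_int R" unfolding R_def by (rule le_of_int_ceiling)
    finally have "k\<^sup>2 \<le> R" by (simp only: of_int_le_iff)
    moreover have "\<bar>k\<bar> \<le> k\<^sup>2"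
    proof -
      have "\<bar>k\<bar> * 1 \<le> \<bar>k\<bar> * \<bar>k\<bar>" if "k \<noteq> 0" using that by (intro mult_left_mono) simp_all
      then show ?thesis by (cases "k = 0") (simp_all add: power2_eq_square)
    qed
    ultimately have "k \<in> {- R..R}" by auto
    moreover have "M $$ (i, j) = of_int k / D" using k D by (simp add: field_simps)
    ultimately show ?thesis unfolding F_def by blast
  qed
  have "H \<subseteq> (\<lambda>f. mat d d f) ` (({..<d} \<times> {..<d}) \<rightarrow>\<^sub>E F)"
  proof
    fix M assume M: "M \<in> H"
    define f where "f = restrict (\<lambda>ij. M $$ ij) ({..<d} \<times> {..<d})"
    have "f \<in> ({..<d} \<times> {..<d}) \<rightarrow>\<^sub>E F" unfolding f_def using entry[OF M] by auto
    moreover have "M = mat d d f"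
    proof (rule eq_matI)
      show "dim_row M = dim_row (mat d d f)" "dim_col M = dim_col (mat d d f)" using H M by auto
      fix i j assume "i < dim_row (mat d d f)" "j < dim_col (mat d d f)"
      then show "M $$ (i, j) = mat d d f $$ (i, j)" by (simp add: f_def)
    qed
    ultimately show "M \<in> (\<lambda>f. mat d d f) ` (({..<d} \<times> {..<d}) \<rightarrow>\<^sub>E F)" by blast
  qed
  moreover have "finite ((\<lambda>f. mat d d f) ` (({..<d} \<times> {..<d}) \<rightarrow>\<^sub>E F))"
    by (intro finite_imageI finite_PiE) (auto simp: F_def)
  ultimately show ?thesis by (rule finite_subset)
qed

text \<open>Matrices with p-integral entries are closed under products but not under inverses, so
  the entries of the inverses of the generators are controlled as well.\<close>

lemma generated_entries:
  assumes G: "group G" and \<rho>: "\<rho> \<in> hom G (GL_rat (Suc n))" and S: "S \<subseteq> carrier G" "generate G S = carrier G"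
    and p: "prime p" and n: "n \<ge> 1"
    and T: "\<And>s i j. s \<in> S \<Longrightarrow> i \<le> n \<Longrightarrow> j \<le> n \<Longrightarrow> \<rho> s $$ (i, j) \<in> plocal.ring_p p \<and> \<rho> (inv\<^bsub>G\<^esub> s) $$ (i, j) \<in> plocal.ring_p p"
    and g: "g \<in> carrier G" and ij: "i \<le> n" "j \<le> n"
  shows "\<rho> g $$ (i, j) \<in> plocal.ring_p p"
proof -
  interpret G: group G by (rule G)
  interpret plocal p n using p n by unfold_locales
  have GLG: "group (GL_rat (Suc n))"
  proof -
    interpret R: ring "ring_mat TYPE(rat) (Suc n) ()" by (rule ring_mat)
    show ?thesis unfolding GL_rat_def by (rule R.units_group)
  qed
  have mat: "\<rho> h \<in> carrier_mat (Suc n) (Suc n)" if "h \<in> carrier G" for h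
    using \<rho> that GL_ratD(1) by (auto simp: hom_def)
  have "\<forall>i\<le>n. \<forall>j\<le>n. \<rho> h $$ (i, j) \<in> ring_p" if "h \<in> generate G S" for h
    using that
  proof (induction rule: generate.induct)
    case one
    have "\<rho> \<one>\<^bsub>G\<^esub> = \<one>\<^bsub>GL_rat (Suc n)\<^esub>" by (rule hom_one[OF \<rho> G GLG])
    then show ?case by (auto simp: GL_rat_def units_of_def ring_mat_def)
  next
    case (eng h1 h2)
    have h: "h1 \<in> carrier G" "h2 \<in> carrier G" using eng S(2) by simp_all
    have "\<rho> (h1 \<otimes>\<^bsub>G\<^esub> h2) = \<rho> h1 * \<rho> h2" using hom_mult[OF \<rho> h] by (simp add: GL_rat_def units_of_def ring_mat_def)
    moreover have "(\<rho> h1 * \<rho> h2) $$ (i, j) \<in> ring_p" if ij: "i \<le> n" "j \<le> n" for i j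
    proof -
      have "(\<rho> h1 * \<rho> h2) $$ (i, j) = (\<Sum>k\<in>{0..<Suc n}. \<rho> h1 $$ (i, k) * \<rho> h2 $$ (k, j))"
        using mat[OF h(1)] mat[OF h(2)] ij by (simp add: scalar_prod_def del: sum.op_ivl_Suc)
      also have "\<dots> \<in> ring_p" using eng.IH ij by (intro ring_p_sum ring_p_mult) auto
      finally show ?thesis .
    qed
    ultimately show ?case by simp
  qed (use T in auto)
  then show ?thesis using g ij S(2) by blast
qed

theorem theoremC:
  fixes G :: "('g, 'm) monoid_scheme"
    and n :: nat
    and \<rho> :: "'g \<Rightarrow> rat mat"
  assumes "n \<ge> 1"
    and "group G"
    and "finitely_generated G"
    and "infinite (UNIV :: 'v set)"
    and "property_FB TYPE('v) n G"
    and "\<rho> \<in> hom G (GL_rat (n + 1))"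
    and "\<exists>q. quadratic_form (n + 1) q \<and> positive_definite (n + 1) q
           \<and> invariant_form (n + 1) (\<rho> ` carrier G) q"
  shows "finite (\<rho> ` carrier G)"
proof -
  note n = assms(1) and G = assms(2) and inf = assms(4) and FB = assms(5)
  have \<rho>: "\<rho> \<in> hom G (GL_rat (Suc n))" using assms(6) by simp
  interpret G: group G by (rule G)
  let ?H = "\<rho> ` carrier G"
  obtain q where q: "quadratic_form (Suc n) q" "positive_definite (Suc n) q" "invariant_form (Suc n) ?H q"
    using assms(7) by auto
  have mat: "\<rho> g \<in> carrier_mat (Suc n) (Suc n)" if "g \<in> carrier G" for g
  proof -
    have "\<rho> g \<in> carrier (GL_rat (Suc n))" using \<rho> that by (auto simp: hom_def)
    then show ?thesis by (simp add: GL_rat_def units_of_def Units_def ring_mat_def)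
  qed
  then have H: "?H \<subseteq> carrier_mat (Suc n) (Suc n)" by blast
  note form = invariant_form_det_bounded[OF q(1,2) H q(3)]
  obtain C where C: "\<And>M i j. M \<in> ?H \<Longrightarrow> i \<le> n \<Longrightarrow> j \<le> n \<Longrightarrow> (M $$ (i, j))\<^sup>2 \<le> C" using form(2) by blast
  obtain S where S: "finite S" "S \<subseteq> carrier G" "generate G S = carrier G"
    using assms(3) unfolding finitely_generated_def by blast
  define T where "T = (\<lambda>(s, i, j). \<rho> s $$ (i, j)) ` ((S \<union> (\<lambda>s. inv\<^bsub>G\<^esub> s) ` S) \<times> {..n} \<times> {..n})"
  have finT: "finite T" unfolding T_def using S(1) by simp
  define bad where "bad = {p. prime p \<and> \<not> T \<subseteq> plocal.ring_p p}"
  have finbad: "finite bad" unfolding bad_def by (rule finite_bad_primes[OF finT n])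
  have good: "\<rho> g $$ (i, j) \<in> plocal.ring_p p"
    if p: "prime p" "p \<notin> bad" and g: "g \<in> carrier G" and ij: "i \<le> n" "j \<le> n" for p g i j
  proof (rule generated_entries[OF G \<rho> S(2,3) p(1) n _ g ij])
    fix s i j assume s: "s \<in> S" "i \<le> n" "j \<le> n"
    have sub: "T \<subseteq> plocal.ring_p p" using p unfolding bad_def by blast
    have "\<rho> s $$ (i, j) \<in> T" unfolding T_def using s by (intro image_eqI[of _ _ "(s, i, j)"]) auto
    moreover have "\<rho> (inv\<^bsub>G\<^esub> s) $$ (i, j) \<in> T" unfolding T_def using s by (intro image_eqI[of _ _ "(inv\<^bsub>G\<^esub> s, i, j)"]) auto
    ultimately show "\<rho> s $$ (i, j) \<in> plocal.ring_p p \<and> \<rho> (inv\<^bsub>G\<^esub> s) $$ (i, j) \<in> plocal.ring_p p" using sub by blast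
  qed
  have "\<exists>c. \<forall>g\<in>carrier G. \<forall>i\<le>n. \<forall>j\<le>n. of_nat p ^ c * \<rho> g $$ (i, j) \<in> plocal.ring_p p" if p: "prime p" for p
  proof -
    interpret plocal p n using p n by unfold_locales
    have "val (det (\<rho> g)) = 0" if "g \<in> carrier G" for g
    proof -
      have "(det (\<rho> g))\<^sup>2 = 1" using form(1) that by blast
      then have "det (\<rho> g) * det (\<rho> g) = 1" by (simp add: power2_eq_square)
      then have "val (det (\<rho> g) * det (\<rho> g)) = 0" "det (\<rho> g) \<noteq> 0" by auto
      then show ?thesis by (simp add: val_mult)
    qed
    then obtain X where X: "lattice X" "\<And>g. g \<in> carrier G \<Longrightarrow> act (\<rho> g) ` X = X"
      using fixed_lattice[OF FB inf G \<rho>] by blast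
    obtain e where e: "\<forall>M. act M ` X = X \<longrightarrow> (\<forall>i\<le>n. \<forall>j\<le>n. P ^ e * M $$ (i, j) \<in> ring_p)"
      using fixed_lattice_entries[OF X(1)] by (rule exE)
    show ?thesis
    proof (intro exI[of _ e] ballI allI impI)
      fix g i j assume "g \<in> carrier G" "i \<le> n" "j \<le> n"
      then show "P ^ e * \<rho> g $$ (i, j) \<in> ring_p" using e X(2) by simp
    qed
  qed
  then obtain c where c: "\<And>p g i j. prime p \<Longrightarrow> g \<in> carrier G \<Longrightarrow> i \<le> n \<Longrightarrow> j \<le> n \<Longrightarrow>
      of_nat p ^ c p * \<rho> g $$ (i, j) \<in> plocal.ring_p p" by metis
  \<comment> \<open>At a bad prime the exponent comes from the stabilised lattice; at the remaining
    primes the entries are p-integral by finite generation, so the product over the bad primes is a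
    common denominator.\<close>
  define D where "D = (\<Prod>p\<in>bad. of_nat p ^ c p :: rat)"
  have "of_nat p ^ c p \<noteq> (0 :: rat)" if "p \<in> bad" for p
  proof -
    have "p \<noteq> 0" using that prime_gt_0_nat[of p] unfolding bad_def by auto
    then show ?thesis by simp
  qed
  then have D0: "D \<noteq> 0" unfolding D_def using prod_zero_iff[OF finbad, of "\<lambda>p. of_nat p ^ c p :: rat"] by blast
  show ?thesis
  proof (rule finite_bounded_matrices[OF H D0])
    fix M i j assume "M \<in> ?H" and "i < Suc n" "j < Suc n"
    then obtain g where g: "g \<in> carrier G" "M = \<rho> g" and ij: "i \<le> n" "j \<le> n" by auto
    show "(M $$ (i, j))\<^sup>2 \<le> C" using C g ij by blast
    show "D * M $$ (i, j) \<in> \<int>"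
    proof (rule rat_integral_of_local[OF n])
      fix p :: nat assume p: "prime p"
      interpret plocal p n using p n by unfold_locales
      show "D * M $$ (i, j) \<in> ring_p"
      proof (cases "p \<in> bad")
        case True
        have "D = of_nat p ^ c p * (\<Prod>p\<in>bad - {p}. of_nat p ^ c p)"
          unfolding D_def by (rule prod.remove[OF finbad True])
        then have D: "D * M $$ (i, j) = (\<Prod>p\<in>bad - {p}. of_nat p ^ c p) * (of_nat p ^ c p * M $$ (i, j))" by simp
        have bad: "(\<Prod>p\<in>bad - {p}. of_nat p ^ c p :: rat) \<in> ring_p" by (intro ring_p_prod ring_p_power ring_p_of_nat)
        show ?thesis unfolding D unfolding g(2) by (rule ring_p_mult[OF bad c[OF p g(1) ij]])
      next
        case False
        have "D \<in> ring_p" unfolding D_def by (intro ring_p_prod ring_p_power ring_p_of_nat)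
        then show ?thesis using ring_p_mult good[OF p False g(1) ij] g(2) by simp
      qed
    qed
  qed
qed

end
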